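(* Let $\mathcal L$ be a first-order language, in either classical or continuous logic, which extends the language of groups. Let $\{G_i : i\in I\}$ be a family of $\mathcal L$-structures each of which expands an amenable group, let $\mathcal U$ be a countably incomplete ultrafilter on $I$, and let $G=\prod_{\mathcal U}G_i$. Suppose $\tau\colon G\to K$ is a definable group homomorphism, where $K$ is a compact Lie group. Then there are group homomorphisms $\tau_i\colon G_i\to K$, for $i\in I$, such that $\tau=\lim_{\mathcal U}\tau_i$, i.e. for every $a\in G$ and every representative $(a_i)_{i\in I}$ of $a$, $\tau(a)=\lim_{\mathcal U}\tau_i(a_i)$.
   Context: A (discrete) group is amenable if it admits a left-invariant finitely additive probability measure defined on all of its subsets. An ultrafilter $\mathcal U$ on $I$ is countably incomplete if it contains a countable family of sets whose common intersection is empty. For an $\mathcal L$-structure $M$ and a compact Hausdorff space $C$, a map $f\colon M^x\to C$ is definable if there is a continuous function $f^*\colon S_x(M)\to C$ on the space of complete types over $M$ with $f^*(\operatorname{tp}(a/M))=f(a)$ for all $a\in M^x$ (in classical logic this is equivalent to: for all closed $D\subseteq C$ and open $V\subseteq C$ with $D\subseteq V$, there is a definable set $X$ with $f^{-1}(D)\subseteq X\subseteq f^{-1}(V)$). Here $\tau_i$ are not required to be definable. *)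

theory Defs
  imports "HOL-Analysis.Analysis" "HOL-Algebra.Coset"
begin

section \<open>Amenable groups and ultrafilters\<close>

definition amenable_group :: "('a, 'z) monoid_scheme \<Rightarrow> bool" where
  "amenable_group G \<longleftrightarrow> group G \<and>
     (\<exists>\<mu> :: 'a set \<Rightarrow> real.
        (\<forall>A \<subseteq> carrier G. 0 \<le> \<mu> A) \<and>
        \<mu> (carrier G) = 1 \<and>
        (\<forall>A \<subseteq> carrier G. \<forall>B \<subseteq> carrier G. A \<inter> B = {} \<longrightarrow> \<mu> (A \<union> B) = \<mu> A + \<mu> B) \<and>
        (\<forall>g \<in> carrier G. \<forall>A \<subseteq> carrier G. \<mu> (g <#\<^bsub>G\<^esub> A) = \<mu> A))"

text \<open>An ultrafilter on the (nonempty) index type is a filter in the sense of the library; a set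
  \<open>S\<close> belongs to it iff \<open>\<forall>\<^sub>F i in \<U>. i \<in> S\<close>. Principal ultrafilters are allowed.\<close>

definition ultrafilter :: "'i filter \<Rightarrow> bool" where
  "ultrafilter \<U> \<longleftrightarrow>
     \<U> \<noteq> bot \<and> (\<forall>S. (\<forall>\<^sub>F i in \<U>. i \<in> S) \<or> (\<forall>\<^sub>F i in \<U>. i \<notin> S))"

definition countably_incomplete :: "'i filter \<Rightarrow> bool" where
  "countably_incomplete \<U> \<longleftrightarrow>
     (\<exists>\<F>. countable \<F> \<and> (\<forall>S \<in> \<F>. \<forall>\<^sub>F i in \<U>. i \<in> S) \<and> \<Inter>\<F> = {})"


section \<open>Lie groups\<close>

text \<open>Real \<open>n\<close>-space is the library's \<^const>\<open>Euclidean_space\<close>, whose points are the functions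
  \<open>nat \<Rightarrow> real\<close> vanishing from \<open>n\<close> on. In contrast to the class \<^class>\<open>euclidean_space\<close> this
  includes \<open>n = 0\<close>, which is needed for finite groups to be Lie groups.\<close>

primrec Ck_on :: "nat \<Rightarrow> nat \<Rightarrow> (nat \<Rightarrow> real) set \<Rightarrow> ((nat \<Rightarrow> real) \<Rightarrow> real) \<Rightarrow> bool" where
  "Ck_on 0 n V f \<longleftrightarrow> continuous_map (subtopology (Euclidean_space n) V) euclideanreal f"
| "Ck_on (Suc k) n V f \<longleftrightarrow>
     continuous_map (subtopology (Euclidean_space n) V) euclideanreal f \<and>
     (\<forall>i<n. \<exists>g. (\<forall>x\<in>V. ((\<lambda>t. f (x(i := t))) has_real_derivative g x) (at (x i))) \<and>
                Ck_on k n V g)"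

text \<open>Used only for open subsets \<open>V\<close> of \<open>n\<close>-space.\<close>

definition smooth_on :: "nat \<Rightarrow> (nat \<Rightarrow> real) set \<Rightarrow> ((nat \<Rightarrow> real) \<Rightarrow> nat \<Rightarrow> real) \<Rightarrow> bool" where
  "smooth_on n V f \<longleftrightarrow> (\<forall>k j. Ck_on k n V (\<lambda>x. f x j))"

type_synonym 'k chart = "'k set \<times> ('k \<Rightarrow> nat \<Rightarrow> real)"

definition is_chart :: "nat \<Rightarrow> 'k topology \<Rightarrow> 'k chart \<Rightarrow> bool" where
  "is_chart n T c \<longleftrightarrow> (case c of (V, \<phi>) \<Rightarrow>
     openin T V \<and> openin (Euclidean_space n) (\<phi> ` V) \<and>
     homeomorphic_map (subtopology T V) (subtopology (Euclidean_space n) (\<phi> ` V)) \<phi>)"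

definition smooth_atlas :: "nat \<Rightarrow> 'k topology \<Rightarrow> 'k chart set \<Rightarrow> bool" where
  "smooth_atlas n T \<A> \<longleftrightarrow>
     (\<forall>c \<in> \<A>. is_chart n T c) \<and>
     (\<Union>(V, \<phi>) \<in> \<A>. V) = topspace T \<and>
     (\<forall>(V, \<phi>) \<in> \<A>. \<forall>(W, \<psi>) \<in> \<A>. smooth_on n (\<phi> ` (V \<inter> W)) (\<lambda>x. \<psi> (inv_into V \<phi> x)))"

text \<open>The two halves of a point of \<open>2n\<close>-space, identified with pairs of points of \<open>n\<close>-space.\<close>

definition fst_half :: "nat \<Rightarrow> (nat \<Rightarrow> real) \<Rightarrow> nat \<Rightarrow> real" where
  "fst_half n z = (\<lambda>i. if i < n then z i else 0)"

definition snd_half :: "nat \<Rightarrow> (nat \<Rightarrow> real) \<Rightarrow> nat \<Rightarrow> real" where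
  "snd_half n z = (\<lambda>i. if i < n then z (n + i) else 0)"

definition Lie_group ::
  "nat \<Rightarrow> ('k, 'z) monoid_scheme \<Rightarrow> 'k topology \<Rightarrow> 'k chart set \<Rightarrow> bool" where
  "Lie_group n K T \<A> \<longleftrightarrow>
     group K \<and> topspace T = carrier K \<and> Hausdorff_space T \<and> second_countable T \<and>
     smooth_atlas n T \<A> \<and>
     continuous_map (prod_topology T T) T (\<lambda>(x, y). x \<otimes>\<^bsub>K\<^esub> y) \<and>
     continuous_map T T (\<lambda>x. inv\<^bsub>K\<^esub> x) \<and>
     (\<forall>(V, \<phi>) \<in> \<A>. \<forall>(W, \<psi>) \<in> \<A>. \<forall>(Z, \<theta>) \<in> \<A>.
        smooth_on (2 * n)
          {z \<in> topspace (Euclidean_space (2 * n)).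
             fst_half n z \<in> \<phi> ` V \<and> snd_half n z \<in> \<psi> ` W \<and>
             inv_into V \<phi> (fst_half n z) \<otimes>\<^bsub>K\<^esub> inv_into W \<psi> (snd_half n z) \<in> Z}
          (\<lambda>z. \<theta> (inv_into V \<phi> (fst_half n z) \<otimes>\<^bsub>K\<^esub> inv_into W \<psi> (snd_half n z)))) \<and>
     (\<forall>(V, \<phi>) \<in> \<A>. \<forall>(W, \<psi>) \<in> \<A>.
        smooth_on n
          {x \<in> \<phi> ` V. inv\<^bsub>K\<^esub> (inv_into V \<phi> x) \<in> W}
          (\<lambda>x. \<psi> (inv\<^bsub>K\<^esub> (inv_into V \<phi> x))))"


section \<open>Languages and terms\<close>

text \<open>A one-sorted first-order language with distinguished symbols of the language of groups.
  The symbols are sets rather than whole types, so that there may be no relation symbols.\<close>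

record ('f, 'r) lang =
  fun_syms :: "'f set"
  rel_syms :: "'r set"
  fun_arity :: "'f \<Rightarrow> nat"
  rel_arity :: "'r \<Rightarrow> nat"
  mult_sym :: 'f
  inv_sym :: 'f
  one_sym :: 'f

definition extends_group_language :: "('f, 'r, 'z) lang_scheme \<Rightarrow> bool" where
  "extends_group_language L \<longleftrightarrow>
     {mult_sym L, inv_sym L, one_sym L} \<subseteq> fun_syms L \<and>
     fun_arity L (mult_sym L) = 2 \<and> fun_arity L (inv_sym L) = 1 \<and> fun_arity L (one_sym L) = 0"

text \<open>The part of a structure common to classical and continuous logic.\<close>

record ('a, 'f) fun_structure =
  univ :: "'a set"
  fn :: "'f \<Rightarrow> 'a list \<Rightarrow> 'a"

definition tuples :: "'a set \<Rightarrow> nat \<Rightarrow> 'a list set" where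
  "tuples X n = {xs. set xs \<subseteq> X \<and> length xs = n}"

definition group_reduct ::
  "('f, 'r, 'y) lang_scheme \<Rightarrow> ('a, 'f, 'z) fun_structure_scheme \<Rightarrow> 'a monoid" where
  "group_reduct L M =
     \<lparr>carrier = univ M, mult = (\<lambda>x y. fn M (mult_sym L) [x, y]), one = fn M (one_sym L) []\<rparr>"

definition expands_amenable_group ::
  "('f, 'r, 'y) lang_scheme \<Rightarrow> ('a, 'f, 'z) fun_structure_scheme \<Rightarrow> bool" where
  "expands_amenable_group L M \<longleftrightarrow>
     amenable_group (group_reduct L M) \<and>
     (\<forall>x \<in> univ M. fn M (inv_sym L) [x] = inv\<^bsub>group_reduct L M\<^esub> x)"

text \<open>Terms and formulas may contain elements of a structure as parameters, so that
  \<open>L(M)\<close>-formulas need no separate language.\<close>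

datatype ('a, 'f) trm = Var nat | Param 'a | App 'f "('a, 'f) trm list"

fun trm_vars :: "('a, 'f) trm \<Rightarrow> nat set" where
  "trm_vars (Var x) = {x}"
| "trm_vars (Param a) = {}"
| "trm_vars (App f ts) = (\<Union>t \<in> set ts. trm_vars t)"

fun wf_trm :: "('f, 'r, 'z) lang_scheme \<Rightarrow> 'a set \<Rightarrow> ('a, 'f) trm \<Rightarrow> bool" where
  "wf_trm L X (Var x) \<longleftrightarrow> True"
| "wf_trm L X (Param a) \<longleftrightarrow> a \<in> X"
| "wf_trm L X (App f ts) \<longleftrightarrow>
     f \<in> fun_syms L \<and> length ts = fun_arity L f \<and> (\<forall>t \<in> set ts. wf_trm L X t)"

fun trm_val :: "('a, 'f, 'z) fun_structure_scheme \<Rightarrow> (nat \<Rightarrow> 'a) \<Rightarrow> ('a, 'f) trm \<Rightarrow> 'a" where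
  "trm_val M v (Var x) = v x"
| "trm_val M v (Param a) = a"
| "trm_val M v (App f ts) = fn M f (map (trm_val M v) ts)"


section \<open>Classical logic\<close>

record ('a, 'f, 'r) fo_structure = "('a, 'f) fun_structure" +
  rel :: "'r \<Rightarrow> 'a list \<Rightarrow> bool"

definition is_fo_structure :: "('f, 'r) lang \<Rightarrow> ('a, 'f, 'r) fo_structure \<Rightarrow> bool" where
  "is_fo_structure L M \<longleftrightarrow>
     univ M \<noteq> {} \<and> (\<forall>f \<in> fun_syms L. \<forall>xs \<in> tuples (univ M) (fun_arity L f). fn M f xs \<in> univ M)"

datatype ('a, 'f, 'r) fo_fm =
    Equal "('a, 'f) trm" "('a, 'f) trm"
  | Rel 'r "('a, 'f) trm list"
  | Neg "('a, 'f, 'r) fo_fm"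
  | Conj "('a, 'f, 'r) fo_fm" "('a, 'f, 'r) fo_fm"
  | Exists nat "('a, 'f, 'r) fo_fm"

fun fo_free :: "('a, 'f, 'r) fo_fm \<Rightarrow> nat set" where
  "fo_free (Equal s t) = trm_vars s \<union> trm_vars t"
| "fo_free (Rel r ts) = (\<Union>t \<in> set ts. trm_vars t)"
| "fo_free (Neg \<phi>) = fo_free \<phi>"
| "fo_free (Conj \<phi> \<psi>) = fo_free \<phi> \<union> fo_free \<psi>"
| "fo_free (Exists x \<phi>) = fo_free \<phi> - {x}"

fun wf_fo :: "('f, 'r) lang \<Rightarrow> 'a set \<Rightarrow> ('a, 'f, 'r) fo_fm \<Rightarrow> bool" where
  "wf_fo L X (Equal s t) \<longleftrightarrow> wf_trm L X s \<and> wf_trm L X t"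
| "wf_fo L X (Rel r ts) \<longleftrightarrow>
     r \<in> rel_syms L \<and> length ts = rel_arity L r \<and> (\<forall>t \<in> set ts. wf_trm L X t)"
| "wf_fo L X (Neg \<phi>) \<longleftrightarrow> wf_fo L X \<phi>"
| "wf_fo L X (Conj \<phi> \<psi>) \<longleftrightarrow> wf_fo L X \<phi> \<and> wf_fo L X \<psi>"
| "wf_fo L X (Exists x \<phi>) \<longleftrightarrow> wf_fo L X \<phi>"

fun fo_sat :: "('a, 'f, 'r) fo_structure \<Rightarrow> (nat \<Rightarrow> 'a) \<Rightarrow> ('a, 'f, 'r) fo_fm \<Rightarrow> bool" where
  "fo_sat M v (Equal s t) \<longleftrightarrow> trm_val M v s = trm_val M v t"
| "fo_sat M v (Rel r ts) \<longleftrightarrow> rel M r (map (trm_val M v) ts)"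
| "fo_sat M v (Neg \<phi>) \<longleftrightarrow> \<not> fo_sat M v \<phi>"
| "fo_sat M v (Conj \<phi> \<psi>) \<longleftrightarrow> fo_sat M v \<phi> \<and> fo_sat M v \<psi>"
| "fo_sat M v (Exists x \<phi>) \<longleftrightarrow> (\<exists>a \<in> univ M. fo_sat M (v(x := a)) \<phi>)"

text \<open>\<open>L(M)\<close>-formulas in the single free variable \<open>0\<close>; such a formula is evaluated at \<open>a\<close> under
  the constant assignment with value \<open>a\<close>.\<close>

definition fo_fms :: "('f, 'r) lang \<Rightarrow> ('a, 'f, 'r) fo_structure \<Rightarrow> ('a, 'f, 'r) fo_fm set" where
  "fo_fms L M = {\<phi>. wf_fo L (univ M) \<phi> \<and> fo_free \<phi> \<subseteq> {0}}"

definition fo_tp ::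
  "('f, 'r) lang \<Rightarrow> ('a, 'f, 'r) fo_structure \<Rightarrow> 'a \<Rightarrow> ('a, 'f, 'r) fo_fm set" where
  "fo_tp L M a = {\<phi> \<in> fo_fms L M. fo_sat M (\<lambda>_. a) \<phi>}"

text \<open>Complete types over \<open>M\<close>. By compactness, a set of \<open>L(M)\<close>-formulas is consistent with the
  elementary diagram of \<open>M\<close> iff it is finitely satisfiable in \<open>M\<close>; the latter avoids quantifying
  over elementary extensions, which live in arbitrary types.\<close>

definition fo_types ::
  "('f, 'r) lang \<Rightarrow> ('a, 'f, 'r) fo_structure \<Rightarrow> ('a, 'f, 'r) fo_fm set set" where
  "fo_types L M = {p. p \<subseteq> fo_fms L M \<and>
     (\<forall>\<Phi>. finite \<Phi> \<and> \<Phi> \<subseteq> p \<longrightarrow> (\<exists>a \<in> univ M. \<forall>\<phi> \<in> \<Phi>. fo_sat M (\<lambda>_. a) \<phi>)) \<and>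
     (\<forall>\<phi> \<in> fo_fms L M. \<phi> \<in> p \<or> Neg \<phi> \<in> p)}"

definition fo_type_space ::
  "('f, 'r) lang \<Rightarrow> ('a, 'f, 'r) fo_structure \<Rightarrow> ('a, 'f, 'r) fo_fm set topology" where
  "fo_type_space L M =
     topology_generated_by {{p \<in> fo_types L M. \<phi> \<in> p} | \<phi>. \<phi> \<in> fo_fms L M}"

definition fo_definable_map ::
  "('f, 'r) lang \<Rightarrow> ('a, 'f, 'r) fo_structure \<Rightarrow> 'c topology \<Rightarrow> ('a \<Rightarrow> 'c) \<Rightarrow> bool" where
  "fo_definable_map L M C f \<longleftrightarrow>
     (\<exists>g. continuous_map (fo_type_space L M) C g \<and> (\<forall>a \<in> univ M. g (fo_tp L M a) = f a))"

definition fo_class ::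
  "'i filter \<Rightarrow> ('i \<Rightarrow> ('a, 'f, 'r) fo_structure) \<Rightarrow> ('i \<Rightarrow> 'a) \<Rightarrow> ('i \<Rightarrow> 'a) set" where
  "fo_class \<U> M a = {b. (\<forall>i. b i \<in> univ (M i)) \<and> (\<forall>\<^sub>F i in \<U>. a i = b i)}"

text \<open>Elements are equivalence classes; symbols are interpreted on chosen representatives.\<close>

definition fo_ultraproduct ::
  "'i filter \<Rightarrow> ('i \<Rightarrow> ('a, 'f, 'r) fo_structure) \<Rightarrow> (('i \<Rightarrow> 'a) set, 'f, 'r) fo_structure" where
  "fo_ultraproduct \<U> M =
     \<lparr>univ = fo_class \<U> M ` {a. \<forall>i. a i \<in> univ (M i)},
      fn = (\<lambda>f As. fo_class \<U> M (\<lambda>i. fn (M i) f (map (\<lambda>A. (SOME a. a \<in> A) i) As))),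
      rel = (\<lambda>r As. \<forall>\<^sub>F i in \<U>. rel (M i) r (map (\<lambda>A. (SOME a. a \<in> A) i) As))\<rparr>"


section \<open>Continuous logic\<close>

text \<open>Bounded metric structures in the sense of Ben Yaacov, Berenstein, Henson and Usvyatsov: the
  language specifies a bound on the diameter, a closed bounded interval of values for each
  predicate symbol, and moduli of uniform continuity.\<close>

record ('f, 'r) metric_lang = "('f, 'r) lang" +
  diam_bound :: real
  pred_lo :: "'r \<Rightarrow> real"
  pred_hi :: "'r \<Rightarrow> real"
  fun_modulus :: "'f \<Rightarrow> real \<Rightarrow> real"
  pred_modulus :: "'r \<Rightarrow> real \<Rightarrow> real"

definition is_metric_lang :: "('f, 'r) metric_lang \<Rightarrow> bool" where
  "is_metric_lang L \<longleftrightarrow>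
     (\<forall>r \<in> rel_syms L. pred_lo L r \<le> pred_hi L r) \<and>
     (\<forall>f \<in> fun_syms L. \<forall>\<epsilon>>0. fun_modulus L f \<epsilon> > 0) \<and>
     (\<forall>r \<in> rel_syms L. \<forall>\<epsilon>>0. pred_modulus L r \<epsilon> > 0)"

record ('a, 'f, 'r) metric_structure = "('a, 'f) fun_structure" +
  metr :: "'a \<Rightarrow> 'a \<Rightarrow> real"
  pred :: "'r \<Rightarrow> 'a list \<Rightarrow> real"

definition is_metric_structure ::
  "('f, 'r) metric_lang \<Rightarrow> ('a, 'f, 'r) metric_structure \<Rightarrow> bool" where
  "is_metric_structure L M \<longleftrightarrow>
     univ M \<noteq> {} \<and>
     Metric_space (univ M) (metr M) \<and> Metric_space.mcomplete (univ M) (metr M) \<and>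
     (\<forall>x \<in> univ M. \<forall>y \<in> univ M. metr M x y \<le> diam_bound L) \<and>
     (\<forall>f \<in> fun_syms L. \<forall>xs \<in> tuples (univ M) (fun_arity L f). fn M f xs \<in> univ M) \<and>
     (\<forall>r \<in> rel_syms L. \<forall>xs \<in> tuples (univ M) (rel_arity L r).
        pred M r xs \<in> {pred_lo L r .. pred_hi L r}) \<and>
     (\<forall>f \<in> fun_syms L. \<forall>\<epsilon>>0.
        \<forall>xs \<in> tuples (univ M) (fun_arity L f). \<forall>ys \<in> tuples (univ M) (fun_arity L f).
          (\<forall>k < fun_arity L f. metr M (xs ! k) (ys ! k) < fun_modulus L f \<epsilon>) \<longrightarrow>
          metr M (fn M f xs) (fn M f ys) \<le> \<epsilon>) \<and>
     (\<forall>r \<in> rel_syms L. \<forall>\<epsilon>>0.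
        \<forall>xs \<in> tuples (univ M) (rel_arity L r). \<forall>ys \<in> tuples (univ M) (rel_arity L r).
          (\<forall>k < rel_arity L r. metr M (xs ! k) (ys ! k) < pred_modulus L r \<epsilon>) \<longrightarrow>
          \<bar>pred M r xs - pred M r ys\<bar> \<le> \<epsilon>)"

text \<open>The connective in \<open>Conn u \<phi>s\<close> is a continuous real function \<open>u\<close> on \<open>n\<close>-space,
  where \<open>n\<close> is the length of \<open>\<phi>s\<close>.\<close>

datatype ('a, 'f, 'r) metric_fm =
    Dist "('a, 'f) trm" "('a, 'f) trm"
  | Pred 'r "('a, 'f) trm list"
  | Conn "(nat \<Rightarrow> real) \<Rightarrow> real" "('a, 'f, 'r) metric_fm list"
  | SupQ nat "('a, 'f, 'r) metric_fm"
  | InfQ nat "('a, 'f, 'r) metric_fm"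

fun metric_free :: "('a, 'f, 'r) metric_fm \<Rightarrow> nat set" where
  "metric_free (Dist s t) = trm_vars s \<union> trm_vars t"
| "metric_free (Pred r ts) = (\<Union>t \<in> set ts. trm_vars t)"
| "metric_free (Conn u \<phi>s) = (\<Union>\<phi> \<in> set \<phi>s. metric_free \<phi>)"
| "metric_free (SupQ x \<phi>) = metric_free \<phi> - {x}"
| "metric_free (InfQ x \<phi>) = metric_free \<phi> - {x}"

fun wf_metric :: "('f, 'r) metric_lang \<Rightarrow> 'a set \<Rightarrow> ('a, 'f, 'r) metric_fm \<Rightarrow> bool" where
  "wf_metric L X (Dist s t) \<longleftrightarrow> wf_trm L X s \<and> wf_trm L X t"
| "wf_metric L X (Pred r ts) \<longleftrightarrow>
     r \<in> rel_syms L \<and> length ts = rel_arity L r \<and> (\<forall>t \<in> set ts. wf_trm L X t)"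
| "wf_metric L X (Conn u \<phi>s) \<longleftrightarrow>
     continuous_map (Euclidean_space (length \<phi>s)) euclideanreal u \<and>
     (\<forall>\<phi> \<in> set \<phi>s. wf_metric L X \<phi>)"
| "wf_metric L X (SupQ x \<phi>) \<longleftrightarrow> wf_metric L X \<phi>"
| "wf_metric L X (InfQ x \<phi>) \<longleftrightarrow> wf_metric L X \<phi>"

fun metric_val ::
  "('a, 'f, 'r) metric_structure \<Rightarrow> (nat \<Rightarrow> 'a) \<Rightarrow> ('a, 'f, 'r) metric_fm \<Rightarrow> real" where
  "metric_val M v (Dist s t) = metr M (trm_val M v s) (trm_val M v t)"
| "metric_val M v (Pred r ts) = pred M r (map (trm_val M v) ts)"
| "metric_val M v (Conn u \<phi>s) =
     u (\<lambda>i. if i < length \<phi>s then map (metric_val M v) \<phi>s ! i else 0)"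
| "metric_val M v (SupQ x \<phi>) = (SUP a \<in> univ M. metric_val M (v(x := a)) \<phi>)"
| "metric_val M v (InfQ x \<phi>) = (INF a \<in> univ M. metric_val M (v(x := a)) \<phi>)"

definition metric_fms ::
  "('f, 'r) metric_lang \<Rightarrow> ('a, 'f, 'r) metric_structure \<Rightarrow> ('a, 'f, 'r) metric_fm set" where
  "metric_fms L M = {\<phi>. wf_metric L (univ M) \<phi> \<and> metric_free \<phi> \<subseteq> {0}}"

definition metric_tp ::
  "('f, 'r) metric_lang \<Rightarrow> ('a, 'f, 'r) metric_structure \<Rightarrow> 'a \<Rightarrow> ('a, 'f, 'r) metric_fm \<Rightarrow> real"
  where
  "metric_tp L M a = (\<lambda>\<phi> \<in> metric_fms L M. metric_val M (\<lambda>_. a) \<phi>)"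

text \<open>A complete type over \<open>M\<close> is given by the values it assigns to the \<open>L(M)\<close>-formulas, i.e.
  \<open>p \<phi> = t\<close> stands for the condition \<open>\<bar>\<phi>(x) - t\<bar> = 0\<close>. By compactness, these conditions are
  consistent with the elementary diagram of \<open>M\<close> iff they are finitely approximately satisfiable
  in \<open>M\<close>. The logic topology is the coarsest one making all evaluations \<open>p \<mapsto> p \<phi>\<close> continuous.\<close>

definition metric_types ::
  "('f, 'r) metric_lang \<Rightarrow> ('a, 'f, 'r) metric_structure \<Rightarrow> (('a, 'f, 'r) metric_fm \<Rightarrow> real) set"
  where
  "metric_types L M = {p \<in> extensional (metric_fms L M).
     \<forall>\<Phi> \<epsilon>. finite \<Phi> \<and> \<Phi> \<subseteq> metric_fms L M \<and> \<epsilon> > 0 \<longrightarrow>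
       (\<exists>a \<in> univ M. \<forall>\<phi> \<in> \<Phi>. \<bar>metric_val M (\<lambda>_. a) \<phi> - p \<phi>\<bar> < \<epsilon>)}"

definition metric_type_space ::
  "('f, 'r) metric_lang \<Rightarrow> ('a, 'f, 'r) metric_structure \<Rightarrow>
   (('a, 'f, 'r) metric_fm \<Rightarrow> real) topology" where
  "metric_type_space L M =
     subtopology (product_topology (\<lambda>_. euclideanreal) (metric_fms L M)) (metric_types L M)"

definition metric_definable_map ::
  "('f, 'r) metric_lang \<Rightarrow> ('a, 'f, 'r) metric_structure \<Rightarrow> 'c topology \<Rightarrow> ('a \<Rightarrow> 'c) \<Rightarrow> bool"
  where
  "metric_definable_map L M C f \<longleftrightarrow>
     (\<exists>g. continuous_map (metric_type_space L M) C g \<and>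
          (\<forall>a \<in> univ M. g (metric_tp L M a) = f a))"

definition metric_class ::
  "'i filter \<Rightarrow> ('i \<Rightarrow> ('a, 'f, 'r) metric_structure) \<Rightarrow> ('i \<Rightarrow> 'a) \<Rightarrow> ('i \<Rightarrow> 'a) set" where
  "metric_class \<U> M a =
     {b. (\<forall>i. b i \<in> univ (M i)) \<and> ((\<lambda>i. metr (M i) (a i) (b i)) \<longlongrightarrow> 0) \<U>}"

definition metric_ultraproduct ::
  "'i filter \<Rightarrow> ('i \<Rightarrow> ('a, 'f, 'r) metric_structure) \<Rightarrow>
   (('i \<Rightarrow> 'a) set, 'f, 'r) metric_structure" where
  "metric_ultraproduct \<U> M =
     \<lparr>univ = metric_class \<U> M ` {a. \<forall>i. a i \<in> univ (M i)},
      fn = (\<lambda>f As. metric_class \<U> M (\<lambda>i. fn (M i) f (map (\<lambda>A. (SOME a. a \<in> A) i) As))),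
      metr = (\<lambda>A B. Lim \<U> (\<lambda>i. metr (M i) ((SOME a. a \<in> A) i) ((SOME b. b \<in> B) i))),
      pred = (\<lambda>r As. Lim \<U> (\<lambda>i. pred (M i) r (map (\<lambda>A. (SOME a. a \<in> A) i) As)))\<rparr>"

end

theory Submission
  imports Defs
begin

text \<open>
  By definability and compactness of the type space, the preimages under \<open>\<tau>\<close> of a closed set and of
  an open neighbourhood of it are separated by an internal subset of the ultraproduct. Covering \<open>K\<close>
  by finitely many small sets, one obtains maps \<open>f\<^sub>i : G\<^sub>i \<rightarrow> K\<close> whose ultralimit is \<open>\<tau>\<close> up to a
  prescribed error; since \<open>\<tau>\<close> is multiplicative, \<open>f\<^sub>i\<close> is uniformly almost multiplicative for
  \<open>\<U>\<close>-most \<open>i\<close>. By Ulam stability \<open>f\<^sub>i\<close> is close to a homomorphism, and countable incompleteness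
  allows the error to tend to \<open>0\<close> along \<open>\<U>\<close>.

  Ulam stability is Kazhdan's averaging argument. Smoothness enters only through a chart \<open>l\<close> at the
  identity with \<open>\<bar>l (xy) - l x - l y\<bar> \<le> C \<bar>l x\<bar> \<bar>l y\<bar>\<close>. In it powers grow linearly, so conjugations are
  uniformly Lipschitz, and being almost additive they almost commute with finitely additive means.
  The defect \<open>f(xz) f(z)\<inverse> f(x)\<inverse>\<close> is a cocycle for the action of the group through \<open>f\<close> by
  conjugation; multiplying \<open>f x\<close> by the mean over \<open>y\<close> of the defect at \<open>(x, y)\<close>, taken in the chart,
  turns a defect \<open>\<delta>\<close> into \<open>O(\<delta>\<^sup>2)\<close>, and iterating this converges to a homomorphism.
\<close>

section \<open>Almost additive maps and finitely additive means\<close>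

locale almost_additive_map =
  fixes W :: "'v::real_normed_vector set" and s C B :: real
    and \<psi> :: "'v \<Rightarrow> 'w::real_normed_vector"
  assumes subspace: "subspace W" and pos: "0 < s" and C_nonneg: "0 \<le> C" and B_nonneg: "0 \<le> B"
    and additive: "u \<in> W \<Longrightarrow> v \<in> W \<Longrightarrow> norm u < s \<Longrightarrow> norm v < s \<Longrightarrow> norm (u + v) < s \<Longrightarrow>
        norm (\<psi> (u + v) - \<psi> u - \<psi> v) \<le> C * norm u * norm v"
    and Lipschitz: "u \<in> W \<Longrightarrow> v \<in> W \<Longrightarrow> norm u < s \<Longrightarrow> norm v < s \<Longrightarrow>
        norm (\<psi> u - \<psi> v) \<le> B * norm (u - v)"
begin

lemma zero: "\<psi> 0 = 0"
  using additive[of 0 0] subspace_0[OF subspace] pos by simp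

lemma bounded: "u \<in> W \<Longrightarrow> norm u < s \<Longrightarrow> norm (\<psi> u) \<le> B * norm u"
  using Lipschitz[of u 0] subspace_0[OF subspace] pos by (simp add: zero)

lemma natural_multiple:
  assumes u: "u \<in> W" and small: "real n * norm u < s"
  shows "norm (\<psi> (real n *\<^sub>R u) - real n *\<^sub>R \<psi> u) \<le> C * (real n * norm u)\<^sup>2"
  using small
proof (induction n)
  case 0
  then show ?case by (simp add: zero)
next
  case (Suc n)
  have grow: "real n * norm u + norm u < s" "0 \<le> real n * norm u"
    using Suc.prems by (simp_all add: algebra_simps)
  have "norm (\<psi> (real n *\<^sub>R u + u) - \<psi> (real n *\<^sub>R u) - \<psi> u) \<le> C * norm (real n *\<^sub>R u) * norm u"
  proof (rule additive)
    show "norm (real n *\<^sub>R u + u) < s"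
      using norm_triangle_ineq[of "real n *\<^sub>R u" u] grow(1) by simp
  qed (use u grow subspace_mul[OF subspace u] norm_ge_zero[of u] in \<open>simp_all, linarith+\<close>)
  moreover have "norm (\<psi> (real n *\<^sub>R u) - real n *\<^sub>R \<psi> u) \<le> C * (real n * norm u)\<^sup>2"
    using grow norm_ge_zero[of u] by (intro Suc.IH) linarith
  ultimately have "norm ((\<psi> (real n *\<^sub>R u + u) - \<psi> (real n *\<^sub>R u) - \<psi> u)
      + (\<psi> (real n *\<^sub>R u) - real n *\<^sub>R \<psi> u)) \<le> C * (real n * norm u * norm u + (real n * norm u)\<^sup>2)"
    by (intro norm_triangle_le) (simp add: algebra_simps)
  also have "\<dots> \<le> C * (real (Suc n) * norm u)\<^sup>2"
    using C_nonneg by (intro mult_left_mono) (simp_all add: power2_eq_square algebra_simps)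
  finally show ?case by (simp add: algebra_simps)
qed

lemma fraction_multiple:
  assumes u: "u \<in> W" "norm u < s" and pq: "p \<le> q" "0 < q"
  shows "norm (\<psi> ((real p / real q) *\<^sub>R u) - (real p / real q) *\<^sub>R \<psi> u)
    \<le> 2 * C * (real p / real q) * (norm u)\<^sup>2"
proof -
  define w where "w = (1 / real q) *\<^sub>R u"
  let ?c = "real p / real q"
  have c: "0 \<le> ?c" "?c \<le> 1" using pq by auto
  have w: "w \<in> W" using u(1) subspace by (simp add: w_def subspace_mul)
  have pw: "real p *\<^sub>R w = ?c *\<^sub>R u" and qw: "real q *\<^sub>R w = u" and norm_w: "real q * norm w = norm u"
    using pq(2) by (simp_all add: w_def)
  have "real p * norm w \<le> real q * norm w" using pq(1) by (intro mult_right_mono) auto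
  then have "real p * norm w < s" using norm_w u(2) by simp
  from natural_multiple[OF w this]
  have "norm (\<psi> (?c *\<^sub>R u) - real p *\<^sub>R \<psi> w) \<le> C * (?c * norm u)\<^sup>2"
    using pq(2) by (simp add: pw flip: norm_w)
  also have "\<dots> = C * (?c * ?c * (norm u)\<^sup>2)" by (simp add: power2_eq_square)
  also have "\<dots> \<le> C * (?c * (norm u)\<^sup>2)"
    using c by (intro mult_left_mono mult_right_mono mult_left_le_one_le C_nonneg) auto
  finally have numerator: "norm (\<psi> (?c *\<^sub>R u) - real p *\<^sub>R \<psi> w) \<le> C * ?c * (norm u)\<^sup>2" by simp
  have "norm (\<psi> u - real q *\<^sub>R \<psi> w) \<le> C * (norm u)\<^sup>2"
    using natural_multiple[OF w, of q] u(2) by (simp add: qw norm_w)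
  then have "norm (?c *\<^sub>R (\<psi> u - real q *\<^sub>R \<psi> w)) \<le> ?c * (C * (norm u)\<^sup>2)"
    unfolding norm_scaleR abs_of_nonneg[OF c(1)] by (rule mult_left_mono[OF _ c(1)])
  then have denominator: "norm (?c *\<^sub>R \<psi> u - real p *\<^sub>R \<psi> w) \<le> C * ?c * (norm u)\<^sup>2"
    using pq(2) by (simp add: scaleR_diff_right algebra_simps)
  have "norm ((\<psi> (?c *\<^sub>R u) - real p *\<^sub>R \<psi> w) - (?c *\<^sub>R \<psi> u - real p *\<^sub>R \<psi> w))
      \<le> C * ?c * (norm u)\<^sup>2 + C * ?c * (norm u)\<^sup>2"
    using numerator denominator by (rule norm_triangle_le_diff[OF add_mono])
  then show ?thesis by simp
qed

lemma real_multiple_upto_fraction: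
  assumes u: "u \<in> W" "norm u < s" and c: "0 \<le> c" "c \<le> 1"
  shows "norm (\<psi> (c *\<^sub>R u) - c *\<^sub>R \<psi> u) \<le> 2 * C * c * (norm u)\<^sup>2 + (2 * B * norm u) / real (Suc m)"
proof -
  let ?q = "real (Suc m)"
  define p where "p = nat \<lfloor>c * ?q\<rfloor>"
  define d where "d = real p / ?q"
  have "real p \<le> c * ?q" "c * ?q < real p + 1" using c(1) by (simp_all add: p_def)
  moreover have "c - d = (c * ?q - real p) / ?q" by (simp add: d_def diff_divide_distrib)
  ultimately have r: "0 \<le> c - d" "c - d \<le> 1 / ?q" by (simp_all add: divide_right_mono)
  have d: "0 \<le> d" by (simp add: d_def)
  have d1: "d \<le> 1" using r(1) c(2) by linarith
  then have "real p \<le> ?q" by (simp add: d_def)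
  then have "norm (\<psi> (d *\<^sub>R u) - d *\<^sub>R \<psi> u) \<le> 2 * C * d * (norm u)\<^sup>2"
    unfolding d_def by (intro fraction_multiple u) linarith+
  also have "\<dots> \<le> 2 * C * c * (norm u)\<^sup>2"
    using r(1) C_nonneg by (intro mult_right_mono mult_left_mono) auto
  finally have fraction: "norm (\<psi> (d *\<^sub>R u) - d *\<^sub>R \<psi> u) \<le> 2 * C * c * (norm u)\<^sup>2" .
  have small: "norm (e *\<^sub>R u) < s" if "0 \<le> e" "e \<le> 1" for e
    using mult_left_le_one_le[OF norm_ge_zero that, of u] that(1) u(2) by simp
  have "norm (\<psi> (c *\<^sub>R u) - \<psi> (d *\<^sub>R u)) \<le> B * norm (c *\<^sub>R u - d *\<^sub>R u)"
    using u(1) subspace c d d1 by (intro Lipschitz small) (auto simp: subspace_mul)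
  also have "\<dots> = (c - d) * (B * norm u)" using r(1) by (simp flip: scaleR_diff_left)
  finally have increment: "norm (\<psi> (c *\<^sub>R u) - \<psi> (d *\<^sub>R u)) \<le> (c - d) * (B * norm u)" .
  have remainder: "norm ((c - d) *\<^sub>R \<psi> u) \<le> (c - d) * (B * norm u)"
    using mult_left_mono[OF bounded[OF u] r(1)] r(1) by simp
  have "\<psi> (c *\<^sub>R u) - c *\<^sub>R \<psi> u
      = (\<psi> (c *\<^sub>R u) - \<psi> (d *\<^sub>R u)) + (\<psi> (d *\<^sub>R u) - d *\<^sub>R \<psi> u) - (c - d) *\<^sub>R \<psi> u"
    by (simp add: algebra_simps)
  also have "norm \<dots> \<le> (c - d) * (B * norm u) + 2 * C * c * (norm u)\<^sup>2 + (c - d) * (B * norm u)"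
    by (rule norm_triangle_le_diff[OF add_mono[OF norm_triangle_mono[OF increment fraction] remainder]])
  also have "\<dots> = 2 * C * c * (norm u)\<^sup>2 + (c - d) * (2 * B * norm u)" by simp
  also have "(c - d) * (2 * B * norm u) \<le> 1 / ?q * (2 * B * norm u)"
    using r(2) B_nonneg by (intro mult_right_mono) auto
  finally show ?thesis by simp
qed

lemma real_multiple:
  assumes u: "u \<in> W" "norm u < s" and c: "0 \<le> c" "c \<le> 1"
  shows "norm (\<psi> (c *\<^sub>R u) - c *\<^sub>R \<psi> u) \<le> 2 * C * c * (norm u)\<^sup>2"
proof (rule LIMSEQ_le_const)
  show "(\<lambda>m. 2 * C * c * (norm u)\<^sup>2 + (2 * B * norm u) / real (Suc m))
      \<longlonglongrightarrow> 2 * C * c * (norm u)\<^sup>2"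
    using tendsto_add[OF tendsto_const LIMSEQ_Suc[OF lim_const_over_n]] by (simp only: add_0_right)
qed (use real_multiple_upto_fraction[OF assms] in blast)

lemma sum_of_multiples:
  assumes "finite I" "\<And>i. i \<in> I \<Longrightarrow> x i \<in> W" "\<And>i. i \<in> I \<Longrightarrow> norm (x i) \<le> b" and b: "0 \<le> b" "b < s"
    and "\<And>i. i \<in> I \<Longrightarrow> 0 \<le> c i" "sum c I \<le> 1"
  shows "norm (\<psi> (\<Sum>i\<in>I. c i *\<^sub>R x i) - (\<Sum>i\<in>I. \<psi> (c i *\<^sub>R x i))) \<le> C * (sum c I * b)\<^sup>2"
  using assms(1-3,6,7)
proof (induction I rule: finite_induct)
  case empty
  then show ?case by (simp add: zero)
next
  case (insert i I)
  let ?S = "\<Sum>j\<in>I. c j *\<^sub>R x j"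
  have c: "0 \<le> c i" "0 \<le> sum c I" "c i + sum c I \<le> 1"
    using insert.hyps insert.prems(3,4) sum_nonneg[of I c] by auto
  then have "sum c I \<le> 1" by linarith
  have norms: "norm (c i *\<^sub>R x i) \<le> c i * b" "norm ?S \<le> sum c I * b"
    using insert.prems unfolding sum_distrib_right by (auto intro!: mult_left_mono sum_norm_le)
  have convex: "c i * b \<le> b" "sum c I * b \<le> b" "c i * b + sum c I * b \<le> b"
    using mult_nonneg_nonneg[OF c(1) b(1)] mult_nonneg_nonneg[OF c(2) b(1)] mult_right_mono[OF c(3) b(1)]
    by (simp_all only: distrib_right mult_1_left)
  have "norm (\<psi> (c i *\<^sub>R x i + ?S) - \<psi> (c i *\<^sub>R x i) - \<psi> ?S) \<le> C * norm (c i *\<^sub>R x i) * norm ?S"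
  proof (rule additive)
    show "c i *\<^sub>R x i \<in> W" "?S \<in> W"
      using insert.prems(1) subspace by (auto intro!: subspace_sum subspace_mul)
    show "norm (c i *\<^sub>R x i + ?S) < s"
      using norm_triangle_ineq[of "c i *\<^sub>R x i" ?S] norms convex(3) b(2) by linarith
  qed (use norms convex b(2) in linarith)+
  also have "\<dots> \<le> C * (c i * b) * (sum c I * b)"
    using norms C_nonneg b(1) c by (intro mult_mono) simp_all
  finally have split_off: "norm (\<psi> (c i *\<^sub>R x i + ?S) - \<psi> (c i *\<^sub>R x i) - \<psi> ?S) \<le> C * (c i * b) * (sum c I * b)" .
  have IH: "norm (\<psi> ?S - (\<Sum>j\<in>I. \<psi> (c j *\<^sub>R x j))) \<le> C * (sum c I * b)\<^sup>2"
    using insert.prems \<open>sum c I \<le> 1\<close> by (intro insert.IH) auto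
  have "\<psi> (c i *\<^sub>R x i + ?S) - (\<psi> (c i *\<^sub>R x i) + (\<Sum>j\<in>I. \<psi> (c j *\<^sub>R x j)))
      = (\<psi> (c i *\<^sub>R x i + ?S) - \<psi> (c i *\<^sub>R x i) - \<psi> ?S) + (\<psi> ?S - (\<Sum>j\<in>I. \<psi> (c j *\<^sub>R x j)))"
    by simp
  also have "norm \<dots> \<le> C * ((c i * b) * (sum c I * b) + (sum c I * b)\<^sup>2)"
    using split_off IH by (intro norm_triangle_le) (simp add: algebra_simps)
  also have "\<dots> \<le> C * (c i * b + sum c I * b)\<^sup>2"
    using C_nonneg b(1) c by (intro mult_left_mono) (simp_all add: power2_sum)
  finally show ?case by (simp only: sum.insert[OF insert.hyps] distrib_right)
qed

lemma convex_combination: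
  assumes I: "finite I" and x: "\<And>i. i \<in> I \<Longrightarrow> x i \<in> W" "\<And>i. i \<in> I \<Longrightarrow> norm (x i) \<le> b"
    and b: "0 \<le> b" "b < s" and c: "\<And>i. i \<in> I \<Longrightarrow> 0 \<le> c i" "sum c I = 1"
  shows "norm (\<psi> (\<Sum>i\<in>I. c i *\<^sub>R x i) - (\<Sum>i\<in>I. c i *\<^sub>R \<psi> (x i))) \<le> 3 * C * b\<^sup>2"
proof -
  have "norm (\<psi> (c i *\<^sub>R x i) - c i *\<^sub>R \<psi> (x i)) \<le> c i * (2 * C * b\<^sup>2)" if i: "i \<in> I" for i
  proof -
    have "c i \<le> 1" using c sum_nonneg_leq_bound[OF I c(1) c(2) i] by simp
    then have "norm (\<psi> (c i *\<^sub>R x i) - c i *\<^sub>R \<psi> (x i)) \<le> 2 * C * c i * (norm (x i))\<^sup>2"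
      using x[OF i] c(1)[OF i] b by (intro real_multiple) auto
    also have "\<dots> \<le> 2 * C * c i * b\<^sup>2"
      using x(2)[OF i] c(1)[OF i] C_nonneg by (intro mult_left_mono power_mono) auto
    finally show ?thesis by (simp add: algebra_simps)
  qed
  then have "norm (\<Sum>i\<in>I. \<psi> (c i *\<^sub>R x i) - c i *\<^sub>R \<psi> (x i)) \<le> (\<Sum>i\<in>I. c i * (2 * C * b\<^sup>2))"
    by (rule sum_norm_le)
  also have "\<dots> = 2 * C * b\<^sup>2" using c(2) by (simp flip: sum_distrib_right)
  finally have "norm ((\<psi> (\<Sum>i\<in>I. c i *\<^sub>R x i) - (\<Sum>i\<in>I. \<psi> (c i *\<^sub>R x i)))
      + (\<Sum>i\<in>I. \<psi> (c i *\<^sub>R x i) - c i *\<^sub>R \<psi> (x i))) \<le> C * b\<^sup>2 + 2 * C * b\<^sup>2"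
    using sum_of_multiples[of I x b c] I x b c by (intro norm_triangle_mono) auto
  then show ?thesis by (simp add: sum_subtractf algebra_simps)
qed

end

definition simple_mean :: "('a set \<Rightarrow> real) \<Rightarrow> 'a set \<Rightarrow> ('a \<Rightarrow> 'v::real_vector) \<Rightarrow> 'v" where
  "simple_mean \<mu> H v = (\<Sum>w\<in>v ` H. \<mu> {y\<in>H. v y = w} *\<^sub>R w)"

lemma compact_finite_valued_approximation:
  assumes "compact S" "0 < \<eta>"
  obtains \<rho> where "finite (\<rho> ` S)" "\<And>u. u \<in> S \<Longrightarrow> \<rho> u \<in> S" "\<And>u. u \<in> S \<Longrightarrow> dist (\<rho> u) u \<le> \<eta>"
proof -
  obtain F where F: "finite F" "F \<subseteq> S" "S \<subseteq> (\<Union>x\<in>F. ball x \<eta>)"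
    using compactE_image[OF assms(1), of S "\<lambda>x. ball x \<eta>"] assms(2) by (metis UN_I centre_in_ball open_ball subsetI)
  then have "\<forall>u\<in>S. \<exists>x\<in>F. dist x u \<le> \<eta>" by (force intro: less_imp_le)
  then obtain \<rho> where "\<And>u. u \<in> S \<Longrightarrow> \<rho> u \<in> F \<and> dist (\<rho> u) u \<le> \<eta>" by metis
  moreover from this have "finite (\<rho> ` S)" by (intro finite_subset[OF _ F(1)]) auto
  ultimately show ?thesis using F(2) by (intro that[of \<rho>]) auto
qed

lemma finite_image_binop:
  assumes "finite (f ` A)" "finite (g ` A)"
  shows "finite ((\<lambda>x. h (f x) (g x)) ` A)"
  by (rule finite_subset[of _ "case_prod h ` (f ` A \<times> g ` A)"]) (use assms in auto)

locale finitely_additive_probability =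
  fixes \<mu> :: "'a set \<Rightarrow> real" and H :: "'a set"
  assumes nonneg: "A \<subseteq> H \<Longrightarrow> 0 \<le> \<mu> A"
    and total: "\<mu> H = 1"
    and additive: "A \<subseteq> H \<Longrightarrow> B \<subseteq> H \<Longrightarrow> A \<inter> B = {} \<Longrightarrow> \<mu> (A \<union> B) = \<mu> A + \<mu> B"
begin

lemma measure_empty: "\<mu> {} = 0"
  using additive[of "{}" "{}"] by simp

lemma space_nonempty: "H \<noteq> {}"
  using measure_empty total by auto

lemma measure_fibres:
  assumes "finite C"
  shows "\<mu> {y\<in>H. q y \<in> C} = (\<Sum>c\<in>C. \<mu> {y\<in>H. q y = c})"
  using assms
proof (induction C rule: finite_induct)
  case empty
  then show ?case by (simp add: measure_empty)
next
  case (insert c C)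
  have "{y\<in>H. q y \<in> insert c C} = {y\<in>H. q y = c} \<union> {y\<in>H. q y \<in> C}" by auto
  also have "\<mu> \<dots> = \<mu> {y\<in>H. q y = c} + \<mu> {y\<in>H. q y \<in> C}"
    using insert.hyps by (intro additive) auto
  finally show ?case using insert by simp
qed

lemma sum_measure_fibres:
  assumes "finite (v ` H)"
  shows "(\<Sum>w\<in>v ` H. \<mu> {y\<in>H. v y = w}) = 1"
proof -
  have "{y\<in>H. v y \<in> v ` H} = H" by auto
  then show ?thesis using measure_fibres[OF assms, of v] total by simp
qed

lemma simple_mean_compose:
  assumes fin: "finite (q ` H)"
  shows "simple_mean \<mu> H (\<lambda>y. h (q y)) = (\<Sum>c\<in>q ` H. \<mu> {y\<in>H. q y = c} *\<^sub>R h c)"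
proof -
  have fibre: "\<mu> {y\<in>H. h (q y) = w} *\<^sub>R w = (\<Sum>c\<in>{c\<in>q ` H. h c = w}. \<mu> {y\<in>H. q y = c} *\<^sub>R h c)" for w
  proof -
    have "{y\<in>H. h (q y) = w} = {y\<in>H. q y \<in> {c\<in>q ` H. h c = w}}" by auto
    then show ?thesis
      using measure_fibres[of "{c\<in>q ` H. h c = w}" q] fin by (simp add: scaleR_sum_left)
  qed
  show ?thesis
    unfolding simple_mean_def image_image[of h q, symmetric] fibre
    by (rule sum.image_gen[OF fin, symmetric])
qed

lemma simple_mean_add:
  assumes "finite (v ` H)" "finite (w ` H)"
  shows "simple_mean \<mu> H (\<lambda>y. v y + w y) = simple_mean \<mu> H v + simple_mean \<mu> H w"
proof -
  have fin: "finite ((\<lambda>y. (v y, w y)) ` H)" using assms by (rule finite_image_binop)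
  show ?thesis
    using simple_mean_compose[OF fin, of "\<lambda>(a, b). a + b"]
      simple_mean_compose[OF fin, of fst] simple_mean_compose[OF fin, of snd]
    by (simp add: sum.distrib scaleR_add_right case_prod_beta)
qed

lemma simple_mean_const: "simple_mean \<mu> H (\<lambda>y. c) = c"
  unfolding simple_mean_def by (simp add: image_constant_conv space_nonempty total)

lemma simple_mean_in_subspace:
  assumes "v ` H \<subseteq> W" "subspace W"
  shows "simple_mean \<mu> H v \<in> W"
  unfolding simple_mean_def using assms by (auto intro!: subspace_sum subspace_mul)

lemma norm_simple_mean_le:
  fixes v :: "'a \<Rightarrow> 'v::real_normed_vector"
  assumes "finite (v ` H)" "\<And>y. y \<in> H \<Longrightarrow> norm (v y) \<le> b"
  shows "norm (simple_mean \<mu> H v) \<le> b"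
proof -
  have "norm (simple_mean \<mu> H v) \<le> (\<Sum>w\<in>v ` H. \<mu> {y\<in>H. v y = w} * b)"
    unfolding simple_mean_def
    by (rule sum_norm_le) (auto intro!: mult_left_mono assms(2) nonneg simp: abs_of_nonneg nonneg)
  also have "\<dots> = b" using sum_measure_fibres[OF assms(1)] by (simp flip: sum_distrib_right)
  finally show ?thesis .
qed

lemma norm_simple_mean_diff_le:
  fixes v w :: "'a \<Rightarrow> 'v::real_normed_vector"
  assumes fin: "finite (v ` H)" "finite (w ` H)" and b: "\<And>y. y \<in> H \<Longrightarrow> norm (v y - w y) \<le> b"
  shows "norm (simple_mean \<mu> H v - simple_mean \<mu> H w) \<le> b"
proof -
  have fin_diff: "finite ((\<lambda>y. v y - w y) ` H)" using fin by (rule finite_image_binop)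
  have "simple_mean \<mu> H v = simple_mean \<mu> H (\<lambda>y. (v y - w y) + w y)" by simp
  also have "\<dots> = simple_mean \<mu> H (\<lambda>y. v y - w y) + simple_mean \<mu> H w"
    by (rule simple_mean_add[OF fin_diff fin(2)])
  finally show ?thesis using norm_simple_mean_le[OF fin_diff b] by simp
qed

lemma simple_mean_almost_additive:
  assumes \<psi>: "almost_additive_map W s C B \<psi>"
    and v: "finite (v ` H)" "v ` H \<subseteq> W" "\<And>y. y \<in> H \<Longrightarrow> norm (v y) \<le> b" and b: "b < s"
  shows "norm (\<psi> (simple_mean \<mu> H v) - simple_mean \<mu> H (\<lambda>y. \<psi> (v y))) \<le> 3 * C * b\<^sup>2"
  unfolding simple_mean_compose[OF v(1)] unfolding simple_mean_def
proof (rule almost_additive_map.convex_combination[OF \<psi> v(1) _ _ _ b])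
  show "0 \<le> b" using v(3) space_nonempty norm_ge_zero order_trans by blast
qed (use v in \<open>auto simp: nonneg sum_measure_fibres\<close>)

end

locale amenable_mean = group G + finitely_additive_probability \<mu> "carrier G"
  for G (structure) and \<mu> +
  assumes invariant: "g \<in> carrier G \<Longrightarrow> A \<subseteq> carrier G \<Longrightarrow> \<mu> (g <# A) = \<mu> A"
begin

lemma simple_mean_translate:
  assumes z: "z \<in> carrier G"
  shows "simple_mean \<mu> (carrier G) (\<lambda>y. v (z \<otimes> y)) = simple_mean \<mu> (carrier G) v"
proof -
  have surj: "(\<lambda>y. z \<otimes> y) ` carrier G = carrier G" using z surj_const_mult by blast
  then have image: "(\<lambda>y. v (z \<otimes> y)) ` carrier G = v ` carrier G" by (metis image_image)
  have "\<mu> {y\<in>carrier G. v (z \<otimes> y) = w} = \<mu> {y\<in>carrier G. v y = w}" for w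
  proof -
    have "z <# {y\<in>carrier G. v (z \<otimes> y) = w} = {x \<in> (\<lambda>y. z \<otimes> y) ` carrier G. v x = w}"
      unfolding l_coset_def by blast
    then have "z <# {y\<in>carrier G. v (z \<otimes> y) = w} = {y\<in>carrier G. v y = w}" by (simp only: surj)
    then show ?thesis using invariant[OF z, of "{y\<in>carrier G. v (z \<otimes> y) = w}"] by simp
  qed
  then show ?thesis unfolding simple_mean_def image by simp
qed

lemma almost_coboundary_finite_valued:
  fixes g v :: "'a \<Rightarrow> 'a \<Rightarrow> 'v::real_normed_vector"
  assumes \<psi>: "\<And>x. x \<in> carrier G \<Longrightarrow> almost_additive_map W s D B (\<psi> x)"
    and \<delta>: "\<delta> < s" and finite_v: "\<And>x. x \<in> carrier G \<Longrightarrow> finite (v x ` carrier G)"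
    and v: "\<And>x y. x \<in> carrier G \<Longrightarrow> y \<in> carrier G \<Longrightarrow> v x y \<in> {u\<in>W. norm u \<le> \<delta>}"
    and cocycle: "\<And>x y z. x \<in> carrier G \<Longrightarrow> y \<in> carrier G \<Longrightarrow> z \<in> carrier G \<Longrightarrow>
        norm (v (x \<otimes> z) y + g x z - (v x (z \<otimes> y) + \<psi> x (v z y))) \<le> \<kappa>"
  obtains a where "\<And>x. x \<in> carrier G \<Longrightarrow> a x \<in> {u\<in>W. norm u \<le> \<delta>}"
    "\<And>x z. x \<in> carrier G \<Longrightarrow> z \<in> carrier G \<Longrightarrow>
      norm (a (x \<otimes> z) + g x z - (a x + \<psi> x (a z))) \<le> \<kappa> + 3 * D * \<delta>\<^sup>2"
proof -
  define a where "a x = simple_mean \<mu> (carrier G) (v x)" for x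
  have subspace_W: "subspace W"
    using \<psi> by (auto simp: almost_additive_map_def)
  show ?thesis
  proof (rule that)
    show "a x \<in> {u\<in>W. norm u \<le> \<delta>}" if "x \<in> carrier G" for x
      unfolding a_def using v[OF that] finite_v[OF that] subspace_W
      by (auto intro!: simple_mean_in_subspace norm_simple_mean_le)
    fix x z assume xz: "x \<in> carrier G" "z \<in> carrier G"
    have finite_translate: "finite ((\<lambda>y. v x (z \<otimes> y)) ` carrier G)"
      by (rule finite_subset[OF _ finite_v[OF xz(1)]]) (use xz in auto)
    have finite_twisted: "finite ((\<lambda>y. \<psi> x (v z y)) ` carrier G)"
      using finite_imageI[OF finite_v[OF xz(2)], of "\<psi> x"] by (simp add: image_image)
    have finite_left: "finite ((\<lambda>y. v (x \<otimes> z) y + g x z) ` carrier G)"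
      by (rule finite_image_binop) (use xz finite_v in \<open>auto simp: image_constant_conv\<close>)
    have finite_right: "finite ((\<lambda>y. v x (z \<otimes> y) + \<psi> x (v z y)) ` carrier G)"
      using finite_translate finite_twisted by (rule finite_image_binop)
    have left: "simple_mean \<mu> (carrier G) (\<lambda>y. v (x \<otimes> z) y + g x z) = a (x \<otimes> z) + g x z"
      unfolding a_def using xz finite_v by (subst simple_mean_add) (auto simp: simple_mean_const image_constant_conv)
    have right: "simple_mean \<mu> (carrier G) (\<lambda>y. v x (z \<otimes> y) + \<psi> x (v z y))
        = a x + simple_mean \<mu> (carrier G) (\<lambda>y. \<psi> x (v z y))"
      unfolding a_def simple_mean_add[OF finite_translate finite_twisted] by (simp add: simple_mean_translate xz)
    note averaged = norm_simple_mean_diff_le[OF finite_left finite_right cocycle[OF xz(1) _ xz(2)], unfolded left right]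
    have "norm (\<psi> x (a z) - simple_mean \<mu> (carrier G) (\<lambda>y. \<psi> x (v z y))) \<le> 3 * D * \<delta>\<^sup>2"
      unfolding a_def using xz v finite_v \<delta>
      by (intro simple_mean_almost_additive[OF \<psi>]) auto
    from norm_triangle_le_diff[OF add_mono[OF averaged this]]
    show "norm (a (x \<otimes> z) + g x z - (a x + \<psi> x (a z))) \<le> \<kappa> + 3 * D * \<delta>\<^sup>2" by (simp add: diff_diff_eq)
  qed
qed

lemma almost_coboundary:
  fixes g :: "'a \<Rightarrow> 'a \<Rightarrow> 'v::real_normed_vector"
  assumes \<psi>: "\<And>x. x \<in> carrier G \<Longrightarrow> almost_additive_map W s D B (\<psi> x)"
    and compact: "compact {u\<in>W. norm u \<le> \<delta>}" and \<delta>: "\<delta> < s" and \<eta>: "0 < \<eta>"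
    and g: "\<And>x y. x \<in> carrier G \<Longrightarrow> y \<in> carrier G \<Longrightarrow> g x y \<in> {u\<in>W. norm u \<le> \<delta>}"
    and cocycle: "\<And>x y z. x \<in> carrier G \<Longrightarrow> y \<in> carrier G \<Longrightarrow> z \<in> carrier G \<Longrightarrow>
        norm (g (x \<otimes> z) y + g x z - (g x (z \<otimes> y) + \<psi> x (g z y))) \<le> \<kappa>"
  obtains a where "\<And>x. x \<in> carrier G \<Longrightarrow> a x \<in> {u\<in>W. norm u \<le> \<delta>}"
    "\<And>x z. x \<in> carrier G \<Longrightarrow> z \<in> carrier G \<Longrightarrow>
      norm (a (x \<otimes> z) + g x z - (a x + \<psi> x (a z))) \<le> \<kappa> + (2 + B) * \<eta> + 3 * D * \<delta>\<^sup>2"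
proof -
  obtain \<rho> where finite_\<rho>: "finite (\<rho> ` {u\<in>W. norm u \<le> \<delta>})"
    and \<rho>: "\<And>u. u \<in> {u\<in>W. norm u \<le> \<delta>} \<Longrightarrow> \<rho> u \<in> {u\<in>W. norm u \<le> \<delta>}"
    and \<rho>_near: "\<And>u. u \<in> {u\<in>W. norm u \<le> \<delta>} \<Longrightarrow> norm (\<rho> u - u) \<le> \<eta>"
    by (rule compact_finite_valued_approximation[OF compact \<eta>, unfolded dist_norm]) (rule that)
  define v where "v x y = \<rho> (g x y)" for x y
  have v: "v x y \<in> {u\<in>W. norm u \<le> \<delta>}" "norm (v x y - g x y) \<le> \<eta>"
    if "x \<in> carrier G" "y \<in> carrier G" for x y
    using \<rho>[OF g[OF that]] \<rho>_near[OF g[OF that]] by (simp_all add: v_def)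
  have finite_v: "finite (v x ` carrier G)" if "x \<in> carrier G" for x
    by (rule finite_subset[OF _ finite_\<rho>]) (use g that in \<open>auto simp: v_def\<close>)
  have near: "norm ((v (x \<otimes> z) y + g x z) - (v x (z \<otimes> y) + \<psi> x (v z y))) \<le> \<kappa> + (2 + B) * \<eta>"
    if xyz: "x \<in> carrier G" "y \<in> carrier G" "z \<in> carrier G" for x y z
  proof -
    interpret \<psi>: almost_additive_map W s D B "\<psi> x" by (rule \<psi>[OF xyz(1)])
    have "norm (\<psi> x (v z y) - \<psi> x (g z y)) \<le> B * norm (v z y - g z y)"
      using v(1)[OF xyz(3,2)] g[OF xyz(3,2)] \<delta> by (intro \<psi>.Lipschitz) auto
    also have "\<dots> \<le> B * \<eta>" using v(2)[OF xyz(3,2)] \<psi>.B_nonneg by (rule mult_left_mono)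
    finally have twisted: "norm (\<psi> x (v z y) - \<psi> x (g z y)) \<le> B * \<eta>" .
    have "(v (x \<otimes> z) y + g x z) - (v x (z \<otimes> y) + \<psi> x (v z y))
        = (g (x \<otimes> z) y + g x z - (g x (z \<otimes> y) + \<psi> x (g z y))) + (v (x \<otimes> z) y - g (x \<otimes> z) y)
          - (v x (z \<otimes> y) - g x (z \<otimes> y)) - (\<psi> x (v z y) - \<psi> x (g z y))" by simp
    also have "norm \<dots> \<le> \<kappa> + \<eta> + \<eta> + B * \<eta>"
      using xyz by (intro norm_triangle_le_diff norm_triangle_mono add_mono cocycle v(2) twisted) auto
    finally show ?thesis by (simp add: algebra_simps)
  qed
  show ?thesis
    by (rule almost_coboundary_finite_valued[where v = v and g = g, OF \<psi> \<delta> finite_v v(1) near])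
      (assumption | rule that)+
qed

end

lemma amenable_group_imp_amenable_mean:
  assumes "amenable_group G"
  obtains \<mu> where "amenable_mean G \<mu>"
proof -
  have "group G" using assms by (simp add: amenable_group_def)
  moreover obtain \<mu> :: "'a set \<Rightarrow> real" where
    "(\<forall>A \<subseteq> carrier G. 0 \<le> \<mu> A) \<and> \<mu> (carrier G) = 1 \<and>
     (\<forall>A \<subseteq> carrier G. \<forall>B \<subseteq> carrier G. A \<inter> B = {} \<longrightarrow> \<mu> (A \<union> B) = \<mu> A + \<mu> B) \<and>
     (\<forall>g \<in> carrier G. \<forall>A \<subseteq> carrier G. \<mu> (g <#\<^bsub>G\<^esub> A) = \<mu> A)"
    using assms unfolding amenable_group_def by (elim conjE exE) (rule that, intro conjI)
  ultimately have "amenable_mean G \<mu>"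
    by (intro amenable_mean.intro finitely_additive_probability.intro amenable_mean_axioms.intro) auto
  then show ?thesis by (rule that)
qed

section \<open>Ultrafilters\<close>

lemma ultrafilter_imp_not_bot: "ultrafilter U \<Longrightarrow> U \<noteq> bot"
  by (simp add: ultrafilter_def)

lemma ultrafilter_eventually_not_iff:
  assumes "ultrafilter U"
  shows "(\<forall>\<^sub>F i in U. \<not> P i) \<longleftrightarrow> \<not> eventually P U"
proof
  assume not_P: "\<forall>\<^sub>F i in U. \<not> P i"
  show "\<not> eventually P U"
  proof
    assume "eventually P U"
    with not_P have "\<forall>\<^sub>F i in U. False" by eventually_elim simp
    then show False using ultrafilter_imp_not_bot[OF assms] by (simp add: trivial_limit_def)
  qed
next
  assume "\<not> eventually P U"
  then show "\<forall>\<^sub>F i in U. \<not> P i"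
    using assms[unfolded ultrafilter_def, THEN conjunct2, rule_format, of "{i. P i}"] by auto
qed

lemma ultrafilter_eventually_bex_finite:
  assumes "ultrafilter U" "finite A" "\<forall>\<^sub>F i in U. \<exists>p\<in>A. Q p i"
  shows "\<exists>p\<in>A. \<forall>\<^sub>F i in U. Q p i"
proof (rule ccontr)
  assume "\<not> ?thesis"
  then have "\<forall>p\<in>A. \<forall>\<^sub>F i in U. \<not> Q p i" by (simp add: ultrafilter_eventually_not_iff[OF assms(1)])
  then have "\<forall>\<^sub>F i in U. \<forall>p\<in>A. \<not> Q p i" by (rule eventually_ball_finite[OF assms(2)])
  then have "\<forall>\<^sub>F i in U. \<not> (\<exists>p\<in>A. Q p i)" by eventually_elim blast
  then show False
    using assms(3) ultrafilter_eventually_not_iff[OF assms(1), of "\<lambda>i. \<exists>p\<in>A. Q p i"] by blast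
qed

lemma ultrafilter_if_minimal:
  assumes "U \<noteq> bot" and minimal: "\<And>G. G \<le> U \<Longrightarrow> G \<noteq> bot \<Longrightarrow> G = U"
  shows "ultrafilter U"
proof -
  have "(\<forall>\<^sub>F i in U. i \<in> S) \<or> (\<forall>\<^sub>F i in U. i \<notin> S)" for S
  proof (cases "inf U (principal S) = bot")
    case True
    then have "eventually (\<lambda>_. False) (inf U (principal S))" by simp
    then show ?thesis by (simp add: eventually_inf_principal)
  next
    case False
    then have "inf U (principal S) = U" by (intro minimal) auto
    moreover have "\<forall>\<^sub>F i in inf U (principal S). i \<in> S" by (simp add: eventually_inf_principal)
    ultimately show ?thesis by simp
  qed
  then show ?thesis using assms(1) by (simp add: ultrafilter_def)
qed

lemma Inf_filter_chain_not_bot: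
  fixes \<F> :: "'a filter set"
  assumes "\<F> \<noteq> {}" and proper: "bot \<notin> \<F>" and chain: "\<And>F G. F \<in> \<F> \<Longrightarrow> G \<in> \<F> \<Longrightarrow> F \<le> G \<or> G \<le> F"
  shows "Inf \<F> \<noteq> bot"
proof -
  have "\<not> eventually (\<lambda>_. False) (Inf \<F>)"
  proof (subst eventually_Inf_base[OF assms(1)])
    show "\<exists>x\<in>\<F>. x \<le> inf F G" if "F \<in> \<F>" "G \<in> \<F>" for F G
      using chain[OF that] that by (auto intro!: bexI[of _ "inf F G"] simp: inf_absorb1 inf_absorb2)
    show "\<not> (\<exists>F\<in>\<F>. eventually (\<lambda>_. False) F)"
      using proper by (auto simp: trivial_limit_def[symmetric])
  qed
  then show ?thesis by (simp add: trivial_limit_def)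
qed

lemma ultrafilter_below:
  assumes "F \<noteq> bot"
  obtains U where "U \<le> F" "ultrafilter U"
proof -
  let ?A = "{G. G \<le> F \<and> G \<noteq> bot}"
  have "\<exists>m\<in>?A. \<forall>a\<in>?A. m \<ge> a \<longrightarrow> a = m"
  proof (rule predicate_Zorn)
    show "partial_order_on ?A (relation_of (\<ge>) ?A)"
      by (rule partial_order_on_relation_ofI) auto
    fix \<C> assume \<C>: "\<C> \<in> Chains (relation_of (\<ge>) ?A)"
    show "\<exists>u\<in>?A. \<forall>a\<in>\<C>. a \<ge> u"
    proof (cases "\<C> = {}")
      case True
      then show ?thesis using assms by auto
    next
      case False
      then have "Inf \<C> \<noteq> bot"
        by (rule Inf_filter_chain_not_bot) (use \<C> in \<open>auto simp: Chains_def relation_of_def\<close>)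
      moreover obtain G where "G \<in> \<C>" "G \<le> F"
        using False \<C> by (auto simp: Chains_def relation_of_def)
      then have "Inf \<C> \<le> F" by (rule Inf_lower2)
      ultimately show ?thesis by (intro bexI[of _ "Inf \<C>"]) (auto intro: Inf_lower)
    qed
  qed
  then obtain U where U: "U \<le> F" "U \<noteq> bot" and minimal: "\<And>G. G \<le> U \<Longrightarrow> G \<noteq> bot \<Longrightarrow> G = U"
    by (auto intro: order_trans)
  show ?thesis by (rule that[OF U(1) ultrafilter_if_minimal[OF U(2) minimal]])
qed

lemma finite_cover_if_ultrafilters:
  assumes covered: "\<And>U. ultrafilter U \<Longrightarrow> \<forall>\<^sub>F x in U. x \<in> D \<Longrightarrow> \<exists>P\<in>\<P>. \<forall>\<^sub>F x in U. x \<in> P"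
  obtains \<Q> where "finite \<Q>" "\<Q> \<subseteq> \<P>" "D \<subseteq> \<Union>\<Q>"
proof -
  have "\<exists>\<Q>. finite \<Q> \<and> \<Q> \<subseteq> \<P> \<and> D \<subseteq> \<Union>\<Q>"
  proof (rule ccontr)
    assume uncovered: "\<not> ?thesis"
    define F where "F = (INF P\<in>insert {} \<P>. principal (D - P))"
    have "F \<noteq> bot"
      unfolding F_def
    proof (rule INF_filter_not_bot)
      fix \<Q> assume \<Q>: "\<Q> \<subseteq> insert {} \<P>" "finite \<Q>"
      then have "\<not> D \<subseteq> \<Union>(\<Q> - {{}})" using uncovered by blast
      then have "(\<Inter>P\<in>\<Q>. D - P) \<noteq> {}" by blast
      then show "(INF P\<in>\<Q>. principal (D - P)) \<noteq> bot"
        by (simp add: INF_principal_finite[OF \<Q>(2)] principal_eq_bot_iff)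
    qed
    then obtain U where U: "U \<le> F" "ultrafilter U" by (rule ultrafilter_below)
    have outside: "\<forall>\<^sub>F x in U. x \<in> D - P" if "P \<in> insert {} \<P>" for P
    proof -
      have "U \<le> principal (D - P)" using U(1) that unfolding F_def by (meson INF_lower order_trans)
      then show ?thesis by (simp add: le_principal)
    qed
    then obtain P where P: "P \<in> \<P>" "\<forall>\<^sub>F x in U. x \<in> P" using covered[OF U(2)] outside[of "{}"] by auto
    have "\<forall>\<^sub>F x in U. x \<notin> P" using outside[of P] P(1) by (auto elim: eventually_mono)
    then show False using P(2) ultrafilter_eventually_not_iff[OF U(2)] by blast
  qed
  then show ?thesis using that by blast
qed

lemma compact_space_ultrafilter_limit:
  assumes U: "ultrafilter U" and T: "compact_space T" and f: "\<forall>\<^sub>F i in U. f i \<in> topspace T"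
  obtains l where "limitin T f l U"
proof -
  have "\<exists>l. limitin T f l U"
  proof (rule ccontr)
    assume no_limit: "\<nexists>l. limitin T f l U"
    have "\<exists>V. openin T V \<and> l \<in> V \<and> (\<forall>\<^sub>F i in U. f i \<notin> V)" if "l \<in> topspace T" for l
      using no_limit that unfolding limitin_def ultrafilter_eventually_not_iff[OF U] by blast
    then obtain V where V: "\<And>l. l \<in> topspace T \<Longrightarrow> openin T (V l) \<and> l \<in> V l \<and> (\<forall>\<^sub>F i in U. f i \<notin> V l)"
      by metis
    have "\<exists>\<F>. finite \<F> \<and> \<F> \<subseteq> V ` topspace T \<and> topspace T \<subseteq> \<Union>\<F>"
      by (rule T[unfolded compact_space_alt, rule_format]) (use V in auto)
    then obtain \<F> where \<F>: "finite \<F>" "\<F> \<subseteq> V ` topspace T" "topspace T \<subseteq> \<Union>\<F>" by blast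
    have "\<forall>\<^sub>F i in U. \<forall>X\<in>\<F>. f i \<notin> X"
      using \<F> V by (intro eventually_ball_finite) auto
    then have "\<forall>\<^sub>F i in U. f i \<notin> topspace T" by eventually_elim (use \<F>(3) in blast)
    then show False using f ultrafilter_eventually_not_iff[OF U] by blast
  qed
  then show ?thesis using that by blast
qed

lemma ultrafilter_bounded_tendsto:
  fixes f :: "'i \<Rightarrow> real"
  assumes U: "ultrafilter U" and bound: "\<forall>\<^sub>F i in U. \<bar>f i\<bar> \<le> B"
  shows "(f \<longlongrightarrow> Lim U f) U"
proof -
  let ?T = "subtopology euclideanreal {-B..B}"
  have "compact_space ?T" by (simp add: compact_space_subtopology)
  moreover have "\<forall>\<^sub>F i in U. f i \<in> topspace ?T" using bound by eventually_elim auto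
  ultimately obtain l where "limitin ?T f l U" by (rule compact_space_ultrafilter_limit[OF U])
  then have "(f \<longlongrightarrow> l) U" by (simp add: limitin_subtopology)
  with tendsto_Lim[OF ultrafilter_imp_not_bot[OF U] this] show ?thesis by simp
qed

lemma witness_section:
  assumes "\<And>i. A i \<noteq> {}"
  obtains a where "\<And>i. a i \<in> A i" "\<And>i. \<exists>x\<in>A i. P i x \<Longrightarrow> P i (a i)"
proof -
  have "\<forall>i. \<exists>x\<in>A i. (\<exists>x\<in>A i. P i x) \<longrightarrow> P i x" using assms by blast
  then show ?thesis using that by metis
qed

lemma eventually_bex_iff_section:
  assumes "\<And>i. A i \<noteq> {}"
  shows "(\<forall>\<^sub>F i in F. \<exists>x\<in>A i. P i x) \<longleftrightarrow> (\<exists>a. (\<forall>i. a i \<in> A i) \<and> (\<forall>\<^sub>F i in F. P i (a i)))"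
proof
  assume witnesses: "\<forall>\<^sub>F i in F. \<exists>x\<in>A i. P i x"
  obtain a where a: "\<And>i. a i \<in> A i" "\<And>i. \<exists>x\<in>A i. P i x \<Longrightarrow> P i (a i)"
    by (rule witness_section[where A = A and P = P, OF assms]) (rule that)
  from witnesses have "\<forall>\<^sub>F i in F. P i (a i)" by eventually_elim (rule a(2))
  with a(1) show "\<exists>a. (\<forall>i. a i \<in> A i) \<and> (\<forall>\<^sub>F i in F. P i (a i))" by blast
next
  assume "\<exists>a. (\<forall>i. a i \<in> A i) \<and> (\<forall>\<^sub>F i in F. P i (a i))"
  then obtain a where a: "\<And>i. a i \<in> A i" "\<forall>\<^sub>F i in F. P i (a i)" by blast
  from a(2) show "\<forall>\<^sub>F i in F. \<exists>x\<in>A i. P i x" by eventually_elim (use a(1) in blast)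
qed

lemma eventually_ball_if_sections:
  assumes "\<And>i. A i \<noteq> {}" and "\<And>a. (\<And>i. a i \<in> A i) \<Longrightarrow> \<forall>\<^sub>F i in F. P i (a i)"
  shows "\<forall>\<^sub>F i in F. \<forall>x\<in>A i. P i x"
proof -
  obtain a where a: "\<And>i. a i \<in> A i" "\<And>i. \<exists>x\<in>A i. \<not> P i x \<Longrightarrow> \<not> P i (a i)"
    by (rule witness_section[where A = A and P = "\<lambda>i x. \<not> P i x", OF assms(1)]) (rule that)
  from assms(2)[OF a(1)] show ?thesis by eventually_elim (use a(2) in blast)
qed

lemma countably_incomplete_diagonal:
  assumes "countably_incomplete U" and P: "\<And>m. \<forall>\<^sub>F i in U. P m i"
  obtains k :: "'i \<Rightarrow> nat" where "\<forall>\<^sub>F i in U. P (k i) i" "\<And>m. \<forall>\<^sub>F i in U. m \<le> k i"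
proof -
  obtain \<F> where \<F>: "countable \<F>" "\<And>S. S \<in> \<F> \<Longrightarrow> \<forall>\<^sub>F i in U. i \<in> S" "\<Inter>\<F> = {}"
    using assms(1) unfolding countably_incomplete_def by blast
  then have "\<F> \<noteq> {}" by auto
  then have "range (from_nat_into \<F>) = \<F>" using \<F>(1) by (rule range_from_nat_into)
  then obtain Y :: "nat \<Rightarrow> 'i set" where "range Y = \<F>" by (rule that)
  then have Y: "\<And>m. \<forall>\<^sub>F i in U. i \<in> Y m" "(\<Inter>m. Y m) = {}" using \<F>(2,3) by auto
  define M where "M i = {m. i \<in> (\<Inter>j\<le>m. Y j) \<and> P m i}" for i
  define k where "k i = Max (M i)" for i
  have "finite (M i)" for i
  proof -
    obtain j where "i \<notin> Y j" using Y(2) by blast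
    then have "M i \<subseteq> {..<j}" by (auto simp: M_def not_le[symmetric])
    then show ?thesis by (rule finite_subset) simp
  qed
  then have k: "P (k i) i" "m \<le> k i" if "m \<in> M i" for i m
    using that Max_in[of "M i"] by (auto simp: k_def M_def)
  have M: "\<forall>\<^sub>F i in U. m \<in> M i" for m
  proof -
    have "\<forall>\<^sub>F i in U. \<forall>j\<in>{..m}. i \<in> Y j" by (intro eventually_ball_finite ballI Y) simp
    with P[of m] show ?thesis by eventually_elim (simp add: M_def)
  qed
  show ?thesis
  proof (rule that)
    show "\<forall>\<^sub>F i in U. P (k i) i" using M[of 0] by eventually_elim (rule k(1))
    show "\<forall>\<^sub>F i in U. m \<le> k i" for m using M[of m] by eventually_elim (rule k(2))
  qed
qed

section \<open>Compact topological groups\<close>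

locale topological_group = group K for K (structure) +
  fixes T
  assumes topspace_eq: "topspace T = carrier K"
    and continuous_mult: "continuous_map (prod_topology T T) T (\<lambda>(x, y). x \<otimes> y)"
    and continuous_inv: "continuous_map T T (\<lambda>x. inv x)"
begin

lemma inv_mult_cancel [simp]:
  "x \<in> carrier K \<Longrightarrow> y \<in> carrier K \<Longrightarrow> inv x \<otimes> (x \<otimes> y) = y"
  "x \<in> carrier K \<Longrightarrow> y \<in> carrier K \<Longrightarrow> x \<otimes> (inv x \<otimes> y) = y"
  by (simp_all add: m_assoc[symmetric])

lemma openin_imp_carrier: "openin T N \<Longrightarrow> x \<in> N \<Longrightarrow> x \<in> carrier K"
  using openin_subset topspace_eq by blast

lemma continuous_map_group_mult:
  "continuous_map X T f \<Longrightarrow> continuous_map X T g \<Longrightarrow> continuous_map X T (\<lambda>x. f x \<otimes> g x)"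
  using continuous_map_compose[OF _ continuous_mult, of X "\<lambda>x. (f x, g x)"]
  by (simp add: continuous_map_pairedI o_def)

lemma continuous_map_group_inv:
  "continuous_map X T f \<Longrightarrow> continuous_map X T (\<lambda>x. inv (f x))"
  using continuous_map_compose[OF _ continuous_inv, of X f] by (simp add: o_def)

lemma limitin_group_mult:
  assumes "limitin T f a F" "limitin T g b F"
  shows "limitin T (\<lambda>i. f i \<otimes> g i) (a \<otimes> b) F"
proof -
  have "limitin (prod_topology T T) (\<lambda>i. (f i, g i)) (a, b) F"
    using assms by (simp add: limitin_pairwise o_def)
  from continuous_map_limit[OF continuous_mult this] show ?thesis by (simp add: o_def)
qed

lemma limitin_group_inv:
  "limitin T f a F \<Longrightarrow> limitin T (\<lambda>i. inv (f i)) (inv a) F"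
  using continuous_map_limit[OF continuous_inv, of f a F] by (simp add: o_def)

lemma openin_right_translate:
  assumes "openin T N" "k \<in> carrier K"
  shows "openin T {x \<in> carrier K. x \<otimes> k \<in> N}"
proof -
  have "continuous_map T T (\<lambda>x. x \<otimes> k)"
    using assms(2) by (intro continuous_map_group_mult) (auto simp: topspace_eq)
  from openin_continuous_map_preimage[OF this assms(1)] show ?thesis by (simp add: topspace_eq)
qed

lemma limitin_if_quotients:
  assumes k: "k \<in> carrier K" and f: "\<forall>\<^sub>F i in F. f i \<in> carrier K"
    and quotients: "\<And>N. openin T N \<Longrightarrow> \<one> \<in> N \<Longrightarrow> \<forall>\<^sub>F i in F. f i \<otimes> inv k \<in> N"
  shows "limitin T f k F"
  unfolding limitin_def
proof (intro conjI allI impI)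
  show "k \<in> topspace T" using k by (simp add: topspace_eq)
  fix N assume N: "openin T N \<and> k \<in> N"
  have "openin T {x \<in> carrier K. x \<otimes> k \<in> N}" using N k by (intro openin_right_translate) auto
  then have "\<forall>\<^sub>F i in F. f i \<otimes> inv k \<in> {x \<in> carrier K. x \<otimes> k \<in> N}"
    by (rule quotients) (use N k in simp)
  with f show "\<forall>\<^sub>F i in F. f i \<in> N" by eventually_elim (use k in \<open>simp add: m_assoc\<close>)
qed

lemma symmetric_neighbourhood:
  assumes "openin T N" "\<one> \<in> N"
  obtains N' where "openin T N'" "\<one> \<in> N'" "\<And>p. p \<in> N' \<Longrightarrow> inv p \<in> N'"
    "\<And>p q. p \<in> N' \<Longrightarrow> q \<in> N' \<Longrightarrow> p \<otimes> q \<in> N"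
proof -
  let ?P = "prod_topology T T"
  have "openin ?P {z \<in> topspace ?P. (case z of (x, y) \<Rightarrow> x \<otimes> y) \<in> N}" (is "openin _ ?W")
    using continuous_mult assms(1) by (rule openin_continuous_map_preimage)
  moreover have "(\<one>, \<one>) \<in> ?W" using assms(2) by (simp add: topspace_eq)
  ultimately have "\<exists>A B. openin T A \<and> openin T B \<and> \<one> \<in> A \<and> \<one> \<in> B \<and> A \<times> B \<subseteq> ?W"
    unfolding openin_prod_topology_alt by blast
  then obtain A B where AB: "openin T A" "openin T B" "\<one> \<in> A" "\<one> \<in> B" "A \<times> B \<subseteq> ?W"
    by (elim exE conjE)
  let ?N = "A \<inter> B \<inter> {x \<in> topspace T. inv x \<in> A \<inter> B}"
  show ?thesis
  proof (rule that[of ?N])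
    show "openin T ?N"
      by (intro openin_Int AB(1,2) openin_continuous_map_preimage[OF continuous_inv])
  qed (use AB in \<open>auto simp: topspace_eq\<close>)
qed

definition defect :: "('h, 'm) monoid_scheme \<Rightarrow> ('h \<Rightarrow> 'a) \<Rightarrow> 'h \<Rightarrow> 'h \<Rightarrow> 'a" where
  "defect H f x z = f (x \<otimes>\<^bsub>H\<^esub> z) \<otimes> inv (f z) \<otimes> inv (f x)"

lemma defect_cocycle:
  assumes H: "group H" and f: "f \<in> carrier H \<rightarrow> carrier K"
    and xyz: "x \<in> carrier H" "y \<in> carrier H" "z \<in> carrier H"
  shows "defect H f (x \<otimes>\<^bsub>H\<^esub> z) y \<otimes> defect H f x z
    = defect H f x (z \<otimes>\<^bsub>H\<^esub> y) \<otimes> (f x \<otimes> defect H f z y \<otimes> inv (f x))"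
proof -
  interpret H: group H by fact
  have "f w \<in> carrier K" if "w \<in> carrier H" for w using f that by auto
  then show ?thesis using xyz by (simp add: defect_def m_assoc H.m_assoc)
qed

lemma defect_left_multiple:
  assumes H: "group H" and f: "f \<in> carrier H \<rightarrow> carrier K" and e: "e \<in> carrier H \<rightarrow> carrier K"
    and xz: "x \<in> carrier H" "z \<in> carrier H"
  shows "defect H (\<lambda>w. e w \<otimes> f w) x z
    = (e (x \<otimes>\<^bsub>H\<^esub> z) \<otimes> defect H f x z) \<otimes> inv (e x \<otimes> (f x \<otimes> e z \<otimes> inv (f x)))"
proof -
  interpret H: group H by fact
  have "f w \<in> carrier K" "e w \<in> carrier K" if "w \<in> carrier H" for w using f e that by auto
  then show ?thesis using xz by (simp add: defect_def m_assoc inv_mult_group)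
qed

lemma hom_if_defect_one:
  assumes H: "group H" and f: "f \<in> carrier H \<rightarrow> carrier K"
    and defect: "\<And>x z. x \<in> carrier H \<Longrightarrow> z \<in> carrier H \<Longrightarrow> defect H f x z = \<one>"
  shows "f \<in> hom H K"
proof (rule homI)
  interpret H: group H by fact
  fix x z assume xz: "x \<in> carrier H" "z \<in> carrier H"
  have K: "f x \<in> carrier K" "f z \<in> carrier K" "f (x \<otimes>\<^bsub>H\<^esub> z) \<in> carrier K" using f xz by auto
  then have "f (x \<otimes>\<^bsub>H\<^esub> z) = defect H f x z \<otimes> (f x \<otimes> f z)" by (simp add: defect_def m_assoc)
  then show "f (x \<otimes>\<^bsub>H\<^esub> z) = f x \<otimes> f z" using defect[OF xz] K by simp
qed (use f in auto)

definition Ulam_stable :: "('h, 'm) monoid_scheme set \<Rightarrow> bool" where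
  "Ulam_stable \<H> \<longleftrightarrow> (\<forall>N. openin T N \<longrightarrow> \<one> \<in> N \<longrightarrow> (\<exists>N'. openin T N' \<and> \<one> \<in> N' \<and>
     (\<forall>H\<in>\<H>. \<forall>f\<in>carrier H \<rightarrow> carrier K. (\<forall>x\<in>carrier H. \<forall>z\<in>carrier H. defect H f x z \<in> N') \<longrightarrow>
        (\<exists>h\<in>hom H K. \<forall>x\<in>carrier H. h x \<otimes> inv (f x) \<in> N))))"

end

locale compact_Hausdorff_group = topological_group +
  assumes compact: "compact_space T" and Hausdorff: "Hausdorff_space T"
begin

lemma conjugation_equicontinuous:
  assumes "openin T N" "\<one> \<in> N"
  obtains N' where "openin T N'" "\<one> \<in> N'"
    "\<And>k x. k \<in> carrier K \<Longrightarrow> x \<in> N' \<Longrightarrow> k \<otimes> x \<otimes> inv k \<in> N"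
proof -
  let ?W = "{z \<in> topspace (prod_topology T T). fst z \<otimes> snd z \<otimes> inv (fst z) \<in> N}"
  have "continuous_map (prod_topology T T) T (\<lambda>z. fst z \<otimes> snd z \<otimes> inv (fst z))"
    by (intro continuous_map_group_mult continuous_map_group_inv continuous_map_fst continuous_map_snd)
  then have "openin (prod_topology T T) ?W"
    using assms(1) by (rule openin_continuous_map_preimage)
  moreover have "compactin T (carrier K)" using compact by (simp add: compact_space_def topspace_eq)
  moreover have "carrier K \<times> {\<one>} \<subseteq> ?W" using assms(2) by (auto simp: topspace_eq)
  ultimately obtain A B where "openin T B" "\<one> \<in> B" "carrier K \<subseteq> A" "A \<times> B \<subseteq> ?W"
    using tube_lemma_left[of T T ?W "carrier K" \<one>] by (auto simp: topspace_eq)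
  then show ?thesis using that[of B] by fastforce
qed

lemma closed_neighbourhood:
  assumes "openin T N" "x \<in> N"
  obtains A D where "openin T A" "closedin T D" "x \<in> A" "A \<subseteq> D" "D \<subseteq> N"
proof -
  have "neighbourhood_base_of (closedin T) T"
    using compact Hausdorff by (simp add: compact_Hausdorff_imp_regular_space neighbourhood_base_of_closedin)
  then show ?thesis
    using assms that unfolding neighbourhood_base_of by blast
qed

lemma ultralimit_hom:
  assumes U: "ultrafilter U" and H: "group H"
    and F: "\<And>n x. x \<in> carrier H \<Longrightarrow> F n x \<in> carrier K"
    and defect: "\<And>x z. x \<in> carrier H \<Longrightarrow> z \<in> carrier H \<Longrightarrow> limitin T (\<lambda>n. defect H (F n) x z) \<one> U"
  obtains h where "h \<in> hom H K" "\<And>x. x \<in> carrier H \<Longrightarrow> limitin T (\<lambda>n. F n x) (h x) U"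
proof -
  interpret H: group H by fact
  have "\<exists>y. limitin T (\<lambda>n. F n x) y U" if "x \<in> carrier H" for x
    by (rule compact_space_ultrafilter_limit[OF U compact, of "\<lambda>n. F n x"])
      (use F[OF that] in \<open>auto simp: topspace_eq\<close>)
  then obtain h where h: "\<And>x. x \<in> carrier H \<Longrightarrow> limitin T (\<lambda>n. F n x) (h x) U" by metis
  have "h \<in> hom H K"
  proof (rule hom_if_defect_one[OF H])
    show "h \<in> carrier H \<rightarrow> carrier K" using limitin_topspace[OF h] by (auto simp: topspace_eq)
    fix x z assume xz: "x \<in> carrier H" "z \<in> carrier H"
    then have "limitin T (\<lambda>n. defect H (F n) x z) (defect H h x z) U"
      unfolding defect_def by (intro limitin_group_mult limitin_group_inv h) auto
    from limitin_Hausdorff_unique[OF this defect[OF xz] ultrafilter_imp_not_bot[OF U] Hausdorff]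
    show "defect H h x z = \<one>" .
  qed
  then show ?thesis using h by (rule that)
qed

end

section \<open>Ulam stability\<close>

text \<open>The only consequence of smoothness that Ulam stability needs: near the identity, the chart
  \<open>l\<close> is additive up to a bilinear error.\<close>

locale almost_additive_chart = compact_Hausdorff_group K T for K (structure) and T +
  fixes W :: "'v::real_normed_vector set" and V :: "'a set" and l :: "'a \<Rightarrow> 'v" and R C :: real
  assumes subspace_W: "subspace W" and compact_W: "compact {u\<in>W. norm u \<le> d}"
    and R_pos: "0 < R" and C_nonneg: "0 \<le> C" and C_R_le: "C * R \<le> 1 / 4"
    and V_subset: "V \<subseteq> carrier K" and one_V: "\<one> \<in> V" and l_one: "l \<one> = 0"
    and l_W: "x \<in> V \<Longrightarrow> l x \<in> W" and inj: "inj_on l V"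
    and surj: "u \<in> W \<Longrightarrow> norm u < R \<Longrightarrow> u \<in> l ` V"
    and openin_norm_less: "0 < s \<Longrightarrow> openin T {x\<in>V. norm (l x) < s}"
    and norm_less_subset: "openin T N \<Longrightarrow> \<one> \<in> N \<Longrightarrow> \<exists>s>0. {x\<in>V. norm (l x) < s} \<subseteq> N"
    and mult_near: "x \<in> V \<Longrightarrow> y \<in> V \<Longrightarrow> norm (l x) < R \<Longrightarrow> norm (l y) < R \<Longrightarrow>
        x \<otimes> y \<in> V \<and> norm (l (x \<otimes> y) - l x - l y) \<le> C * norm (l x) * norm (l y)"
begin

definition chart_ball :: "real \<Rightarrow> 'a set" where "chart_ball s = {x\<in>V. norm (l x) < s}"

definition chart_cball :: "real \<Rightarrow> 'a set" where "chart_cball b = {x\<in>V. norm (l x) \<le> b}"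

definition unchart :: "'v \<Rightarrow> 'a" where "unchart = inv_into V l"

lemma chart_ballD: "x \<in> chart_ball s \<Longrightarrow> x \<in> V \<and> norm (l x) < s"
  by (simp add: chart_ball_def)

lemma chart_cballD: "x \<in> chart_cball b \<Longrightarrow> x \<in> V \<and> norm (l x) \<le> b"
  by (simp add: chart_cball_def)

lemma chart_ball_mono: "s \<le> t \<Longrightarrow> x \<in> chart_ball s \<Longrightarrow> x \<in> chart_ball t"
  by (auto simp: chart_ball_def)

lemma chart_cball_mono: "b \<le> c \<Longrightarrow> x \<in> chart_cball b \<Longrightarrow> x \<in> chart_cball c"
  by (auto simp: chart_cball_def)

lemma chart_cball_subset_ball: "b < s \<Longrightarrow> x \<in> chart_cball b \<Longrightarrow> x \<in> chart_ball s"
  by (auto simp: chart_ball_def chart_cball_def)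

lemma V_carrier: "x \<in> V \<Longrightarrow> x \<in> carrier K"
  using V_subset by blast

lemma one_chart_ball: "0 < s \<Longrightarrow> \<one> \<in> chart_ball s"
  by (simp add: chart_ball_def one_V l_one)

lemma one_chart_cball: "0 \<le> b \<Longrightarrow> \<one> \<in> chart_cball b"
  by (simp add: chart_cball_def one_V l_one)

lemma openin_chart_ball: "0 < s \<Longrightarrow> openin T (chart_ball s)"
  unfolding chart_ball_def by (rule openin_norm_less)

lemma chart_ball_subset:
  assumes "openin T N" "\<one> \<in> N" "0 < t"
  obtains s where "0 < s" "s \<le> t" "chart_ball s \<subseteq> N"
proof -
  obtain s where "s > 0" "{x\<in>V. norm (l x) < s} \<subseteq> N" using norm_less_subset assms by blast
  then show ?thesis using that[of "min s t"] assms(3) by (auto simp: chart_ball_def)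
qed

lemma unchart:
  assumes "u \<in> W" "norm u < R"
  shows "unchart u \<in> V" "l (unchart u) = u"
  using surj[OF assms] by (simp_all add: unchart_def inv_into_into f_inv_into_f)

lemma unchart_l: "x \<in> V \<Longrightarrow> unchart (l x) = x"
  unfolding unchart_def by (rule inv_into_f_f[OF inj])

lemma unchart_chart_ball: "u \<in> W \<Longrightarrow> norm u < s \<Longrightarrow> s \<le> R \<Longrightarrow> unchart u \<in> chart_ball s"
  using unchart[of u] by (simp add: chart_ball_def)

lemma mult_in_V: "x \<in> chart_ball R \<Longrightarrow> y \<in> chart_ball R \<Longrightarrow> x \<otimes> y \<in> V"
  using mult_near by (simp add: chart_ball_def)

lemma norm_mult_diff_le:
  assumes x: "x \<in> chart_ball R" and y: "y \<in> chart_ball R"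
  shows "norm (l (x \<otimes> y) - l x - l y) \<le> C * norm (l x) * norm (l y)"
    "norm (l (x \<otimes> y) - l x - l y) \<le> norm (l x) / 4"
    "norm (l (x \<otimes> y) - l x - l y) \<le> norm (l y) / 4"
proof -
  show near: "norm (l (x \<otimes> y) - l x - l y) \<le> C * norm (l x) * norm (l y)"
    using mult_near x y by (simp add: chart_ball_def)
  have quarter: "C * norm (l w) \<le> 1 / 4" if "w \<in> chart_ball R" for w
    using mult_left_mono[OF less_imp_le C_nonneg, of "norm (l w)" R] chart_ballD[OF that] C_R_le by linarith
  show "norm (l (x \<otimes> y) - l x - l y) \<le> norm (l y) / 4"
    using near mult_right_mono[OF quarter[OF x] norm_ge_zero[of "l y"]] by simp
  show "norm (l (x \<otimes> y) - l x - l y) \<le> norm (l x) / 4"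
    using near mult_right_mono[OF quarter[OF y] norm_ge_zero[of "l x"]] by (simp add: algebra_simps)
qed

lemma norm_mult_le:
  assumes "x \<in> chart_ball R" "y \<in> chart_ball R"
  shows "norm (l (x \<otimes> y)) \<le> 5 / 4 * norm (l x) + norm (l y)"
proof -
  have "norm ((l (x \<otimes> y) - l x - l y) + (l x + l y)) \<le> norm (l x) / 4 + (norm (l x) + norm (l y))"
    using norm_mult_diff_le(2)[OF assms] by (intro norm_triangle_mono norm_triangle_ineq)
  then show ?thesis by simp
qed

lemma mult_in_chart_cball:
  assumes x: "x \<in> chart_cball a" and y: "y \<in> chart_cball b" and "a < R" "b < R"
  shows "x \<otimes> y \<in> chart_cball (5 / 4 * a + b)"
proof -
  have balls: "x \<in> chart_ball R" "y \<in> chart_ball R" using assms chart_cball_subset_ball by blast+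
  have "norm (l (x \<otimes> y)) \<le> 5 / 4 * a + b"
    using norm_mult_le[OF balls] chart_cballD[OF x] chart_cballD[OF y] by linarith
  then show ?thesis using mult_in_V[OF balls] by (simp add: chart_cball_def)
qed

lemma quotient_chart_ball:
  assumes "0 < t" "t \<le> R"
  obtains s where "0 < s" "s \<le> t" "\<And>p q. p \<in> chart_ball s \<Longrightarrow> q \<in> chart_ball s \<Longrightarrow> p \<otimes> inv q \<in> chart_ball t"
proof -
  obtain N where N: "openin T N" "\<one> \<in> N" "\<And>p. p \<in> N \<Longrightarrow> inv p \<in> N"
    "\<And>p q. p \<in> N \<Longrightarrow> q \<in> N \<Longrightarrow> p \<otimes> q \<in> chart_ball t"
    using symmetric_neighbourhood[OF openin_chart_ball one_chart_ball] assms(1) by metis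
  obtain s where "0 < s" "s \<le> t" "chart_ball s \<subseteq> N" using chart_ball_subset[OF N(1,2) assms(1)] by blast
  then show ?thesis using N(3,4) by (intro that[of s]) blast+
qed

lemma norm_quotient_comparable:
  assumes p: "p \<in> V" and q: "q \<in> chart_ball R" and pq: "p \<otimes> inv q \<in> chart_ball R"
  shows "norm (l (p \<otimes> inv q)) \<le> 2 * norm (l p - l q)" "norm (l p - l q) \<le> 2 * norm (l (p \<otimes> inv q))"
proof -
  let ?w = "p \<otimes> inv q"
  have "?w \<otimes> q = p" using p q by (simp add: m_assoc V_carrier chart_ballD)
  then have near: "norm (l p - l ?w - l q) \<le> norm (l ?w) / 4" using norm_mult_diff_le(2)[OF pq q] by simp
  have "norm (l p - l q) \<le> norm (l p - l ?w - l q) + norm (l ?w)"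
    using norm_triangle_ineq[of "l p - l ?w - l q" "l ?w"] by simp
  with near show "norm (l p - l q) \<le> 2 * norm (l ?w)" using norm_ge_zero[of "l ?w"] by linarith
  have "norm (l ?w) \<le> norm (l p - l q) + norm (l p - l ?w - l q)"
    using norm_triangle_ineq4[of "l p - l q" "l p - l ?w - l q"] by simp
  with near show "norm (l ?w) \<le> 2 * norm (l p - l q)" using norm_ge_zero[of "l ?w"] by linarith
qed

lemma nat_pow_near:
  assumes x: "x \<in> chart_ball R" and pow: "\<And>j. j < m \<Longrightarrow> x [^] j \<in> chart_ball R"
  shows "x [^] (m::nat) \<in> V \<and> norm (l (x [^] m) - real m *\<^sub>R l x) \<le> real m * norm (l x) / 4"
  using pow
proof (induction m)
  case 0
  then show ?case by (simp add: one_V l_one)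
next
  case (Suc m)
  then have near: "norm (l (x [^] m) - real m *\<^sub>R l x) \<le> real m * norm (l x) / 4"
    and m: "x [^] m \<in> chart_ball R" by simp_all
  have "norm ((l (x [^] m \<otimes> x) - l (x [^] m) - l x) + (l (x [^] m) - real m *\<^sub>R l x))
      \<le> norm (l x) / 4 + real m * norm (l x) / 4"
    by (rule norm_triangle_mono[OF norm_mult_diff_le(3)[OF m x] near])
  then show ?case using mult_in_V[OF m x] by (simp add: algebra_simps add_divide_distrib)
qed

lemma nat_pow_in_chart_ball:
  assumes x: "x \<in> chart_ball R" and s: "s \<le> R" and m: "5 / 4 * real m * norm (l x) < s" and j: "j \<le> m"
  shows "x [^] j \<in> chart_ball s"
  using j
proof (induction j rule: less_induct)
  case (less j)
  then have "x [^] i \<in> chart_ball R" if "i < j" for i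
    using that chart_ball_mono[OF s] by simp
  from nat_pow_near[OF x this]
  have pow: "x [^] j \<in> V" "norm (l (x [^] j) - real j *\<^sub>R l x) \<le> real j * norm (l x) / 4" by blast+
  have "norm (l (x [^] j)) \<le> norm (l (x [^] j) - real j *\<^sub>R l x) + norm (real j *\<^sub>R l x)"
    using norm_triangle_ineq[of "l (x [^] j) - real j *\<^sub>R l x" "real j *\<^sub>R l x"] by simp
  also have "\<dots> \<le> 5 / 4 * (real j * norm (l x))" using pow(2) by simp
  also have "\<dots> \<le> 5 / 4 * (real m * norm (l x))" using less.prems by (intro mult_left_mono mult_right_mono) auto
  finally show ?case using pow(1) m by (simp add: chart_ball_def)
qed

lemma nat_pow_escapes:
  assumes x: "x \<in> carrier K" and m: "0 < m" and pow: "\<And>j::nat. j \<le> m \<Longrightarrow> x [^] j \<in> chart_ball R"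
  shows "3 * (real m * norm (l x)) < 4 * R"
proof -
  have "x \<in> chart_ball R" using pow[of 1] m x by simp
  then have near: "norm (l (x [^] m) - real m *\<^sub>R l x) \<le> real m * norm (l x) / 4"
    using nat_pow_near[of x m] pow by simp
  have "real m * norm (l x) \<le> norm (l (x [^] m)) + norm (l (x [^] m) - real m *\<^sub>R l x)"
    using norm_triangle_ineq4[of "l (x [^] m)" "l (x [^] m) - real m *\<^sub>R l x"] by simp
  then show ?thesis using near chart_ballD[OF pow[of m]] by simp
qed

text \<open>Since \<open>\<bar>l (x ^ m)\<bar>\<close> is comparable to \<open>m \<bar>l x\<bar>\<close>, the size of \<open>l x\<close> is determined by how long
  the powers of \<open>x\<close> stay in a fixed neighbourhood, which equicontinuity of conjugation controls.\<close>

lemma norm_le_if_powers_stay: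
  assumes x: "x \<in> chart_ball (t / 5)" "l x \<noteq> 0" and t: "0 < t" "t \<le> R" and y: "y \<in> carrier K"
    and stay: "\<And>j::nat. x [^] j \<in> chart_ball t \<Longrightarrow> y [^] j \<in> chart_ball R"
  shows "norm (l y) \<le> 3 * R / t * norm (l x)"
proof -
  have x_t: "norm (l x) < t / 5" and x_R: "x \<in> chart_ball R"
    using chart_ballD[OF x(1)] chart_ball_mono[OF _ x(1)] t by auto
  define m where "m = nat (\<lceil>4 * t / (5 * norm (l x))\<rceil> - 1)"
  have "4 < 4 * t / (5 * norm (l x))" using x_t x(2) by (simp add: field_simps)
  then have m: "0 < m" "real m < 4 * t / (5 * norm (l x))" "4 * t / (5 * norm (l x)) \<le> real m + 1"
    unfolding m_def by linarith+
  have small: "5 / 4 * real m * norm (l x) < t" using m(2) x(2) by (simp add: field_simps)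
  have "4 * t \<le> 5 * (real m + 1) * norm (l x)" using m(3) x(2) by (simp add: field_simps)
  then have "3 * t \<le> 5 * (real m * norm (l x))" using x_t by (simp add: algebra_simps)
  then have long: "3 * t * norm (l y) \<le> 5 * (real m * norm (l x)) * norm (l y)"
    by (rule mult_right_mono) simp
  have "3 * (real m * norm (l y)) < 4 * R"
    using nat_pow_in_chart_ball[OF x_R t(2) small] by (intro nat_pow_escapes[OF y m(1)] stay)
  then have "3 * (real m * norm (l y)) * norm (l x) \<le> 4 * R * norm (l x)"
    by (intro mult_right_mono) auto
  with long have "3 * (3 * (t * norm (l y))) \<le> 20 * (R * norm (l x))" by (simp add: algebra_simps)
  moreover have "0 \<le> R * norm (l x)" using R_pos by simp
  ultimately have "t * norm (l y) \<le> 3 * (R * norm (l x))" by linarith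
  then show ?thesis using t(1) by (simp add: field_simps)
qed

lemma conjugation_bounded:
  obtains s B where "0 < s" "s \<le> R" "0 \<le> B"
    "\<And>k x. k \<in> carrier K \<Longrightarrow> x \<in> chart_ball s \<Longrightarrow> k \<otimes> x \<otimes> inv k \<in> chart_ball R"
    "\<And>k x. k \<in> carrier K \<Longrightarrow> x \<in> chart_ball s \<Longrightarrow> norm (l (k \<otimes> x \<otimes> inv k)) \<le> B * norm (l x)"
proof -
  obtain N where N: "openin T N" "\<one> \<in> N"
    and conj_N: "\<And>k x. k \<in> carrier K \<Longrightarrow> x \<in> N \<Longrightarrow> k \<otimes> x \<otimes> inv k \<in> chart_ball R"
    using conjugation_equicontinuous[OF openin_chart_ball[OF R_pos] one_chart_ball[OF R_pos]] by blast
  obtain t where t: "0 < t" "t \<le> R" "chart_ball t \<subseteq> N" using chart_ball_subset[OF N R_pos] by blast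
  show ?thesis
  proof (rule that[of "t / 5" "3 * R / t"])
    show "0 < t / 5" "t / 5 \<le> R" "0 \<le> 3 * R / t" using t R_pos by simp_all
    fix k x assume k: "k \<in> carrier K" and x: "x \<in> chart_ball (t / 5)"
    have x_t: "x \<in> chart_ball t" using x t(1) chart_ball_mono[of "t / 5"] by simp
    have x_K: "x \<in> carrier K" using chart_ballD[OF x] V_carrier by blast
    show "k \<otimes> x \<otimes> inv k \<in> chart_ball R" using conj_N[OF k] x_t t(3) by blast
    show "norm (l (k \<otimes> x \<otimes> inv k)) \<le> 3 * R / t * norm (l x)"
    proof (cases "l x = 0")
      case True
      then have "x = \<one>" using inj_onD[OF inj _ _ one_V] l_one chart_ballD[OF x] by simp
      then show ?thesis using k by (simp add: l_one)
    next
      case False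
      have "(k \<otimes> x \<otimes> inv k) [^] j = k \<otimes> x [^] j \<otimes> inv k" for j :: nat
        using k x_K by (induction j) (simp_all add: m_assoc)
      then have "(k \<otimes> x \<otimes> inv k) [^] j \<in> chart_ball R" if "x [^] j \<in> chart_ball t" for j :: nat
        using conj_N[OF k, of "x [^] j"] that t(3) by auto
      then show ?thesis
        using k x_K by (intro norm_le_if_powers_stay[OF x False t(1,2)]) simp_all
    qed
  qed
qed

lemma conjugation_Lipschitz:
  obtains s B where "0 < s" "s \<le> R" "0 \<le> B"
    "\<And>p q. p \<in> chart_ball s \<Longrightarrow> q \<in> chart_ball s \<Longrightarrow> p \<otimes> inv q \<in> chart_ball R"
    "\<And>k p. k \<in> carrier K \<Longrightarrow> p \<in> chart_ball s \<Longrightarrow> k \<otimes> p \<otimes> inv k \<in> chart_ball R"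
    "\<And>k p q. k \<in> carrier K \<Longrightarrow> p \<in> chart_ball s \<Longrightarrow> q \<in> chart_ball s \<Longrightarrow>
       norm (l (k \<otimes> p \<otimes> inv k) - l (k \<otimes> q \<otimes> inv k)) \<le> B * norm (l p - l q)"
proof -
  obtain t B where t: "0 < t" "t \<le> R" and B: "0 \<le> B"
    and conj_t: "\<And>k x. k \<in> carrier K \<Longrightarrow> x \<in> chart_ball t \<Longrightarrow> k \<otimes> x \<otimes> inv k \<in> chart_ball R"
    and conj_B: "\<And>k x. k \<in> carrier K \<Longrightarrow> x \<in> chart_ball t \<Longrightarrow> norm (l (k \<otimes> x \<otimes> inv k)) \<le> B * norm (l x)"
    using conjugation_bounded by blast
  obtain s where s: "0 < s" "s \<le> t"
    and quotient: "\<And>p q. p \<in> chart_ball s \<Longrightarrow> q \<in> chart_ball s \<Longrightarrow> p \<otimes> inv q \<in> chart_ball t"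
    using quotient_chart_ball[OF t] by blast
  have conj_s: "k \<otimes> p \<otimes> inv k \<in> chart_ball R" if "k \<in> carrier K" "p \<in> chart_ball s" for k p
    using conj_t that chart_ball_mono[OF s(2)] by blast
  have "norm (l (k \<otimes> p \<otimes> inv k) - l (k \<otimes> q \<otimes> inv k)) \<le> 4 * B * norm (l p - l q)"
    if k: "k \<in> carrier K" and p: "p \<in> chart_ball s" and q: "q \<in> chart_ball s" for k p q
  proof -
    have K: "p \<in> carrier K" "q \<in> carrier K" using p q by (simp_all add: V_carrier chart_ballD)
    have ball_R: "p \<in> chart_ball R" "q \<in> chart_ball R" "p \<otimes> inv q \<in> chart_ball R"
      using p q quotient[OF p q] s(2) t(2) chart_ball_mono by (metis order_trans)+
    have conj_quotient: "(k \<otimes> p \<otimes> inv k) \<otimes> inv (k \<otimes> q \<otimes> inv k) = k \<otimes> (p \<otimes> inv q) \<otimes> inv k"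
      using k K by (simp add: m_assoc inv_mult_group)
    have "norm (l (k \<otimes> p \<otimes> inv k) - l (k \<otimes> q \<otimes> inv k)) \<le> 2 * norm (l (k \<otimes> (p \<otimes> inv q) \<otimes> inv k))"
      unfolding conj_quotient[symmetric]
      by (rule norm_quotient_comparable(2))
        (use conj_s[OF k p] conj_s[OF k q] conj_t[OF k quotient[OF p q]] in \<open>simp_all add: conj_quotient chart_ballD\<close>)
    also have "\<dots> \<le> 2 * (B * norm (l (p \<otimes> inv q)))" using conj_B[OF k quotient[OF p q]] by simp
    also have "\<dots> \<le> 2 * (B * (2 * norm (l p - l q)))"
      using norm_quotient_comparable(1)[OF _ ball_R(2,3)] chart_ballD[OF p] B
      by (intro mult_left_mono) simp_all
    finally show ?thesis by simp
  qed
  moreover have "p \<otimes> inv q \<in> chart_ball R" if "p \<in> chart_ball s" "q \<in> chart_ball s" for p q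
    using quotient[OF that] t(2) chart_ball_mono by blast
  ultimately show ?thesis using s t B conj_s by (intro that[of s "4 * B"]) auto
qed

end

locale Lipschitz_conjugation_chart = almost_additive_chart K T W V l R C
  for K (structure) and T and W :: "'v::real_normed_vector set" and V l R C +
  fixes s B :: real
  assumes s_bounds: "0 < s" "s \<le> R" and B_ge_1: "1 \<le> B"
    and quotient: "p \<in> chart_ball s \<Longrightarrow> q \<in> chart_ball s \<Longrightarrow> p \<otimes> inv q \<in> chart_ball R"
    and conj_chart_ball: "k \<in> carrier K \<Longrightarrow> p \<in> chart_ball s \<Longrightarrow> k \<otimes> p \<otimes> inv k \<in> chart_ball R"
    and conj_Lipschitz: "k \<in> carrier K \<Longrightarrow> p \<in> chart_ball s \<Longrightarrow> q \<in> chart_ball s \<Longrightarrow>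
       norm (l (k \<otimes> p \<otimes> inv k) - l (k \<otimes> q \<otimes> inv k)) \<le> B * norm (l p - l q)"
begin

definition conj_in_chart :: "'a \<Rightarrow> 'v \<Rightarrow> 'v" where
  "conj_in_chart k u = l (k \<otimes> unchart u \<otimes> inv k)"

lemma conj_in_chart_l: "x \<in> V \<Longrightarrow> conj_in_chart k (l x) = l (k \<otimes> x \<otimes> inv k)"
  by (simp add: conj_in_chart_def unchart_l)

lemma chart_ball_s_R: "x \<in> chart_ball s \<Longrightarrow> x \<in> chart_ball R"
  by (rule chart_ball_mono[OF s_bounds(2)])

lemma norm_conj_le:
  assumes "k \<in> carrier K" "x \<in> chart_ball s"
  shows "norm (l (k \<otimes> x \<otimes> inv k)) \<le> B * norm (l x)"
  using conj_Lipschitz[OF assms one_chart_ball[OF s_bounds(1)]] assms(1) by (simp add: l_one)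

lemma almost_additive_conj_in_chart:
  assumes k: "k \<in> carrier K"
  shows "almost_additive_map W (s / 3) (C * B + C * B\<^sup>2) B (conj_in_chart k)"
proof
  show "0 < s / 3" "0 \<le> C * B + C * B\<^sup>2" "0 \<le> B" using s_bounds B_ge_1 C_nonneg by simp_all
  let ?c = "\<lambda>x. k \<otimes> x \<otimes> inv k"
  have chart: "unchart u \<in> chart_ball s" "l (unchart u) = u" if "u \<in> W" "norm u < s / 3" for u
    using that s_bounds unchart[of u] by (auto intro!: unchart_chart_ball)
  show "norm (conj_in_chart k u - conj_in_chart k v) \<le> B * norm (u - v)"
    if "u \<in> W" "v \<in> W" "norm u < s / 3" "norm v < s / 3" for u v
    using conj_Lipschitz[OF k chart(1) chart(1), of u v] that chart(2) by (simp add: conj_in_chart_def)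
  fix u v assume u: "u \<in> W" "norm u < s / 3" and v: "v \<in> W" "norm v < s / 3" and uv: "norm (u + v) < s / 3"
  define x y z where "x = unchart u" and "y = unchart v" and "z = unchart (u + v)"
  have x: "x \<in> chart_ball s" "l x = u" and y: "y \<in> chart_ball s" "l y = v"
    and z: "z \<in> chart_ball s" "l z = u + v"
    using chart[OF u] chart[OF v] chart[OF subspace_add[OF subspace_W u(1) v(1)] uv] by (simp_all add: x_def y_def z_def)
  note x_R = chart_ball_s_R[OF x(1)] and y_R = chart_ball_s_R[OF y(1)]
  have K: "x \<in> carrier K" "y \<in> carrier K" using x y by (simp_all add: V_carrier chart_ballD)
  have product: "norm (u + v - l (x \<otimes> y)) \<le> C * norm u * norm v"
    using norm_mult_diff_le(1)[OF x_R y_R] x(2) y(2) by (metis diff_diff_eq norm_minus_commute)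
  have "x \<otimes> y \<in> chart_ball s"
    using norm_mult_le[OF x_R y_R] mult_in_V[OF x_R y_R] x(2) y(2) u(2) v(2) s_bounds(1) by (simp add: chart_ball_def)
  then have "norm (l (?c z) - l (?c (x \<otimes> y))) \<le> B * norm (u + v - l (x \<otimes> y))"
    using conj_Lipschitz[OF k z(1)] z(2) by simp
  also have "\<dots> \<le> B * (C * norm u * norm v)" using product B_ge_1 by (intro mult_left_mono) auto
  finally have conj_product: "norm (l (?c z) - l (?c (x \<otimes> y))) \<le> B * (C * norm u * norm v)" .
  have conj_mult: "?c (x \<otimes> y) = ?c x \<otimes> ?c y" using k K by (simp add: m_assoc)
  have "norm (l (?c (x \<otimes> y)) - l (?c x) - l (?c y)) \<le> C * norm (l (?c x)) * norm (l (?c y))"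
    unfolding conj_mult using conj_chart_ball[OF k] x(1) y(1) by (intro norm_mult_diff_le) auto
  also have "\<dots> \<le> C * (B * norm u) * (B * norm v)"
    using norm_conj_le[OF k x(1)] norm_conj_le[OF k y(1)] x(2) y(2) C_nonneg B_ge_1 by (intro mult_mono) auto
  finally have product_conj: "norm (l (?c (x \<otimes> y)) - l (?c x) - l (?c y)) \<le> C * (B * norm u) * (B * norm v)" .
  have "norm ((l (?c z) - l (?c (x \<otimes> y))) + (l (?c (x \<otimes> y)) - l (?c x) - l (?c y)))
      \<le> B * (C * norm u * norm v) + C * (B * norm u) * (B * norm v)"
    by (rule norm_triangle_mono[OF conj_product product_conj])
  then show "norm (conj_in_chart k (u + v) - conj_in_chart k u - conj_in_chart k v)
      \<le> (C * B + C * B\<^sup>2) * norm u * norm v"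
    by (simp add: conj_in_chart_def x_def y_def z_def power2_eq_square algebra_simps)
qed (rule subspace_W)

lemma norm_mult_diff_le_square:
  assumes "x \<in> chart_cball \<delta>" "y \<in> chart_cball \<delta>" "\<delta> < R"
  shows "norm (l (x \<otimes> y) - (l x + l y)) \<le> C * \<delta>\<^sup>2"
proof -
  have "0 \<le> \<delta>" using chart_cballD[OF assms(1)] norm_ge_zero order_trans by blast
  have "norm (l (x \<otimes> y) - l x - l y) \<le> C * norm (l x) * norm (l y)"
    using assms by (intro norm_mult_diff_le) (auto intro: chart_cball_subset_ball)
  also have "\<dots> \<le> C * \<delta> * \<delta>"
    using assms C_nonneg \<open>0 \<le> \<delta>\<close> unfolding chart_cball_def by (intro mult_mono) auto
  finally show ?thesis by (simp add: power2_eq_square diff_diff_eq)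
qed

lemma norm_twisted_mult_diff_le_square:
  assumes k: "k \<in> carrier K" and x: "x \<in> chart_cball \<delta>" and y: "y \<in> chart_cball \<delta>" and \<delta>: "B * \<delta> < s"
  shows "norm (l (x \<otimes> (k \<otimes> y \<otimes> inv k)) - (l x + conj_in_chart k (l y))) \<le> C * B\<^sup>2 * \<delta>\<^sup>2"
    "x \<otimes> (k \<otimes> y \<otimes> inv k) \<in> chart_cball (9 / 4 * (B * \<delta>))"
proof -
  have \<delta>_nonneg: "0 \<le> \<delta>" using chart_cballD[OF x] norm_ge_zero order_trans by blast
  then have \<delta>_le: "\<delta> \<le> B * \<delta>" using B_ge_1 mult_right_mono by fastforce
  have y_s: "y \<in> chart_ball s" using y \<delta> \<delta>_le by (intro chart_cball_subset_ball[of \<delta>]) auto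
  have "norm (l (k \<otimes> y \<otimes> inv k)) \<le> B * \<delta>"
    using norm_conj_le[OF k y_s] chart_cballD[OF y] B_ge_1 mult_left_mono[of "norm (l y)" \<delta> B] by linarith
  then have balls: "x \<in> chart_cball (B * \<delta>)" "k \<otimes> y \<otimes> inv k \<in> chart_cball (B * \<delta>)"
    using x chart_cball_mono[OF \<delta>_le] chart_ballD[OF conj_chart_ball[OF k y_s]]
    by (simp_all add: chart_cball_def)
  have y_V: "y \<in> V" using y by (simp add: chart_cballD)
  have B\<delta>_R: "B * \<delta> < R" using \<delta> s_bounds by linarith
  show "norm (l (x \<otimes> (k \<otimes> y \<otimes> inv k)) - (l x + conj_in_chart k (l y))) \<le> C * B\<^sup>2 * \<delta>\<^sup>2"
    using norm_mult_diff_le_square[OF balls B\<delta>_R] by (simp add: conj_in_chart_l[OF y_V] power_mult_distrib)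
  show "x \<otimes> (k \<otimes> y \<otimes> inv k) \<in> chart_cball (9 / 4 * (B * \<delta>))"
    using mult_in_chart_cball[OF balls B\<delta>_R B\<delta>_R] by simp
qed

definition defect_le :: "('h, 'm) monoid_scheme \<Rightarrow> ('h \<Rightarrow> 'a) \<Rightarrow> real \<Rightarrow> bool" where
  "defect_le H f b \<longleftrightarrow> (\<forall>x\<in>carrier H. \<forall>z\<in>carrier H. defect H f x z \<in> chart_cball b)"

definition Newton_constant :: real where
  "Newton_constant = 2 * (2 * (C + C * B\<^sup>2) + (2 + B) + 3 * (C * B + C * B\<^sup>2))"

lemma Newton_constant_pos: "0 < Newton_constant"
  unfolding Newton_constant_def using B_ge_1 C_nonneg
  by (intro mult_pos_pos add_nonneg_pos add_pos_nonneg mult_nonneg_nonneg) auto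

lemma defect_cocycle_in_chart:
  assumes H: "group H" and f: "f \<in> carrier H \<rightarrow> carrier K"
    and def: "defect_le H f \<delta>" and \<delta>: "\<delta> < R" "B * \<delta> < s"
    and xyz: "x \<in> carrier H" "y \<in> carrier H" "z \<in> carrier H"
  shows "norm (l (defect H f (x \<otimes>\<^bsub>H\<^esub> z) y) + l (defect H f x z)
    - (l (defect H f x (z \<otimes>\<^bsub>H\<^esub> y)) + conj_in_chart (f x) (l (defect H f z y)))) \<le> (C + C * B\<^sup>2) * \<delta>\<^sup>2"
proof -
  interpret H: group H by fact
  have defect: "defect H f x z \<in> chart_cball \<delta>" if "x \<in> carrier H" "z \<in> carrier H" for x z
    using def that by (simp add: defect_le_def)
  let ?p = "defect H f (x \<otimes>\<^bsub>H\<^esub> z) y \<otimes> defect H f x z"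
  have left: "norm (l ?p - (l (defect H f (x \<otimes>\<^bsub>H\<^esub> z) y) + l (defect H f x z))) \<le> C * \<delta>\<^sup>2"
    using xyz \<delta> by (intro norm_mult_diff_le_square defect) auto
  have "norm (l ?p - (l (defect H f x (z \<otimes>\<^bsub>H\<^esub> y)) + conj_in_chart (f x) (l (defect H f z y)))) \<le> C * B\<^sup>2 * \<delta>\<^sup>2"
    unfolding defect_cocycle[OF H f xyz] using xyz f \<delta>
    by (intro norm_twisted_mult_diff_le_square defect) auto
  from norm_triangle_le_diff[OF add_mono[OF this left]] show ?thesis by (simp add: algebra_simps)
qed

lemma amenable_correction:
  assumes H: "amenable_group H" and f: "f \<in> carrier H \<rightarrow> carrier K"
    and \<delta>: "0 < \<delta>" "3 * (B * \<delta>) < s" and def: "defect_le H f \<delta>"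
  obtains e where "\<And>x. x \<in> carrier H \<Longrightarrow> e x \<in> chart_cball \<delta>"
    "\<And>x z. x \<in> carrier H \<Longrightarrow> z \<in> carrier H \<Longrightarrow>
      norm (l (e (x \<otimes>\<^bsub>H\<^esub> z)) + l (defect H f x z) - (l (e x) + conj_in_chart (f x) (l (e z))))
      \<le> ((C + C * B\<^sup>2) + (2 + B) + 3 * (C * B + C * B\<^sup>2)) * \<delta>\<^sup>2"
proof -
  obtain \<mu> where "amenable_mean H \<mu>" using amenable_group_imp_amenable_mean[OF H] by blast
  then interpret amenable_mean H \<mu> .
  have \<delta>_B: "\<delta> \<le> B * \<delta>" using mult_right_mono[OF B_ge_1, of \<delta>] \<delta>(1) by simp
  then have \<delta>_small: "\<delta> < s / 3" "\<delta> < R" "B * \<delta> < s" using \<delta> s_bounds by linarith+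
  have defect: "defect H f x z \<in> chart_cball \<delta>" if "x \<in> carrier H" "z \<in> carrier H" for x z
    using def that by (simp add: defect_le_def)
  show ?thesis
  proof (rule almost_coboundary[of W "s / 3" "C * B + C * B\<^sup>2" B "\<lambda>x. conj_in_chart (f x)" \<delta> "\<delta>\<^sup>2"
        "\<lambda>x z. l (defect H f x z)" "(C + C * B\<^sup>2) * \<delta>\<^sup>2"])
    show "almost_additive_map W (s / 3) (C * B + C * B\<^sup>2) B (conj_in_chart (f x))" if "x \<in> carrier H" for x
      using f that by (intro almost_additive_conj_in_chart) auto
    show "l (defect H f x y) \<in> {u\<in>W. norm u \<le> \<delta>}" if "x \<in> carrier H" "y \<in> carrier H" for x y
      using chart_cballD[OF defect[OF that]] l_W by blast
    fix a assume a: "\<And>x. x \<in> carrier H \<Longrightarrow> a x \<in> {u\<in>W. norm u \<le> \<delta>}"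
      "\<And>x z. x \<in> carrier H \<Longrightarrow> z \<in> carrier H \<Longrightarrow>
        norm (a (x \<otimes>\<^bsub>H\<^esub> z) + l (defect H f x z) - (a x + conj_in_chart (f x) (a z)))
        \<le> (C + C * B\<^sup>2) * \<delta>\<^sup>2 + (2 + B) * \<delta>\<^sup>2 + 3 * (C * B + C * B\<^sup>2) * \<delta>\<^sup>2"
    have "unchart (a x) \<in> V" "l (unchart (a x)) = a x" if "x \<in> carrier H" for x
      using a(1)[OF that] \<delta>_small(2) by (auto intro!: unchart)
    then show ?thesis using a by (intro that[of "\<lambda>x. unchart (a x)"]) (simp_all add: chart_cball_def algebra_simps)
  qed (use compact_W \<delta>_small \<delta>(1) defect_cocycle_in_chart[OF is_group f def] in auto)
qed

text \<open>One step of Newton's method: the correction \<open>e\<close> is the mean of the defect in the chart, which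
  cancels the defect to first order by the cocycle identity and the invariance of the mean.\<close>

lemma Newton_step:
  assumes H: "amenable_group H" and f: "f \<in> carrier H \<rightarrow> carrier K"
    and \<delta>: "0 < \<delta>" "3 * (B * \<delta>) < s" and def: "defect_le H f \<delta>"
  obtains e where "e \<in> carrier H \<rightarrow> chart_cball \<delta>" "defect_le H (\<lambda>x. e x \<otimes> f x) (Newton_constant * \<delta>\<^sup>2)"
proof -
  interpret H: group H using H by (simp add: amenable_group_def)
  obtain e where e: "\<And>x. x \<in> carrier H \<Longrightarrow> e x \<in> chart_cball \<delta>"
    and coboundary: "\<And>x z. x \<in> carrier H \<Longrightarrow> z \<in> carrier H \<Longrightarrow>
      norm (l (e (x \<otimes>\<^bsub>H\<^esub> z)) + l (defect H f x z) - (l (e x) + conj_in_chart (f x) (l (e z))))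
      \<le> ((C + C * B\<^sup>2) + (2 + B) + 3 * (C * B + C * B\<^sup>2)) * \<delta>\<^sup>2"
    using amenable_correction[OF assms] by blast
  have \<delta>_B: "\<delta> \<le> B * \<delta>" using mult_right_mono[OF B_ge_1, of \<delta>] \<delta>(1) by simp
  then have \<delta>_small: "\<delta> < R" "B * \<delta> < s" using \<delta> s_bounds by linarith+
  have "defect H (\<lambda>x. e x \<otimes> f x) x z \<in> chart_cball (Newton_constant * \<delta>\<^sup>2)"
    if xz: "x \<in> carrier H" "z \<in> carrier H" for x z
  proof -
    let ?p = "e (x \<otimes>\<^bsub>H\<^esub> z) \<otimes> defect H f x z" and ?q = "e x \<otimes> (f x \<otimes> e z \<otimes> inv (f x))"
    have cballs: "e (x \<otimes>\<^bsub>H\<^esub> z) \<in> chart_cball \<delta>" "defect H f x z \<in> chart_cball \<delta>"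
      "e x \<in> chart_cball \<delta>" "e z \<in> chart_cball \<delta>" and fx: "f x \<in> carrier K"
      using e xz def f by (auto simp: defect_le_def)
    have p: "?p \<in> chart_ball s"
      using mult_in_chart_cball[OF cballs(1,2) \<delta>_small(1,1)]
      by (rule chart_cball_subset_ball[rotated]) (use \<delta> \<delta>_B in linarith)
    note twisted = norm_twisted_mult_diff_le_square[OF fx cballs(3,4) \<delta>_small(2)]
    have q: "?q \<in> chart_ball s"
      using twisted(2) by (rule chart_cball_subset_ball[rotated]) (use \<delta> \<delta>_B in linarith)
    note p_near = norm_mult_diff_le_square[OF cballs(1,2) \<delta>_small(1)]
    from norm_triangle_le_diff[OF add_mono[OF norm_triangle_mono[OF p_near coboundary[OF xz]] twisted(1)]]
    have "norm (l ?p - l ?q)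
        \<le> C * \<delta>\<^sup>2 + ((C + C * B\<^sup>2) + (2 + B) + 3 * (C * B + C * B\<^sup>2)) * \<delta>\<^sup>2 + C * B\<^sup>2 * \<delta>\<^sup>2"
      by simp
    also have "\<dots> = Newton_constant / 2 * \<delta>\<^sup>2" by (simp add: Newton_constant_def algebra_simps)
    finally have "norm (l ?p - l ?q) \<le> Newton_constant / 2 * \<delta>\<^sup>2" .
    moreover note pq = quotient[OF p q]
    moreover have "norm (l (?p \<otimes> inv ?q)) \<le> 2 * norm (l ?p - l ?q)"
      using chart_ballD[OF p] chart_ball_s_R[OF q] pq by (intro norm_quotient_comparable) auto
    ultimately have "?p \<otimes> inv ?q \<in> chart_cball (Newton_constant * \<delta>\<^sup>2)"
      using chart_ballD[OF pq] by (simp add: chart_cball_def)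
    moreover have "e \<in> carrier H \<rightarrow> carrier K" using chart_cballD[OF e] V_carrier by blast
    ultimately show ?thesis by (simp add: defect_left_multiple[OF H.is_group f _ xz])
  qed
  then show ?thesis using e by (intro that[of e]) (auto simp: defect_le_def)
qed

lemma Newton_halving:
  assumes H: "amenable_group H" and f: "f \<in> carrier H \<rightarrow> carrier K" and g: "g \<in> carrier H \<rightarrow> carrier K"
    and \<epsilon>: "0 < \<epsilon>" "\<epsilon> \<le> \<delta>" and \<delta>: "3 * (B * \<delta>) < s" "Newton_constant * \<delta> \<le> 1 / 2"
    and def: "defect_le H g \<epsilon>"
    and near: "\<And>x. x \<in> carrier H \<Longrightarrow> g x \<otimes> inv (f x) \<in> chart_cball (5 / 2 * (\<delta> - \<epsilon>))"
  obtains g' where "g' \<in> carrier H \<rightarrow> carrier K" "defect_le H g' (\<epsilon> / 2)"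
    "\<And>x. x \<in> carrier H \<Longrightarrow> g' x \<otimes> inv (f x) \<in> chart_cball (5 / 2 * (\<delta> - \<epsilon> / 2))"
proof -
  have "3 * \<delta> \<le> 3 * (B * \<delta>)" "3 * (B * \<epsilon>) \<le> 3 * (B * \<delta>)" using \<epsilon> B_ge_1 by simp_all
  then have "3 * \<delta> < s" and \<epsilon>_s: "3 * (B * \<epsilon>) < s" using \<delta>(1) by (auto intro: le_less_trans)
  then have small: "\<epsilon> < R" "5 / 2 * (\<delta> - \<epsilon>) < R"
    using \<epsilon> s_bounds unfolding right_diff_distrib by linarith+
  obtain e where e: "e \<in> carrier H \<rightarrow> chart_cball \<epsilon>"
    and improved: "defect_le H (\<lambda>x. e x \<otimes> g x) (Newton_constant * \<epsilon>\<^sup>2)"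
    using Newton_step[OF H g \<epsilon>(1) \<epsilon>_s def] by blast
  have K: "e x \<in> carrier K" "g x \<in> carrier K" "f x \<in> carrier K" if "x \<in> carrier H" for x
    using e f g that V_carrier chart_cballD by blast+
  have "Newton_constant * \<epsilon>\<^sup>2 \<le> 1 / 2 * \<epsilon>"
    using mult_left_mono[OF \<epsilon>(2), of Newton_constant] Newton_constant_pos \<delta>(2) \<epsilon>(1)
    unfolding power2_eq_square mult.assoc[symmetric] by (intro mult_right_mono) linarith+
  then have "defect_le H (\<lambda>x. e x \<otimes> g x) (\<epsilon> / 2)"
    using improved chart_cball_mono unfolding defect_le_def by simp
  moreover have "(e x \<otimes> g x) \<otimes> inv (f x) \<in> chart_cball (5 / 2 * (\<delta> - \<epsilon> / 2))" if x: "x \<in> carrier H" for x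
  proof -
    have "e x \<otimes> (g x \<otimes> inv (f x)) \<in> chart_cball (5 / 4 * \<epsilon> + 5 / 2 * (\<delta> - \<epsilon>))"
      using e x small by (intro mult_in_chart_cball near) auto
    moreover have "5 / 4 * \<epsilon> + 5 / 2 * (\<delta> - \<epsilon>) = 5 / 2 * (\<delta> - \<epsilon> / 2)" by (simp add: field_simps)
    ultimately show ?thesis using K[OF x] by (simp only: m_assoc inv_closed)
  qed
  ultimately show ?thesis using K by (intro that[of "\<lambda>x. e x \<otimes> g x"]) auto
qed

lemma Newton_iteration:
  assumes H: "amenable_group H" and f: "f \<in> carrier H \<rightarrow> carrier K"
    and \<delta>: "0 < \<delta>" "3 * (B * \<delta>) < s" "Newton_constant * \<delta> \<le> 1 / 2" and def: "defect_le H f \<delta>"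
  obtains F where "\<And>n. F n \<in> carrier H \<rightarrow> carrier K" "\<And>n. defect_le H (F n) (\<delta> / 2 ^ n)"
    "\<And>n x. x \<in> carrier H \<Longrightarrow> F n x \<otimes> inv (f x) \<in> chart_cball (5 / 2 * \<delta>)"
proof -
  define P where "P n g \<longleftrightarrow> g \<in> carrier H \<rightarrow> carrier K \<and> defect_le H g (\<delta> / 2 ^ n) \<and>
    (\<forall>x\<in>carrier H. g x \<otimes> inv (f x) \<in> chart_cball (5 / 2 * (\<delta> - \<delta> / 2 ^ n)))" for n g
  have "\<exists>F. \<forall>n. P n (F n) \<and> True"
  proof (rule dependent_nat_choice)
    have "f x \<otimes> inv (f x) = \<one>" if "x \<in> carrier H" for x using f that by (intro r_inv) auto
    then show "\<exists>g. P 0 g" using f def by (auto simp: P_def one_chart_cball)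
    fix g n assume g: "P n g"
    have "0 < \<delta> / 2 ^ n" "\<delta> / 2 ^ n \<le> \<delta>" using \<delta>(1) by (auto simp: field_simps)
    with Newton_halving[OF H f _ _ _ \<delta>(2,3)] g obtain g' where
      "g' \<in> carrier H \<rightarrow> carrier K" "defect_le H g' (\<delta> / 2 ^ n / 2)"
      "\<And>x. x \<in> carrier H \<Longrightarrow> g' x \<otimes> inv (f x) \<in> chart_cball (5 / 2 * (\<delta> - \<delta> / 2 ^ n / 2))"
      unfolding P_def by metis
    then show "\<exists>g'. P (Suc n) g' \<and> True" by (intro exI[of _ g']) (simp add: P_def mult.commute)
  qed
  then obtain F where F: "\<And>n. P n (F n)" by blast
  show ?thesis
  proof (rule that[of F])
    show "F n x \<otimes> inv (f x) \<in> chart_cball (5 / 2 * \<delta>)" if "x \<in> carrier H" for n x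
      using F[of n] that \<delta>(1) by (auto simp: P_def intro: chart_cball_mono[rotated])
  qed (use F in \<open>auto simp: P_def\<close>)
qed

lemma limitin_one_if_chart_cball:
  assumes "\<And>n::nat. x n \<in> chart_cball (\<delta> / 2 ^ n)" and F: "F \<le> sequentially"
  shows "limitin T x \<one> F"
  unfolding limitin_def
proof (intro conjI allI impI)
  show "\<one> \<in> topspace T" by (simp add: topspace_eq)
  fix N assume N: "openin T N \<and> \<one> \<in> N"
  obtain t where t: "0 < t" "chart_ball t \<subseteq> N" using chart_ball_subset[of N R] N R_pos by blast
  have "(\<lambda>n. \<delta> * (1 / 2) ^ n) \<longlonglongrightarrow> \<delta> * 0"
    by (intro tendsto_intros LIMSEQ_power_zero) auto
  then have "\<forall>\<^sub>F n in sequentially. \<delta> * (1 / 2) ^ n < t"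
    using t(1) by (intro order_tendstoD(2)[of _ 0]) auto
  with F have "\<forall>\<^sub>F n in F. \<delta> * (1 / 2) ^ n < t" by (rule filter_leD)
  then show "\<forall>\<^sub>F n in F. x n \<in> N"
  proof eventually_elim
    case (elim n)
    then have "x n \<in> chart_ball t"
      by (intro chart_cball_subset_ball[OF _ assms(1)]) (simp add: power_one_over)
    then show ?case using t(2) by blast
  qed
qed

lemma hom_near_almost_hom:
  assumes H: "amenable_group H" and f: "f \<in> carrier H \<rightarrow> carrier K"
    and \<delta>: "0 < \<delta>" "3 * (B * \<delta>) < s" "Newton_constant * \<delta> \<le> 1 / 2" and def: "defect_le H f \<delta>"
    and D: "closedin T D" "chart_cball (5 / 2 * \<delta>) \<subseteq> D"
  shows "\<exists>h\<in>hom H K. \<forall>x\<in>carrier H. h x \<otimes> inv (f x) \<in> D"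
proof -
  obtain F where F: "\<And>n. F n \<in> carrier H \<rightarrow> carrier K" "\<And>n. defect_le H (F n) (\<delta> / 2 ^ n)"
    and near: "\<And>n x. x \<in> carrier H \<Longrightarrow> F n x \<otimes> inv (f x) \<in> chart_cball (5 / 2 * \<delta>)"
    using Newton_iteration[OF H f \<delta> def] by blast
  obtain \<F> where \<F>: "\<F> \<le> sequentially" "ultrafilter \<F>" using ultrafilter_below[of sequentially] by auto
  have group_H: "group H" using H by (simp add: amenable_group_def)
  have vanishing: "limitin T (\<lambda>n. defect H (F n) x z) \<one> \<F>" if "x \<in> carrier H" "z \<in> carrier H" for x z
    using F(2) that by (intro limitin_one_if_chart_cball[OF _ \<F>(1)]) (auto simp: defect_le_def)
  obtain h where h: "h \<in> hom H K" "\<And>x. x \<in> carrier H \<Longrightarrow> limitin T (\<lambda>n. F n x) (h x) \<F>"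
    by (rule ultralimit_hom[OF \<F>(2) group_H, of F]) (use F(1) vanishing in auto)
  have "h x \<otimes> inv (f x) \<in> D" if x: "x \<in> carrier H" for x
  proof -
    have "limitin T (\<lambda>n. f x) (f x) \<F>" using f x by (auto simp: topspace_eq)
    then have "limitin T (\<lambda>n. F n x \<otimes> inv (f x)) (h x \<otimes> inv (f x)) \<F>"
      by (intro limitin_group_mult limitin_group_inv h x)
    then show ?thesis
      by (rule limitin_closedin[OF _ D(1) _ ultrafilter_imp_not_bot[OF \<F>(2)]])
        (use near[OF x] D(2) in \<open>blast intro: always_eventually\<close>)
  qed
  then show ?thesis using h(1) by blast
qed

theorem Ulam_stable_amenable: "Ulam_stable {H :: ('h, 'm) monoid_scheme. amenable_group H}"
  unfolding Ulam_stable_def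
proof (intro allI impI)
  fix N assume N: "openin T N" "\<one> \<in> N"
  obtain A D where AD: "openin T A" "closedin T D" "\<one> \<in> A" "A \<subseteq> D" "D \<subseteq> N"
    using closed_neighbourhood[OF N] by blast
  obtain t where t: "0 < t" "t \<le> s" "chart_ball t \<subseteq> A" using chart_ball_subset[OF AD(1,3) s_bounds(1)] by blast
  define \<delta> where "\<delta> = min (t / (4 * B)) (1 / (2 * Newton_constant))"
  have \<delta>: "0 < \<delta>" using t B_ge_1 Newton_constant_pos by (simp add: \<delta>_def)
  have "\<delta> \<le> t / (4 * B)" "\<delta> \<le> 1 / (2 * Newton_constant)" by (simp_all add: \<delta>_def)
  then have "4 * (B * \<delta>) \<le> t" and \<delta>_Newton: "Newton_constant * \<delta> \<le> 1 / 2"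
    using B_ge_1 Newton_constant_pos by (simp_all add: field_simps)
  moreover have "\<delta> \<le> B * \<delta>" using mult_right_mono[OF B_ge_1, of \<delta>] \<delta> by simp
  ultimately have \<delta>_s: "3 * (B * \<delta>) < s" and "5 / 2 * \<delta> < t" using t \<delta> by linarith+
  then have near: "chart_cball (5 / 2 * \<delta>) \<subseteq> D" using chart_cball_subset_ball t(3) AD(4) by blast
  have "\<exists>h\<in>hom H K. \<forall>x\<in>carrier H. h x \<otimes> inv (f x) \<in> N"
    if H: "amenable_group H" "f \<in> carrier H \<rightarrow> carrier K"
      and def: "\<forall>x\<in>carrier H. \<forall>z\<in>carrier H. defect H f x z \<in> chart_ball \<delta>"
    for H :: "('h, 'm) monoid_scheme" and f
  proof -
    have "defect_le H f \<delta>" using def by (force simp: defect_le_def chart_ball_def chart_cball_def)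
    from hom_near_almost_hom[OF H \<delta> \<delta>_s \<delta>_Newton this AD(2) near] show ?thesis using AD(5) by blast
  qed
  then show "\<exists>N'. openin T N' \<and> \<one> \<in> N' \<and> (\<forall>H\<in>{H :: ('h, 'm) monoid_scheme. amenable_group H}.
      \<forall>f\<in>carrier H \<rightarrow> carrier K. (\<forall>x\<in>carrier H. \<forall>z\<in>carrier H. defect H f x z \<in> N') \<longrightarrow>
        (\<exists>h\<in>hom H K. \<forall>x\<in>carrier H. h x \<otimes> inv (f x) \<in> N))"
    using openin_chart_ball[OF \<delta>] one_chart_ball[OF \<delta>] by (intro exI[of _ "chart_ball \<delta>"]) auto
qed

end

lemma (in almost_additive_chart) Lipschitz_conjugation_chart_exists:
  obtains s B where "Lipschitz_conjugation_chart K T W V l R C s B"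
proof -
  obtain s B where s: "0 < s" "s \<le> R" and B: "0 \<le> B"
    and balls: "\<And>p q. p \<in> chart_ball s \<Longrightarrow> q \<in> chart_ball s \<Longrightarrow> p \<otimes> inv q \<in> chart_ball R"
      "\<And>k p. k \<in> carrier K \<Longrightarrow> p \<in> chart_ball s \<Longrightarrow> k \<otimes> p \<otimes> inv k \<in> chart_ball R"
    and Lipschitz: "\<And>k p q. k \<in> carrier K \<Longrightarrow> p \<in> chart_ball s \<Longrightarrow> q \<in> chart_ball s \<Longrightarrow>
       norm (l (k \<otimes> p \<otimes> inv k) - l (k \<otimes> q \<otimes> inv k)) \<le> B * norm (l p - l q)"
    using conjugation_Lipschitz by blast
  have "norm (l (k \<otimes> p \<otimes> inv k) - l (k \<otimes> q \<otimes> inv k)) \<le> max 1 B * norm (l p - l q)"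
    if "k \<in> carrier K" "p \<in> chart_ball s" "q \<in> chart_ball s" for k p q
    using Lipschitz[OF that] by (rule order_trans) (simp add: mult_right_mono)
  then have "Lipschitz_conjugation_chart K T W V l R C s (max 1 B)"
    using s balls by unfold_locales auto
  then show ?thesis by (rule that)
qed

section \<open>Euclidean spaces of varying dimension\<close>

lemma uniform_radius_and_bound:
  fixes P :: "'j \<Rightarrow> real \<Rightarrow> real \<Rightarrow> bool"
  assumes "finite J" and "\<And>j. j \<in> J \<Longrightarrow> \<exists>e>0. \<exists>M. P j e M"
    and mono: "\<And>j e M e' M'. P j e M \<Longrightarrow> 0 < e' \<Longrightarrow> e' \<le> e \<Longrightarrow> M \<le> M' \<Longrightarrow> P j e' M'"
  obtains e M where "0 < e" "0 \<le> M" "\<And>j. j \<in> J \<Longrightarrow> P j e M"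
  using assms(1,2)
proof (induction J arbitrary: thesis rule: finite_induct)
  case empty
  then show ?case by (metis empty_iff order_refl zero_less_one)
next
  case (insert i J)
  obtain e M where eM: "0 < e" "0 \<le> M" "\<And>j. j \<in> J \<Longrightarrow> P j e M" using insert.IH insert.prems(2) by blast
  obtain e' M' where i: "0 < e'" "P i e' M'" using insert.prems(2) by blast
  show ?case
  proof (rule insert.prems(1)[of "min e e'" "max M M'"])
    show "P j (min e e') (max M M')" if "j \<in> insert i J" for j
      using that mono[OF i(2)] mono[OF eM(3)] eM(1) i(1) by auto
  qed (use eM i in auto)
qed

lemma product_topology_real_contains_box:
  assumes "openin (product_topology (\<lambda>_. euclideanreal) I) S" "p \<in> S"
  obtains J e where "finite J" "J \<subseteq> I" "0 < e"
    "{q \<in> extensional I. \<forall>i\<in>J. \<bar>q i - p i\<bar> < e} \<subseteq> S"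
proof -
  obtain X where X: "p \<in> Pi\<^sub>E I X" "\<And>i. openin euclideanreal (X i)" "finite {i. X i \<noteq> UNIV}" "Pi\<^sub>E I X \<subseteq> S"
    using product_topology_open_contains_basis[OF assms] by auto
  define J where "J = {i \<in> I. X i \<noteq> UNIV}"
  have finite_J: "finite J" unfolding J_def by (rule finite_subset[OF _ X(3)]) auto
  have balls: "\<exists>e>0. \<exists>M::real. ball (p i) e \<subseteq> X i" if "i \<in> J" for i
  proof -
    have "open (X i)" "p i \<in> X i" using X(1) X(2)[of i] that by (auto simp: PiE_iff J_def)
    then show ?thesis by (auto simp: open_contains_ball)
  qed
  obtain e where e: "0 < e" "\<And>i. i \<in> J \<Longrightarrow> ball (p i) e \<subseteq> X i"
  proof (rule uniform_radius_and_bound[where P = "\<lambda>i e M. ball (p i) e \<subseteq> X i", OF finite_J balls])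
    show "ball (p i) e' \<subseteq> X i" if "ball (p i) e \<subseteq> X i" "e' \<le> e" for i e e'
      using subset_ball[OF that(2)] that(1) by (rule order_trans)
  qed (auto intro: that)
  show ?thesis
  proof (rule that[OF finite_J _ e(1)])
    show "{q \<in> extensional I. \<forall>i\<in>J. \<bar>q i - p i\<bar> < e} \<subseteq> S"
    proof
      fix q assume q: "q \<in> {q \<in> extensional I. \<forall>i\<in>J. \<bar>q i - p i\<bar> < e}"
      have "q i \<in> X i" if "i \<in> I" for i
      proof (cases "i \<in> J")
        case True
        then have "q i \<in> ball (p i) e" using q by (simp add: dist_real_def abs_minus_commute)
        then show ?thesis using e(2)[OF True] by blast
      qed (use that in \<open>auto simp: J_def\<close>)
      with q have "q \<in> Pi\<^sub>E I X" by (simp add: PiE_iff)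
      then show "q \<in> S" using X(4) by blast
    qed
  qed (auto simp: J_def)
qed

lemma limitin_Euclidean_space:
  assumes "\<forall>\<^sub>F i in F. f i \<in> topspace (Euclidean_space m)" "l \<in> topspace (Euclidean_space m)"
    "\<And>k. k < m \<Longrightarrow> ((\<lambda>i. f i k) \<longlongrightarrow> l k) F"
  shows "limitin (Euclidean_space m) f l F"
proof -
  have "((\<lambda>i. f i k) \<longlongrightarrow> l k) F" for k
  proof (cases "k < m")
    case False
    have "\<forall>\<^sub>F i in F. f i k = l k"
      using assms(1) by eventually_elim (use False assms(2) in \<open>auto simp: topspace_Euclidean_space\<close>)
    then show ?thesis by (rule tendsto_eventually)
  qed (rule assms(3))
  then show ?thesis
    using assms(1,2) unfolding Euclidean_space_def limitin_subtopology limitin_componentwise by simp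
qed

lemma compactin_Euclidean_space_box:
  "compactin (Euclidean_space m) {x \<in> topspace (Euclidean_space m). \<forall>i<m. \<bar>x i\<bar> \<le> d}"
proof -
  have box: "{x \<in> topspace (Euclidean_space m). \<forall>i<m. \<bar>x i\<bar> \<le> d} = Pi\<^sub>E UNIV (\<lambda>i. if i < m then {-d..d} else {0})"
    by (auto simp: topspace_Euclidean_space PiE_iff abs_le_iff minus_le_iff split: if_splits)
  have "compactin (powertop_real UNIV) (Pi\<^sub>E UNIV (\<lambda>i. if i < m then {-d..d} else {0}))"
    by (simp add: compactin_PiE)
  then show ?thesis
    unfolding box[symmetric] unfolding Euclidean_space_def compactin_subtopology by auto
qed

definition coord_box :: "nat \<Rightarrow> (nat \<Rightarrow> real) \<Rightarrow> real \<Rightarrow> (nat \<Rightarrow> real) set" where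
  "coord_box m c \<epsilon> = {y. (\<forall>i\<ge>m. y i = 0) \<and> (\<forall>i<m. \<bar>y i - c i\<bar> < \<epsilon>)}"

lemma coord_box_mono: "\<epsilon> \<le> \<epsilon>' \<Longrightarrow> coord_box m c \<epsilon> \<subseteq> coord_box m c \<epsilon>'"
  by (auto simp: coord_box_def)

lemma centre_in_coord_box: "c \<in> topspace (Euclidean_space m) \<Longrightarrow> 0 < \<epsilon> \<Longrightarrow> c \<in> coord_box m c \<epsilon>"
  by (simp add: coord_box_def topspace_Euclidean_space)

lemma openin_coord_box: "openin (Euclidean_space m) (coord_box m c \<epsilon>)"
proof -
  have coordinate: "continuous_map (Euclidean_space m) euclideanreal (\<lambda>y. y k)" for k
    unfolding Euclidean_space_def
    by (intro continuous_map_from_subtopology continuous_map_product_coordinates) simp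
  have "openin (Euclidean_space m)
      ((\<Inter>k\<in>{..<m}. {y \<in> topspace (Euclidean_space m). y k \<in> ball (c k) \<epsilon>}) \<inter> topspace (Euclidean_space m))"
    by (intro openin_INT openin_continuous_map_preimage[OF coordinate]) auto
  moreover have "(\<Inter>k\<in>{..<m}. {y \<in> topspace (Euclidean_space m). y k \<in> ball (c k) \<epsilon>})
      \<inter> topspace (Euclidean_space m) = coord_box m c \<epsilon>"
    by (auto simp: coord_box_def topspace_Euclidean_space dist_real_def abs_minus_commute)
  ultimately show ?thesis by simp
qed

lemma openin_contains_coord_box:
  assumes "openin (Euclidean_space m) U" "x \<in> U"
  obtains \<epsilon> where "0 < \<epsilon>" "coord_box m x \<epsilon> \<subseteq> U"
proof -
  obtain S where S: "openin (powertop_real UNIV) S" "U = S \<inter> {x. \<forall>i\<ge>m. x i = 0}"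
    using assms(1) unfolding Euclidean_space_def openin_subtopology by blast
  then have x: "x \<in> S" "\<forall>i\<ge>m. x i = 0" using assms(2) by auto
  obtain J \<epsilon> where \<epsilon>: "finite J" "J \<subseteq> UNIV" "0 < \<epsilon>" "{q \<in> extensional UNIV. \<forall>i\<in>J. \<bar>q i - x i\<bar> < \<epsilon>} \<subseteq> S"
    by (rule product_topology_real_contains_box[OF S(1) x(1)]) (rule that)
  have "\<bar>q i - x i\<bar> < \<epsilon>" if "q \<in> coord_box m x \<epsilon>" for q i
    using that x(2) \<epsilon>(3) by (cases "i < m") (auto simp: coord_box_def)
  then have "coord_box m x \<epsilon> \<subseteq> S" using \<epsilon>(4) by (auto simp: subset_iff)
  then show ?thesis using S(2) by (intro that[OF \<epsilon>(3)]) (auto simp: coord_box_def)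
qed

text \<open>The sup-normed copy of \<open>n\<close>-space inside the bounded sequences: a single normed type
  that serves every \<open>n\<close>.\<close>

definition coord_space :: "nat \<Rightarrow> (nat \<Rightarrow>\<^sub>C real) set" where
  "coord_space n = {u. \<forall>i\<ge>n. apply_bcontfun u i = 0}"

lemma subspace_coord_space: "subspace (coord_space n)"
  by (auto simp: subspace_def coord_space_def)

lemma apply_Bcontfun_Euclidean_space:
  assumes "f \<in> topspace (Euclidean_space n)"
  shows "apply_bcontfun (Bcontfun f) = f" "Bcontfun f \<in> coord_space n"
proof -
  have "range f \<subseteq> insert 0 (f ` {..<n})"
    using assms by (force simp: topspace_Euclidean_space image_iff not_less[symmetric])
  then have "finite (range f)" by (rule finite_subset) simp
  then have "f \<in> bcontfun" by (auto simp: bcontfun_def intro: finite_imp_bounded)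
  then show "apply_bcontfun (Bcontfun f) = f" by (rule Bcontfun_inverse)
  then show "Bcontfun f \<in> coord_space n"
    using assms by (simp add: coord_space_def topspace_Euclidean_space)
qed

lemma norm_coord_space_le_iff:
  assumes "u \<in> coord_space n" "0 \<le> d"
  shows "norm u \<le> d \<longleftrightarrow> (\<forall>i<n. \<bar>apply_bcontfun u i\<bar> \<le> d)"
proof
  assume "\<forall>i<n. \<bar>apply_bcontfun u i\<bar> \<le> d"
  then show "norm u \<le> d"
    using assms by (intro norm_bound) (auto simp: coord_space_def not_less[symmetric] le_less_linear intro: order_trans)
qed (use norm_bounded[of u] in \<open>auto intro: order_trans\<close>)

lemma norm_coord_space_less_iff:
  assumes "u \<in> coord_space n" "0 < s"
  shows "norm u < s \<longleftrightarrow> (\<forall>i<n. \<bar>apply_bcontfun u i\<bar> < s)"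
proof
  assume small: "\<forall>i<n. \<bar>apply_bcontfun u i\<bar> < s"
  define d where "d = Max (insert 0 ((\<lambda>i. \<bar>apply_bcontfun u i\<bar>) ` {..<n}))"
  have "d < s" unfolding d_def using small assms(2) by (subst Max_less_iff) auto
  moreover have d: "0 \<le> d" "\<forall>i<n. \<bar>apply_bcontfun u i\<bar> \<le> d" unfolding d_def by (auto intro: Max_ge)
  ultimately show "norm u < s" using norm_coord_space_le_iff[OF assms(1) d(1)] by simp
qed (use norm_bounded[of u] in \<open>auto intro: le_less_trans\<close>)

lemma norm_Bcontfun_diff_less_iff:
  assumes "x \<in> topspace (Euclidean_space n)" "y \<in> topspace (Euclidean_space n)" "0 < e"
  shows "norm (Bcontfun y - Bcontfun x) < e \<longleftrightarrow> y \<in> coord_box n x e"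
  using assms norm_coord_space_less_iff[OF subspace_diff[OF subspace_coord_space], of "Bcontfun y" n "Bcontfun x" e]
  by (auto simp: apply_Bcontfun_Euclidean_space coord_box_def topspace_Euclidean_space)

lemma continuous_map_Bcontfun: "continuous_map (Euclidean_space n) euclidean Bcontfun"
  unfolding continuous_map_def
proof (intro conjI allI impI)
  fix S :: "(nat \<Rightarrow>\<^sub>C real) set" assume S: "openin euclidean S"
  show "openin (Euclidean_space n) {x \<in> topspace (Euclidean_space n). Bcontfun x \<in> S}"
  proof (subst openin_subopen, intro ballI)
    fix x assume "x \<in> {x \<in> topspace (Euclidean_space n). Bcontfun x \<in> S}"
    then have x: "x \<in> topspace (Euclidean_space n)" "Bcontfun x \<in> S" by simp_all
    obtain e where e: "0 < e" "ball (Bcontfun x) e \<subseteq> S" using S x(2) by (auto simp: open_contains_ball)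
    have "Bcontfun y \<in> S" if "y \<in> coord_box n x e" for y
      using that norm_Bcontfun_diff_less_iff[OF x(1) _ e(1), of y] e(2)
      by (auto simp: coord_box_def topspace_Euclidean_space dist_norm norm_minus_commute)
    then show "\<exists>U. openin (Euclidean_space n) U \<and> x \<in> U \<and> U \<subseteq> {x \<in> topspace (Euclidean_space n). Bcontfun x \<in> S}"
      using openin_subset[OF openin_coord_box[of n x e]]
      by (intro exI[of _ "coord_box n x e"] conjI openin_coord_box centre_in_coord_box[OF x(1) e(1)]) auto
  qed
qed simp

lemma compact_coord_space_cball: "compact {u \<in> coord_space n. norm u \<le> d}"
proof (cases "0 \<le> d")
  case True
  have "{u \<in> coord_space n. norm u \<le> d}
      = Bcontfun ` {x \<in> topspace (Euclidean_space n). \<forall>i<n. \<bar>x i\<bar> \<le> d}" (is "_ = Bcontfun ` ?box")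
  proof
    show "{u \<in> coord_space n. norm u \<le> d} \<subseteq> Bcontfun ` ?box"
    proof
      fix u assume u: "u \<in> {u \<in> coord_space n. norm u \<le> d}"
      then have "apply_bcontfun u \<in> ?box"
        using norm_coord_space_le_iff[OF _ True] by (auto simp: coord_space_def topspace_Euclidean_space)
      then have "Bcontfun (apply_bcontfun u) \<in> Bcontfun ` ?box" by (rule imageI)
      then show "u \<in> Bcontfun ` ?box" by (simp only: apply_bcontfun_inverse)
    qed
    show "Bcontfun ` ?box \<subseteq> {u \<in> coord_space n. norm u \<le> d}"
      using True norm_coord_space_le_iff[OF apply_Bcontfun_Euclidean_space(2)]
      by (auto simp: apply_Bcontfun_Euclidean_space)
  qed
  moreover have "compactin euclidean (Bcontfun ` ?box)"
    using compactin_Euclidean_space_box continuous_map_Bcontfun by (rule image_compactin)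
  ultimately show ?thesis by simp
next
  case False
  then have "{u \<in> coord_space n. norm u \<le> d} = {}" using norm_ge_zero order_trans by blast
  then show ?thesis by (simp only: compact_empty)
qed

section \<open>Mixed second differences\<close>

lemma coordinatewise_mean_value:
  assumes deriv: "\<And>i x. i < m \<Longrightarrow> x \<in> coord_box m c \<epsilon> \<Longrightarrow>
      ((\<lambda>t. f (x(i := t))) has_real_derivative g i x) (at (x i))"
    and bound: "\<And>i x. i < m \<Longrightarrow> x \<in> coord_box m c \<epsilon> \<Longrightarrow> \<bar>g i x\<bar> \<le> M"
    and x: "x \<in> coord_box m c \<epsilon>" and y: "y \<in> coord_box m c \<epsilon>"
  shows "\<bar>f x - f y\<bar> \<le> M * (\<Sum>i<m. \<bar>x i - y i\<bar>)"
proof -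
  \<comment> \<open>Pass from \<open>y\<close> to \<open>x\<close> by changing one coordinate at a time.\<close>
  define h where "h k i = (if i < k then x i else y i)" for k i :: nat
  have "\<bar>f (h k) - f (h 0)\<bar> \<le> M * (\<Sum>i<k. \<bar>x i - y i\<bar>)" if "k \<le> m" for k
    using that
  proof (induction k)
    case (Suc k)
    let ?S = "{c k - \<epsilon><..<c k + \<epsilon>}"
    have box: "(h k)(k := t) \<in> coord_box m c \<epsilon>" if "t \<in> ?S" for t
      using x y that Suc.prems by (auto simp: coord_box_def h_def)
    have "norm (f ((h k)(k := x k)) - f ((h k)(k := y k))) \<le> M * norm (x k - y k)"
    proof (rule field_differentiable_bound[where S = ?S])
      fix t assume t: "t \<in> ?S"
      have "((\<lambda>s. f (((h k)(k := t))(k := s))) has_real_derivative g k ((h k)(k := t)))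
          (at (((h k)(k := t)) k))"
        using Suc.prems by (intro deriv box t) auto
      then have "((\<lambda>s. f ((h k)(k := s))) has_real_derivative g k ((h k)(k := t))) (at t)" by simp
      then show "((\<lambda>s. f ((h k)(k := s))) has_real_derivative g k ((h k)(k := t))) (at t within ?S)"
        by (rule has_field_derivative_at_within)
      show "norm (g k ((h k)(k := t))) \<le> M" using bound[OF _ box[OF t]] Suc.prems by simp
    next
      have "\<bar>x k - c k\<bar> < \<epsilon>" "\<bar>y k - c k\<bar> < \<epsilon>" using x y Suc.prems by (auto simp: coord_box_def)
      then show "x k \<in> ?S" "y k \<in> ?S" by auto
    qed auto
    moreover have "h (Suc k) = (h k)(k := x k)" "h k = (h k)(k := y k)"
      by (auto simp: h_def fun_eq_iff less_Suc_eq)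
    ultimately have "\<bar>f (h (Suc k)) - f (h k)\<bar> \<le> M * \<bar>x k - y k\<bar>" by simp
    then show ?case using Suc by (simp add: algebra_simps)
  qed simp
  from this[of m] have "\<bar>f (h m) - f (h 0)\<bar> \<le> M * (\<Sum>i<m. \<bar>x i - y i\<bar>)" by simp
  moreover have "h m = x" "h 0 = y" using x y by (auto simp: h_def coord_box_def fun_eq_iff)
  ultimately show ?thesis by simp
qed

lemma add_in_coord_box:
  assumes "x \<in> coord_box m c (\<epsilon> / 2)" "q \<in> coord_box m (\<lambda>_. 0) (\<epsilon> / 2)"
  shows "(\<lambda>i. x i + q i) \<in> coord_box m c \<epsilon>"
proof -
  have "\<bar>x i + q i - c i\<bar> < \<epsilon>" if "i < m" for i
  proof -
    have "\<bar>x i - c i\<bar> < \<epsilon> / 2" "\<bar>q i\<bar> < \<epsilon> / 2" using assms that by (auto simp: coord_box_def)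
    then show ?thesis by linarith
  qed
  then show ?thesis using assms by (auto simp: coord_box_def)
qed

definition mixed_difference :: "((nat \<Rightarrow> real) \<Rightarrow> real) \<Rightarrow> (nat \<Rightarrow> real) \<Rightarrow> (nat \<Rightarrow> real) \<Rightarrow> (nat \<Rightarrow> real) \<Rightarrow> real"
  where "mixed_difference F c p q = F (\<lambda>i. c i + p i + q i) - F (\<lambda>i. c i + p i) - F (\<lambda>i. c i + q i) + F c"

lemma abs_mixed_difference_le:
  assumes g: "\<And>i x. i < m \<Longrightarrow> x \<in> coord_box m c \<epsilon> \<Longrightarrow>
      ((\<lambda>t. F (x(i := t))) has_real_derivative g i x) (at (x i))"
    and h: "\<And>i j x. i < m \<Longrightarrow> j < m \<Longrightarrow> x \<in> coord_box m c \<epsilon> \<Longrightarrow>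
      ((\<lambda>t. g i (x(j := t))) has_real_derivative h i j x) (at (x j))"
    and M: "\<And>i j x. i < m \<Longrightarrow> j < m \<Longrightarrow> x \<in> coord_box m c \<epsilon> \<Longrightarrow> \<bar>h i j x\<bar> \<le> M"
    and c: "c \<in> topspace (Euclidean_space m)" and \<epsilon>: "0 < \<epsilon>"
    and p: "p \<in> coord_box m (\<lambda>_. 0) (\<epsilon> / 2)" and q: "q \<in> coord_box m (\<lambda>_. 0) (\<epsilon> / 2)"
  shows "\<bar>mixed_difference F c p q\<bar> \<le> M * (\<Sum>i<m. \<bar>p i\<bar>) * (\<Sum>i<m. \<bar>q i\<bar>)"
proof -
  let ?\<Delta> = "\<lambda>x. F (\<lambda>i. x i + q i) - F x"
  have half: "x \<in> coord_box m c \<epsilon>" if "x \<in> coord_box m c (\<epsilon> / 2)" for x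
    using that \<epsilon> coord_box_mono[of "\<epsilon> / 2" \<epsilon> m c] by auto
  have "\<bar>?\<Delta> (\<lambda>i. c i + p i) - ?\<Delta> c\<bar> \<le> (M * (\<Sum>j<m. \<bar>q j\<bar>)) * (\<Sum>i<m. \<bar>(c i + p i) - c i\<bar>)"
  proof (rule coordinatewise_mean_value[where g = "\<lambda>i x. g i (\<lambda>k. x k + q k) - g i x"])
    fix i x assume i: "i < m" and x: "x \<in> coord_box m c (\<epsilon> / 2)"
    note xq = add_in_coord_box[OF x q]
    have "((\<lambda>t. F ((\<lambda>k. x k + q k)(i := t))) has_real_derivative g i (\<lambda>k. x k + q k)) (at (x i + q i))"
      using g[OF i xq] .
    then have "((\<lambda>t. F ((\<lambda>k. x k + q k)(i := t + q i))) has_real_derivative g i (\<lambda>k. x k + q k)) (at (x i))"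
      by (simp add: DERIV_shift)
    moreover have "(\<lambda>k. x k + q k)(i := t + q i) = (\<lambda>k. (x(i := t)) k + q k)" for t
      by (auto simp: fun_eq_iff)
    ultimately show "((\<lambda>t. ?\<Delta> (x(i := t))) has_real_derivative g i (\<lambda>k. x k + q k) - g i x) (at (x i))"
      by (intro DERIV_diff g[OF i half[OF x]]) simp
    show "\<bar>g i (\<lambda>k. x k + q k) - g i x\<bar> \<le> M * (\<Sum>j<m. \<bar>q j\<bar>)"
      using coordinatewise_mean_value[OF h[OF i] M[OF i] xq half[OF x]] by simp
  next
    show "c \<in> coord_box m c (\<epsilon> / 2)" using c \<epsilon> by (intro centre_in_coord_box) auto
    then show "(\<lambda>i. c i + p i) \<in> coord_box m c (\<epsilon> / 2)" using p by (auto simp: coord_box_def)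
  qed
  then show ?thesis by (simp add: mixed_difference_def algebra_simps)
qed

lemma continuous_map_locally_bounded:
  assumes cont: "continuous_map (subtopology (Euclidean_space m) U) euclideanreal h"
    and U: "coord_box m c \<epsilon> \<subseteq> U" and c: "c \<in> topspace (Euclidean_space m)" and \<epsilon>: "0 < \<epsilon>"
  shows "\<exists>\<epsilon>'>0. \<exists>M. \<forall>x\<in>coord_box m c \<epsilon>'. \<bar>h x\<bar> \<le> M"
proof -
  have "continuous_map (subtopology (Euclidean_space m) (coord_box m c \<epsilon>)) euclideanreal h"
    using cont U by (rule continuous_map_from_subtopology_mono)
  then have "openin (subtopology (Euclidean_space m) (coord_box m c \<epsilon>))
      {x \<in> topspace (subtopology (Euclidean_space m) (coord_box m c \<epsilon>)). h x \<in> ball (h c) 1}" (is "openin _ ?S")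
    by (rule openin_continuous_map_preimage) simp
  then have "openin (Euclidean_space m) ?S" using openin_coord_box by (rule openin_trans_full)
  moreover have "c \<in> ?S" using c centre_in_coord_box[OF c \<epsilon>] by simp
  ultimately obtain \<epsilon>' where \<epsilon>': "0 < \<epsilon>'" "coord_box m c \<epsilon>' \<subseteq> ?S" by (rule openin_contains_coord_box)
  have "\<bar>h x\<bar> \<le> \<bar>h c\<bar> + 1" if "x \<in> coord_box m c \<epsilon>'" for x
    using subsetD[OF \<epsilon>'(2) that] by (auto simp: dist_real_def)
  then show ?thesis using \<epsilon>'(1) by blast
qed

lemma Ck_on_2_mixed_difference_bound:
  assumes F: "Ck_on 2 m U F" and U: "coord_box m c \<epsilon> \<subseteq> U" and \<epsilon>: "0 < \<epsilon>"
    and c: "c \<in> topspace (Euclidean_space m)"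
  shows "\<exists>\<epsilon>'>0. \<exists>M. \<forall>p\<in>coord_box m (\<lambda>_. 0) \<epsilon>'. \<forall>q\<in>coord_box m (\<lambda>_. 0) \<epsilon>'.
     \<bar>mixed_difference F c p q\<bar> \<le> M * (\<Sum>i<m. \<bar>p i\<bar>) * (\<Sum>i<m. \<bar>q i\<bar>)"
proof -
  have "\<forall>i<m. \<exists>g. (\<forall>x\<in>U. ((\<lambda>t. F (x(i := t))) has_real_derivative g x) (at (x i))) \<and> Ck_on 1 m U g"
    using F by (simp add: numeral_2_eq_2)
  then obtain g where g: "\<And>i x. i < m \<Longrightarrow> x \<in> U \<Longrightarrow> ((\<lambda>t. F (x(i := t))) has_real_derivative g i x) (at (x i))"
    and "\<And>i. i < m \<Longrightarrow> Ck_on 1 m U (g i)" by metis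
  then have "\<forall>i<m. \<forall>j<m. \<exists>h. (\<forall>x\<in>U. ((\<lambda>t. g i (x(j := t))) has_real_derivative h x) (at (x j))) \<and>
      continuous_map (subtopology (Euclidean_space m) U) euclideanreal h"
    by simp
  then obtain h where
    h: "\<And>i j x. i < m \<Longrightarrow> j < m \<Longrightarrow> x \<in> U \<Longrightarrow> ((\<lambda>t. g i (x(j := t))) has_real_derivative h i j x) (at (x j))"
    and h_cont: "\<And>i j. i < m \<Longrightarrow> j < m \<Longrightarrow> continuous_map (subtopology (Euclidean_space m) U) euclideanreal (h i j)"
    by metis
  have h_bounded: "\<exists>e>0. \<exists>M. \<forall>x\<in>coord_box m c e. \<bar>h (fst ij) (snd ij) x\<bar> \<le> M" if "ij \<in> {..<m} \<times> {..<m}" for ij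
    using that by (intro continuous_map_locally_bounded[OF h_cont U c \<epsilon>]) auto
  obtain e M where e: "0 < e"
    and M: "\<And>ij. ij \<in> {..<m} \<times> {..<m} \<Longrightarrow> \<forall>x\<in>coord_box m c e. \<bar>h (fst ij) (snd ij) x\<bar> \<le> M"
  proof (rule uniform_radius_and_bound[where P = "\<lambda>ij e M. \<forall>x\<in>coord_box m c e. \<bar>h (fst ij) (snd ij) x\<bar> \<le> M",
        OF _ h_bounded])
    show "\<forall>x\<in>coord_box m c e'. \<bar>h (fst ij) (snd ij) x\<bar> \<le> M'"
      if "\<forall>x\<in>coord_box m c e. \<bar>h (fst ij) (snd ij) x\<bar> \<le> M" "e' \<le> e" "M \<le> M'" for ij e M e' M'
      using that coord_box_mono[OF that(2)] by (meson order_trans subsetD)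
  qed (auto intro: that)
  define r where "r = min e \<epsilon>"
  have r: "0 < r" "coord_box m c r \<subseteq> U" "coord_box m c r \<subseteq> coord_box m c e"
    using e \<epsilon> U coord_box_mono[of r \<epsilon> m c] coord_box_mono[of r e m c] by (auto simp: r_def)
  have "\<bar>mixed_difference F c p q\<bar> \<le> M * (\<Sum>i<m. \<bar>p i\<bar>) * (\<Sum>i<m. \<bar>q i\<bar>)"
    if pq: "p \<in> coord_box m (\<lambda>_. 0) (r / 2)" "q \<in> coord_box m (\<lambda>_. 0) (r / 2)" for p q
  proof (rule abs_mixed_difference_le[OF _ _ _ c r(1) pq])
    fix i j x assume i: "i < m" and x: "x \<in> coord_box m c r"
    then have "x \<in> U" using r(2) by blast
    then show "((\<lambda>t. F (x(i := t))) has_real_derivative g i x) (at (x i))" by (rule g[OF i])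
    assume j: "j < m"
    show "((\<lambda>t. g i (x(j := t))) has_real_derivative h i j x) (at (x j))" by (rule h[OF i j \<open>x \<in> U\<close>])
    show "\<bar>h i j x\<bar> \<le> M" using M[of "(i, j)"] i j x r(3) by auto
  qed
  moreover have "0 < r / 2" using r(1) by simp
  ultimately show ?thesis by (intro exI[of _ "r / 2"] exI[of _ M] conjI ballI)
qed

section \<open>Charts of Lie groups\<close>

definition join_halves :: "nat \<Rightarrow> (nat \<Rightarrow> real) \<Rightarrow> (nat \<Rightarrow> real) \<Rightarrow> nat \<Rightarrow> real" where
  "join_halves n x y i = (if i < n then x i else if i < 2 * n then y (i - n) else 0)"

lemma halves_join_halves:
  assumes "x \<in> topspace (Euclidean_space n)" "y \<in> topspace (Euclidean_space n)"
  shows "fst_half n (join_halves n x y) = x" "snd_half n (join_halves n x y) = y"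
  using assms by (auto simp: fst_half_def snd_half_def join_halves_def topspace_Euclidean_space fun_eq_iff)

lemma join_halves_add:
  "join_halves n x y i + join_halves n x' y' i = join_halves n (\<lambda>i. x i + x' i) (\<lambda>i. y i + y' i) i"
  by (simp add: join_halves_def)

lemma join_halves_in_Euclidean_space: "join_halves n x y \<in> topspace (Euclidean_space (2 * n))"
  by (simp add: join_halves_def topspace_Euclidean_space)

lemma halves_in_coord_box:
  assumes z: "z \<in> coord_box (2 * n) (join_halves n c c') e"
  shows "fst_half n z \<in> coord_box n c e" "snd_half n z \<in> coord_box n c' e"
proof -
  have "\<bar>z i - join_halves n c c' i\<bar> < e" "\<bar>z (n + i) - join_halves n c c' (n + i)\<bar> < e" if "i < n" for i
    using z that by (auto simp: coord_box_def)
  then show "fst_half n z \<in> coord_box n c e" "snd_half n z \<in> coord_box n c' e"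
    by (auto simp: coord_box_def fst_half_def snd_half_def join_halves_def)
qed

locale C2_group_chart = compact_Hausdorff_group K T for K (structure) and T +
  fixes n :: nat and V :: "'a set" and \<phi> :: "'a \<Rightarrow> nat \<Rightarrow> real"
  assumes chart: "is_chart n T (V, \<phi>)" and one_V: "\<one> \<in> V"
    and Ck_on_mult: "Ck_on 2 (2 * n)
      {z \<in> topspace (Euclidean_space (2 * n)). fst_half n z \<in> \<phi> ` V \<and> snd_half n z \<in> \<phi> ` V \<and>
        inv_into V \<phi> (fst_half n z) \<otimes> inv_into V \<phi> (snd_half n z) \<in> V}
      (\<lambda>z. \<phi> (inv_into V \<phi> (fst_half n z) \<otimes> inv_into V \<phi> (snd_half n z)) j)"
begin

lemma openin_V: "openin T V" and openin_range: "openin (Euclidean_space n) (\<phi> ` V)"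
  and homeomorphic: "homeomorphic_map (subtopology T V) (subtopology (Euclidean_space n) (\<phi> ` V)) \<phi>"
  using chart by (simp_all add: is_chart_def)

lemma topspace_V: "topspace (subtopology T V) = V"
  using openin_subset[OF openin_V] by auto

lemma V_carrier: "x \<in> V \<Longrightarrow> x \<in> carrier K"
  using openin_imp_carrier[OF openin_V] .

lemma inj_on_chart: "inj_on \<phi> V"
  using homeomorphic_imp_injective_map[OF homeomorphic] by (simp only: topspace_V)

lemma chart_in_Euclidean_space: "x \<in> V \<Longrightarrow> \<phi> x \<in> topspace (Euclidean_space n)"
  using openin_subset[OF openin_range] by auto

lemma inv_into_chart: "x \<in> V \<Longrightarrow> inv_into V \<phi> (\<phi> x) = x"
  by (rule inv_into_f_f[OF inj_on_chart])

lemma openin_chart_image: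
  assumes "openin T N"
  shows "openin (Euclidean_space n) (\<phi> ` (N \<inter> V))"
proof -
  have "openin (subtopology T V) (N \<inter> V)" using assms by (auto simp: openin_subtopology)
  then have "openin (subtopology (Euclidean_space n) (\<phi> ` V)) (\<phi> ` (N \<inter> V))"
    using homeomorphic_imp_open_map[OF homeomorphic] by (simp add: open_map_def)
  then show ?thesis using openin_range by (rule openin_trans_full)
qed

lemma coord_box_in_chart:
  assumes "openin T N" "\<one> \<in> N"
  obtains e where "0 < e" "coord_box n (\<phi> \<one>) e \<subseteq> \<phi> ` (N \<inter> V)"
  using openin_contains_coord_box[OF openin_chart_image[OF assms(1)], of "\<phi> \<one>"] assms(2) one_V by blast

definition coords :: "'a \<Rightarrow> nat \<Rightarrow>\<^sub>C real" where
  "coords x = Bcontfun (\<phi> x) - Bcontfun (\<phi> \<one>)"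

lemma coords_one: "coords \<one> = 0"
  by (simp add: coords_def)

lemma apply_coords: "x \<in> V \<Longrightarrow> apply_bcontfun (coords x) i = \<phi> x i - \<phi> \<one> i"
  using apply_Bcontfun_Euclidean_space(1)[OF chart_in_Euclidean_space] one_V by (simp add: coords_def)

lemma coords_in_coord_space: "x \<in> V \<Longrightarrow> coords x \<in> coord_space n"
  unfolding coords_def using one_V
  by (intro subspace_diff[OF subspace_coord_space] apply_Bcontfun_Euclidean_space chart_in_Euclidean_space)

lemma norm_coords_less_iff: "x \<in> V \<Longrightarrow> 0 < s \<Longrightarrow> norm (coords x) < s \<longleftrightarrow> \<phi> x \<in> coord_box n (\<phi> \<one>) s"
  unfolding coords_def using one_V by (intro norm_Bcontfun_diff_less_iff chart_in_Euclidean_space)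

lemma inj_on_coords: "inj_on coords V"
proof (rule inj_onI)
  fix x y assume xy: "x \<in> V" "y \<in> V" "coords x = coords y"
  then have "\<phi> x i - \<phi> \<one> i = \<phi> y i - \<phi> \<one> i" for i using apply_coords by metis
  then have "\<phi> x = \<phi> y" by (simp add: fun_eq_iff)
  then show "x = y" using inj_onD[OF inj_on_chart] xy by blast
qed

lemma openin_norm_coords_less:
  assumes "0 < s"
  shows "openin T {x\<in>V. norm (coords x) < s}"
proof -
  have "continuous_map (subtopology T V) (Euclidean_space n) \<phi>"
    using homeomorphic_imp_continuous_map[OF homeomorphic] by (simp add: continuous_map_in_subtopology)
  then have "openin (subtopology T V) {x \<in> topspace (subtopology T V). \<phi> x \<in> coord_box n (\<phi> \<one>) s}"
    using openin_coord_box by (rule openin_continuous_map_preimage)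
  moreover have "{x \<in> topspace (subtopology T V). \<phi> x \<in> coord_box n (\<phi> \<one>) s} = {x\<in>V. norm (coords x) < s}"
    using norm_coords_less_iff assms unfolding topspace_V by blast
  ultimately show ?thesis using openin_V by (auto intro: openin_trans_full)
qed

lemma norm_coords_less_subset:
  assumes "openin T N" "\<one> \<in> N"
  obtains s where "0 < s" "{x\<in>V. norm (coords x) < s} \<subseteq> N"
proof -
  obtain s where s: "0 < s" "coord_box n (\<phi> \<one>) s \<subseteq> \<phi> ` (N \<inter> V)" by (rule coord_box_in_chart[OF assms])
  have "x \<in> N" if "x \<in> V" "norm (coords x) < s" for x
  proof -
    have "\<phi> x \<in> \<phi> ` (N \<inter> V)" using norm_coords_less_iff[OF that(1) s(1)] that(2) s(2) by blast
    then show ?thesis using inj_onD[OF inj_on_chart] that(1) by auto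
  qed
  then show ?thesis using s(1) by (intro that) auto
qed

lemma coords_surj:
  obtains e where "0 < e" "\<And>u. u \<in> coord_space n \<Longrightarrow> norm u < e \<Longrightarrow> u \<in> coords ` V"
proof -
  obtain e where e: "0 < e" "coord_box n (\<phi> \<one>) e \<subseteq> \<phi> ` (V \<inter> V)"
    by (rule coord_box_in_chart[OF openin_V one_V])
  have "u \<in> coords ` V" if u: "u \<in> coord_space n" "norm u < e" for u
  proof -
    have "(\<lambda>i. \<phi> \<one> i + apply_bcontfun u i) \<in> coord_box n (\<phi> \<one>) e"
      using u norm_coord_space_less_iff[OF u(1) e(1)] chart_in_Euclidean_space[OF one_V]
      by (auto simp: coord_box_def coord_space_def topspace_Euclidean_space)
    then obtain x where x: "x \<in> V" "\<phi> x = (\<lambda>i. \<phi> \<one> i + apply_bcontfun u i)" using e(2) by auto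
    then have "coords x = u" by (intro bcontfun_eqI) (simp add: apply_coords)
    then show ?thesis using x(1) by blast
  qed
  then show ?thesis using e(1) by (rule that[rotated])
qed

definition mult_domain :: "(nat \<Rightarrow> real) set" where
  "mult_domain = {z \<in> topspace (Euclidean_space (2 * n)). fst_half n z \<in> \<phi> ` V \<and> snd_half n z \<in> \<phi> ` V \<and>
     inv_into V \<phi> (fst_half n z) \<otimes> inv_into V \<phi> (snd_half n z) \<in> V}"

definition mult_in_chart :: "nat \<Rightarrow> (nat \<Rightarrow> real) \<Rightarrow> real" where
  "mult_in_chart j z = \<phi> (inv_into V \<phi> (fst_half n z) \<otimes> inv_into V \<phi> (snd_half n z)) j"

lemma mult_in_chart_join_halves:
  "x \<in> V \<Longrightarrow> y \<in> V \<Longrightarrow> mult_in_chart j (join_halves n (\<phi> x) (\<phi> y)) = \<phi> (x \<otimes> y) j"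
  by (simp add: mult_in_chart_def halves_join_halves chart_in_Euclidean_space inv_into_chart)

lemma coord_box_in_mult_domain:
  obtains e where "0 < e" "coord_box (2 * n) (join_halves n (\<phi> \<one>) (\<phi> \<one>)) e \<subseteq> mult_domain"
proof -
  obtain N where N: "openin T N" "\<one> \<in> N" "\<And>p q. p \<in> N \<Longrightarrow> q \<in> N \<Longrightarrow> p \<otimes> q \<in> V"
    using symmetric_neighbourhood[OF openin_V one_V] by metis
  obtain e where e: "0 < e" "coord_box n (\<phi> \<one>) e \<subseteq> \<phi> ` (N \<inter> V)" by (rule coord_box_in_chart[OF N(1,2)])
  have "z \<in> mult_domain" if z: "z \<in> coord_box (2 * n) (join_halves n (\<phi> \<one>) (\<phi> \<one>)) e" for z
  proof -
    obtain x y where "x \<in> N \<inter> V" "fst_half n z = \<phi> x" "y \<in> N \<inter> V" "snd_half n z = \<phi> y"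
      using halves_in_coord_box[OF z] e(2) by blast
    then show ?thesis
      using N(3) z by (auto simp: mult_domain_def inv_into_chart coord_box_def topspace_Euclidean_space)
  qed
  then show ?thesis using e(1) by (intro that) auto
qed

lemma mult_mixed_difference_bound:
  obtains e M where "0 < e" "0 \<le> M"
    "\<And>j p q. j < n \<Longrightarrow> p \<in> coord_box (2 * n) (\<lambda>_. 0) e \<Longrightarrow> q \<in> coord_box (2 * n) (\<lambda>_. 0) e \<Longrightarrow>
       \<bar>mixed_difference (mult_in_chart j) (join_halves n (\<phi> \<one>) (\<phi> \<one>)) p q\<bar>
       \<le> M * (\<Sum>i<2*n. \<bar>p i\<bar>) * (\<Sum>i<2*n. \<bar>q i\<bar>)"
proof -
  let ?c = "join_halves n (\<phi> \<one>) (\<phi> \<one>)"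
  define P where "P j e M \<longleftrightarrow> (\<forall>p\<in>coord_box (2 * n) (\<lambda>_. 0) e. \<forall>q\<in>coord_box (2 * n) (\<lambda>_. 0) e.
     \<bar>mixed_difference (mult_in_chart j) ?c p q\<bar> \<le> M * (\<Sum>i<2*n. \<bar>p i\<bar>) * (\<Sum>i<2*n. \<bar>q i\<bar>))" for j e M
  obtain e where e: "0 < e" "coord_box (2 * n) ?c e \<subseteq> mult_domain" by (rule coord_box_in_mult_domain)
  have "Ck_on 2 (2 * n) mult_domain (mult_in_chart j)" for j
    using Ck_on_mult[of j] by (simp add: mult_domain_def mult_in_chart_def[abs_def])
  then have local: "\<exists>e>0. \<exists>M. P j e M" for j
    unfolding P_def by (rule Ck_on_2_mixed_difference_bound[OF _ e(2,1) join_halves_in_Euclidean_space])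
  have mono: "P j e' M'" if P: "P j e M" and le: "e' \<le> e" "M \<le> M'" for j e M e' M'
    unfolding P_def
  proof (intro ballI)
    fix p q assume "p \<in> coord_box (2 * n) (\<lambda>_. 0) e'" "q \<in> coord_box (2 * n) (\<lambda>_. 0) e'"
    then have "p \<in> coord_box (2 * n) (\<lambda>_. 0) e" "q \<in> coord_box (2 * n) (\<lambda>_. 0) e"
      using coord_box_mono[OF le(1)] by blast+
    with P have "\<bar>mixed_difference (mult_in_chart j) ?c p q\<bar> \<le> M * (\<Sum>i<2*n. \<bar>p i\<bar>) * (\<Sum>i<2*n. \<bar>q i\<bar>)"
      unfolding P_def by blast
    also have "\<dots> \<le> M' * (\<Sum>i<2*n. \<bar>p i\<bar>) * (\<Sum>i<2*n. \<bar>q i\<bar>)"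
      using le(2) by (intro mult_right_mono sum_nonneg) auto
    finally show "\<bar>mixed_difference (mult_in_chart j) ?c p q\<bar> \<le> M' * (\<Sum>i<2*n. \<bar>p i\<bar>) * (\<Sum>i<2*n. \<bar>q i\<bar>)" .
  qed
  obtain e M where "0 < e" "0 \<le> M" "\<And>j. j \<in> {..<n} \<Longrightarrow> P j e M"
    by (rule uniform_radius_and_bound[of "{..<n}" P]) (use local mono in auto)
  then show ?thesis by (intro that[of e M]) (auto simp: P_def)
qed

lemma coords_mult_eq_mixed_difference:
  assumes "x \<in> V" "y \<in> V" "x \<otimes> y \<in> V"
  shows "apply_bcontfun (coords (x \<otimes> y) - coords x - coords y) j
    = mixed_difference (mult_in_chart j) (join_halves n (\<phi> \<one>) (\<phi> \<one>))
        (join_halves n (apply_bcontfun (coords x)) (\<lambda>_. 0)) (join_halves n (\<lambda>_. 0) (apply_bcontfun (coords y)))"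
  using assms one_V V_carrier
  by (simp add: mixed_difference_def join_halves_add apply_coords mult_in_chart_join_halves)

lemma norm_coords_mult_diff_le:
  assumes xy: "x \<in> V" "y \<in> V" "x \<otimes> y \<in> V" and small: "norm (coords x) < e" "norm (coords y) < e"
    and M: "0 \<le> M" and mixed:
    "\<And>j p q. j < n \<Longrightarrow> p \<in> coord_box (2 * n) (\<lambda>_. 0) e \<Longrightarrow> q \<in> coord_box (2 * n) (\<lambda>_. 0) e \<Longrightarrow>
       \<bar>mixed_difference (mult_in_chart j) (join_halves n (\<phi> \<one>) (\<phi> \<one>)) p q\<bar>
       \<le> M * (\<Sum>i<2*n. \<bar>p i\<bar>) * (\<Sum>i<2*n. \<bar>q i\<bar>)"
  shows "norm (coords (x \<otimes> y) - coords x - coords y)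
    \<le> M * real (2 * n) * real (2 * n) * norm (coords x) * norm (coords y)"
proof (subst norm_coord_space_le_iff)
  show "coords (x \<otimes> y) - coords x - coords y \<in> coord_space n"
    using xy by (intro subspace_diff[OF subspace_coord_space] coords_in_coord_space)
  show "0 \<le> M * real (2 * n) * real (2 * n) * norm (coords x) * norm (coords y)" using M by simp
  let ?p = "join_halves n (apply_bcontfun (coords x)) (\<lambda>_. 0)"
  let ?q = "join_halves n (\<lambda>_. 0) (apply_bcontfun (coords y))"
  have p: "\<bar>?p i\<bar> \<le> norm (coords x)" and q: "\<bar>?q i\<bar> \<le> norm (coords y)" for i
    using norm_bounded[of "coords x" i] norm_bounded[of "coords y" "i - n"] by (auto simp: join_halves_def)
  have boxes: "?p \<in> coord_box (2 * n) (\<lambda>_. 0) e" "?q \<in> coord_box (2 * n) (\<lambda>_. 0) e"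
    using le_less_trans[OF p] le_less_trans[OF q] small join_halves_in_Euclidean_space[of n]
    by (auto simp: coord_box_def topspace_Euclidean_space)
  have "\<bar>apply_bcontfun (coords (x \<otimes> y) - coords x - coords y) j\<bar>
      \<le> M * real (2 * n) * real (2 * n) * norm (coords x) * norm (coords y)" if "j < n" for j
  proof -
    have "\<bar>apply_bcontfun (coords (x \<otimes> y) - coords x - coords y) j\<bar>
        \<le> M * (\<Sum>i<2*n. \<bar>?p i\<bar>) * (\<Sum>i<2*n. \<bar>?q i\<bar>)"
      unfolding coords_mult_eq_mixed_difference[OF xy] by (rule mixed[OF that boxes])
    also have "\<dots> \<le> M * (real (2 * n) * norm (coords x)) * (real (2 * n) * norm (coords y))"
      using sum_bounded_above[of "{..<2*n}", OF p] sum_bounded_above[of "{..<2*n}", OF q] M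
      by (intro mult_mono) (auto intro: sum_nonneg)
    also have "\<dots> = M * real (2 * n) * real (2 * n) * norm (coords x) * norm (coords y)" by simp
    finally show ?thesis .
  qed
  then show "\<forall>j<n. \<bar>apply_bcontfun (coords (x \<otimes> y) - coords x - coords y) j\<bar>
      \<le> M * real (2 * n) * real (2 * n) * norm (coords x) * norm (coords y)" by blast
qed

lemma coords_mult_near:
  obtains R C where "0 < R" "0 \<le> C"
    "\<And>x y. x \<in> V \<Longrightarrow> y \<in> V \<Longrightarrow> norm (coords x) < R \<Longrightarrow> norm (coords y) < R \<Longrightarrow>
       x \<otimes> y \<in> V \<and> norm (coords (x \<otimes> y) - coords x - coords y) \<le> C * norm (coords x) * norm (coords y)"
proof -
  obtain N where N: "openin T N" "\<one> \<in> N" "\<And>p q. p \<in> N \<Longrightarrow> q \<in> N \<Longrightarrow> p \<otimes> q \<in> V"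
    using symmetric_neighbourhood[OF openin_V one_V] by metis
  obtain s where s: "0 < s" "{x\<in>V. norm (coords x) < s} \<subseteq> N" by (rule norm_coords_less_subset[OF N(1,2)])
  obtain e M where e: "0 < e" and M: "0 \<le> M" and mixed:
    "\<And>j p q. j < n \<Longrightarrow> p \<in> coord_box (2 * n) (\<lambda>_. 0) e \<Longrightarrow> q \<in> coord_box (2 * n) (\<lambda>_. 0) e \<Longrightarrow>
       \<bar>mixed_difference (mult_in_chart j) (join_halves n (\<phi> \<one>) (\<phi> \<one>)) p q\<bar>
       \<le> M * (\<Sum>i<2*n. \<bar>p i\<bar>) * (\<Sum>i<2*n. \<bar>q i\<bar>)"
    using mult_mixed_difference_bound by blast
  show ?thesis
  proof (rule that[of "min s e" "M * real (2 * n) * real (2 * n)"])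
    show "0 < min s e" "0 \<le> M * real (2 * n) * real (2 * n)" using s(1) e M by simp_all
    fix x y assume xy: "x \<in> V" "y \<in> V" "norm (coords x) < min s e" "norm (coords y) < min s e"
    then have "x \<otimes> y \<in> V" using s(2) by (intro N(3)) auto
    then show "x \<otimes> y \<in> V \<and> norm (coords (x \<otimes> y) - coords x - coords y)
        \<le> M * real (2 * n) * real (2 * n) * norm (coords x) * norm (coords y)"
      using xy by (intro conjI norm_coords_mult_diff_le mixed M) auto
  qed
qed

theorem almost_additive_chart_exists:
  obtains R C where "almost_additive_chart K T (coord_space n) V coords R C"
proof -
  obtain e where e: "0 < e" "\<And>u. u \<in> coord_space n \<Longrightarrow> norm u < e \<Longrightarrow> u \<in> coords ` V"
    by (rule coords_surj) blast
  obtain r C where r: "0 < r" and C: "0 \<le> C" and mult: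
    "\<And>x y. x \<in> V \<Longrightarrow> y \<in> V \<Longrightarrow> norm (coords x) < r \<Longrightarrow> norm (coords y) < r \<Longrightarrow>
       x \<otimes> y \<in> V \<and> norm (coords (x \<otimes> y) - coords x - coords y) \<le> C * norm (coords x) * norm (coords y)"
    using coords_mult_near by blast
  define R where "R = min (min e r) (1 / (4 * (C + 1)))"
  have R: "0 < R" "R \<le> e" "R \<le> r" using e r C by (simp_all add: R_def)
  have "C * R \<le> C * (1 / (4 * (C + 1)))" using C by (intro mult_left_mono) (simp_all add: R_def)
  also have "\<dots> \<le> 1 / 4" using C by (simp add: field_simps)
  finally have CR: "C * R \<le> 1 / 4" .
  have "almost_additive_chart K T (coord_space n) V coords R C"
  proof unfold_locales
    show "\<exists>s>0. {x\<in>V. norm (coords x) < s} \<subseteq> N" if "openin T N" "\<one> \<in> N" for N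
      using norm_coords_less_subset[OF that] by blast
    show "V \<subseteq> carrier K" using V_carrier by blast
  qed (use subspace_coord_space compact_coord_space_cball R C CR one_V coords_one coords_in_coord_space inj_on_coords
      e(2) openin_norm_coords_less mult in auto)
  then show ?thesis by (rule that)
qed

end

lemma Lie_group_imp_compact_Hausdorff_group:
  "Lie_group n K T \<A> \<Longrightarrow> compact_space T \<Longrightarrow> compact_Hausdorff_group K T"
  by (simp add: Lie_group_def compact_Hausdorff_group_def compact_Hausdorff_group_axioms_def
      topological_group_def topological_group_axioms_def)

lemma Lie_group_C2_chart:
  assumes "Lie_group n K T \<A>" "compact_space T"
  obtains V \<phi> where "C2_group_chart K T n V \<phi>"
proof -
  note Lie = assms(1)[unfolded Lie_group_def]
  interpret compact_Hausdorff_group K T by (rule Lie_group_imp_compact_Hausdorff_group[OF assms])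
  have atlas: "smooth_atlas n T \<A>" using Lie by simp
  then have "\<one>\<^bsub>K\<^esub> \<in> (\<Union>(V, \<phi>) \<in> \<A>. V)" by (simp add: smooth_atlas_def topspace_eq)
  then obtain V \<phi> where V: "(V, \<phi>) \<in> \<A>" "\<one>\<^bsub>K\<^esub> \<in> V" by auto
  have "smooth_on (2 * n) {z \<in> topspace (Euclidean_space (2 * n)). fst_half n z \<in> \<phi> ` V \<and> snd_half n z \<in> \<phi> ` V \<and>
      inv_into V \<phi> (fst_half n z) \<otimes>\<^bsub>K\<^esub> inv_into V \<phi> (snd_half n z) \<in> V}
    (\<lambda>z. \<phi> (inv_into V \<phi> (fst_half n z) \<otimes>\<^bsub>K\<^esub> inv_into V \<phi> (snd_half n z)))"
    using Lie V(1) by fast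
  then have "C2_group_chart K T n V \<phi>"
    using atlas V by unfold_locales (auto simp: smooth_atlas_def smooth_on_def)
  then show ?thesis by (rule that)
qed

theorem compact_Lie_group_Ulam_stable:
  assumes "Lie_group n K T \<A>" "compact_space T"
  shows "topological_group.Ulam_stable K T {H :: ('h, 'm) monoid_scheme. amenable_group H}"
proof -
  obtain V \<phi> where "C2_group_chart K T n V \<phi>" by (rule Lie_group_C2_chart[OF assms])
  then interpret C2_group_chart K T n V \<phi> .
  obtain R C where "almost_additive_chart K T (coord_space n) V coords R C" by (rule almost_additive_chart_exists)
  then interpret almost_additive_chart K T "coord_space n" V coords R C .
  obtain s B where "Lipschitz_conjugation_chart K T (coord_space n) V coords R C s B"
    by (rule Lipschitz_conjugation_chart_exists)
  then interpret Lipschitz_conjugation_chart K T "coord_space n" V coords R C s B .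
  show ?thesis by (rule Ulam_stable_amenable)
qed

section \<open>Internal homomorphisms\<close>

definition sections :: "('i \<Rightarrow> 'a set) \<Rightarrow> ('i \<Rightarrow> 'a) set" where
  "sections A = {a. \<forall>i. a i \<in> A i}"

lemma sectionsD: "a \<in> sections A \<Longrightarrow> a i \<in> A i"
  by (simp add: sections_def)

text \<open>Sets of sections stand for subsets of an ultraproduct, and the internal set that separates
  \<open>P\<close> from the complement of \<open>Q\<close> is the ultraproduct of the sets \<open>X i\<close>.\<close>

definition internally_separated :: "'i filter \<Rightarrow> ('i \<Rightarrow> 'a) set \<Rightarrow> ('i \<Rightarrow> 'a) set \<Rightarrow> ('i \<Rightarrow> 'a) set \<Rightarrow> bool" where
  "internally_separated \<U> S P Q \<longleftrightarrow>
     (\<exists>X. \<forall>a\<in>S. (a \<in> P \<longrightarrow> (\<forall>\<^sub>F i in \<U>. a i \<in> X i)) \<and> ((\<forall>\<^sub>F i in \<U>. a i \<in> X i) \<longrightarrow> a \<in> Q))"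

lemma internally_separated_subset:
  "internally_separated \<U> S P Q \<Longrightarrow> a \<in> S \<Longrightarrow> a \<in> P \<Longrightarrow> a \<in> Q"
  unfolding internally_separated_def by blast

lemma internally_separated_mono:
  assumes "internally_separated \<U> S P Q" "S \<inter> P' \<subseteq> P" "S \<inter> Q \<subseteq> Q'"
  shows "internally_separated \<U> S P' Q'"
proof -
  obtain X where "\<forall>a\<in>S. (a \<in> P \<longrightarrow> (\<forall>\<^sub>F i in \<U>. a i \<in> X i)) \<and> ((\<forall>\<^sub>F i in \<U>. a i \<in> X i) \<longrightarrow> a \<in> Q)"
    using assms(1) unfolding internally_separated_def by (rule exE)
  then show ?thesis
    using assms(2,3) unfolding internally_separated_def by (intro exI[of _ X]) blast
qed

lemma internally_separated_Union:
  assumes U: "ultrafilter \<U>" and "finite \<P>" "\<And>P. P \<in> \<P> \<Longrightarrow> internally_separated \<U> S P Q"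
  shows "internally_separated \<U> S (\<Union>\<P>) Q"
proof -
  have "\<forall>P\<in>\<P>. \<exists>X. \<forall>a\<in>S. (a \<in> P \<longrightarrow> (\<forall>\<^sub>F i in \<U>. a i \<in> X i)) \<and> ((\<forall>\<^sub>F i in \<U>. a i \<in> X i) \<longrightarrow> a \<in> Q)"
    using assms(3) by (simp add: internally_separated_def)
  then obtain X where "\<forall>P\<in>\<P>. \<forall>a\<in>S. (a \<in> P \<longrightarrow> (\<forall>\<^sub>F i in \<U>. a i \<in> X P i)) \<and> ((\<forall>\<^sub>F i in \<U>. a i \<in> X P i) \<longrightarrow> a \<in> Q)"
    by (rule bchoice[THEN exE])
  then have X: "\<And>P a. P \<in> \<P> \<Longrightarrow> a \<in> S \<Longrightarrow> a \<in> P \<Longrightarrow> \<forall>\<^sub>F i in \<U>. a i \<in> X P i"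
    "\<And>P a. P \<in> \<P> \<Longrightarrow> a \<in> S \<Longrightarrow> \<forall>\<^sub>F i in \<U>. a i \<in> X P i \<Longrightarrow> a \<in> Q"
    by simp_all
  show ?thesis
    unfolding internally_separated_def
  proof (intro exI ballI conjI impI)
    fix a assume a: "a \<in> S"
    show "\<forall>\<^sub>F i in \<U>. a i \<in> (\<Union>P\<in>\<P>. X P i)" if aP: "a \<in> \<Union>\<P>"
    proof -
      obtain P where P: "P \<in> \<P>" "a \<in> P" using aP by blast
      from X(1)[OF P(1) a P(2)] show ?thesis by eventually_elim (use P(1) in blast)
    qed
    show "a \<in> Q" if "\<forall>\<^sub>F i in \<U>. a i \<in> (\<Union>P\<in>\<P>. X P i)"
      using ultrafilter_eventually_bex_finite[OF U assms(2), of "\<lambda>P i. a i \<in> X P i"] that X(2)[OF _ a] by auto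
  qed
qed

lemma internally_separated_if_ultrafilters:
  assumes U: "ultrafilter \<U>"
    and local: "\<And>F. ultrafilter F \<Longrightarrow> \<forall>\<^sub>F a in F. a \<in> S \<Longrightarrow> \<forall>\<^sub>F a in F. a \<in> P \<Longrightarrow>
      \<exists>P'. (\<forall>\<^sub>F a in F. a \<in> P') \<and> internally_separated \<U> S P' Q"
  shows "internally_separated \<U> S P Q"
proof -
  let ?\<P> = "{P'. internally_separated \<U> S P' Q}"
  obtain \<Q> where \<Q>: "finite \<Q>" "\<Q> \<subseteq> ?\<P>" "S \<inter> P \<subseteq> \<Union>\<Q>"
  proof (rule finite_cover_if_ultrafilters)
    fix F assume F: "ultrafilter F" "\<forall>\<^sub>F a in F. a \<in> S \<inter> P"
    then have "\<forall>\<^sub>F a in F. a \<in> S" "\<forall>\<^sub>F a in F. a \<in> P" by (simp_all add: eventually_conj_iff)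
    from local[OF F(1) this] show "\<exists>P'\<in>?\<P>. \<forall>\<^sub>F a in F. a \<in> P'" by blast
  qed
  have "internally_separated \<U> S (\<Union>\<Q>) Q"
    using \<Q>(1,2) by (intro internally_separated_Union[OF U]) auto
  then show ?thesis using \<Q>(3) by (rule internally_separated_mono) blast
qed

lemma internally_separated_vimage:
  assumes U: "ultrafilter \<U>"
    and limit: "\<And>F. ultrafilter F \<Longrightarrow> \<forall>\<^sub>F a in F. a \<in> S \<Longrightarrow> \<exists>y\<in>topspace T. \<forall>Q. openin T Q \<longrightarrow> y \<in> Q \<longrightarrow>
      (\<exists>P. (\<forall>\<^sub>F a in F. a \<in> P) \<and> internally_separated \<U> S P (t -` Q))"
    and D: "closedin T D" and N: "openin T N" and "D \<subseteq> N"
  shows "internally_separated \<U> S (t -` D) (t -` N)"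
proof (rule internally_separated_if_ultrafilters[OF U])
  fix F assume F: "ultrafilter F" and S: "\<forall>\<^sub>F a in F. a \<in> S" and tD: "\<forall>\<^sub>F a in F. a \<in> t -` D"
  obtain y where y: "y \<in> topspace T"
    and near: "\<And>Q. openin T Q \<Longrightarrow> y \<in> Q \<Longrightarrow> \<exists>P. (\<forall>\<^sub>F a in F. a \<in> P) \<and> internally_separated \<U> S P (t -` Q)"
    using limit[OF F S] by blast
  have "y \<in> D"
  proof (rule ccontr)
    assume "y \<notin> D"
    moreover have "openin T (topspace T - D)" using D by blast
    ultimately obtain P where P: "\<forall>\<^sub>F a in F. a \<in> P" "internally_separated \<U> S P (t -` (topspace T - D))"
      using near[of "topspace T - D"] y by blast
    from S P(1) have "\<forall>\<^sub>F a in F. a \<notin> t -` D"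
      by eventually_elim (use internally_separated_subset[OF P(2)] in blast)
    then show False using tD ultrafilter_eventually_not_iff[OF F] by blast
  qed
  then show "\<exists>P. (\<forall>\<^sub>F a in F. a \<in> P) \<and> internally_separated \<U> S P (t -` N)"
    using near[OF N] \<open>D \<subseteq> N\<close> by blast
qed

lemma internally_separated_continuous_map:
  assumes g: "continuous_map X T g" and p: "\<And>a. a \<in> S \<Longrightarrow> p a \<in> topspace X" "\<And>a. a \<in> S \<Longrightarrow> g (p a) = t a"
    and separated: "\<And>D N. closedin X D \<Longrightarrow> openin X N \<Longrightarrow> D \<subseteq> N \<Longrightarrow> internally_separated \<U> S (p -` D) (p -` N)"
    and DN: "closedin T D" "openin T N" "D \<subseteq> N"
  shows "internally_separated \<U> S (t -` D) (t -` N)"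
proof (rule internally_separated_mono)
  show "internally_separated \<U> S (p -` {x \<in> topspace X. g x \<in> D}) (p -` {x \<in> topspace X. g x \<in> N})"
    using closedin_continuous_map_preimage[OF g DN(1)] openin_continuous_map_preimage[OF g DN(2)] DN(3)
    by (intro separated) auto
qed (use p in auto)

lemma first_countable_decreasing_base:
  assumes "first_countable X" "x \<in> topspace X"
  obtains B :: "nat \<Rightarrow> 'a set" where "\<And>m. openin X (B m)" "\<And>m. x \<in> B m" "decseq B"
    "\<And>U. openin X U \<Longrightarrow> x \<in> U \<Longrightarrow> \<exists>m. B m \<subseteq> U"
proof -
  obtain \<B> where \<B>: "countable \<B>" "\<And>V. V \<in> \<B> \<Longrightarrow> openin X V"
    and base: "\<And>U. openin X U \<Longrightarrow> x \<in> U \<Longrightarrow> \<exists>V\<in>\<B>. x \<in> V \<and> V \<subseteq> U"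
    using assms unfolding first_countable_def by metis
  define \<N> where "\<N> = {V\<in>\<B>. x \<in> V}"
  have "\<N> \<noteq> {}" using base[OF openin_topspace assms(2)] by (auto simp: \<N>_def)
  moreover have "countable \<N>" using \<B>(1) by (simp add: \<N>_def)
  ultimately have range: "range (from_nat_into \<N>) = \<N>" by (rule range_from_nat_into)
  have \<N>: "openin X (from_nat_into \<N> j)" "x \<in> from_nat_into \<N> j" for j
    using rangeI[of "from_nat_into \<N>" j] \<B>(2) unfolding range by (auto simp: \<N>_def)
  show ?thesis
  proof (rule that[of "\<lambda>m. \<Inter>j\<le>m. from_nat_into \<N> j"])
    show "openin X (\<Inter>j\<le>m. from_nat_into \<N> j)" for m by (rule openin_Inter) (auto simp: \<N>(1))
    fix U assume "openin X U" "x \<in> U"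
    then obtain V where "V \<in> \<N>" "V \<subseteq> U" using base by (auto simp: \<N>_def)
    then obtain m where "from_nat_into \<N> m \<subseteq> U" using range by (metis rangeE)
    then show "\<exists>m. (\<Inter>j\<le>m. from_nat_into \<N> j) \<subseteq> U" by (intro exI[of _ m]) auto
  qed (use \<N>(2) in \<open>auto simp: decseq_def\<close>)
qed

context compact_Hausdorff_group begin

lemma triple_product_neighbourhood:
  assumes "openin T N" "\<one> \<in> N"
  obtains N' where "openin T N'" "\<one> \<in> N'" "\<And>p. p \<in> N' \<Longrightarrow> inv p \<in> N'"
    "\<And>p q r. p \<in> N' \<Longrightarrow> q \<in> N' \<Longrightarrow> r \<in> N' \<Longrightarrow> p \<otimes> q \<otimes> r \<in> N"
proof -
  obtain A where A: "openin T A" "\<one> \<in> A" "\<And>p q. p \<in> A \<Longrightarrow> q \<in> A \<Longrightarrow> p \<otimes> q \<in> N"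
    using symmetric_neighbourhood[OF assms] by metis
  obtain B where B: "openin T B" "\<one> \<in> B" "\<And>p. p \<in> B \<Longrightarrow> inv p \<in> B"
    "\<And>p q. p \<in> B \<Longrightarrow> q \<in> B \<Longrightarrow> p \<otimes> q \<in> A"
    using symmetric_neighbourhood[OF A(1,2)] by metis
  have "r \<in> A" if "r \<in> B" for r
    using B(4)[OF that B(2)] openin_imp_carrier[OF B(1) that] by simp
  then show ?thesis using A(3) B by (intro that[of B]) auto
qed

lemma twisted_product_neighbourhood:
  assumes "openin T N" "\<one> \<in> N"
  obtains N' where "openin T N'" "\<one> \<in> N'"
    "\<And>k p q r. k \<in> carrier K \<Longrightarrow> p \<in> N' \<Longrightarrow> q \<in> N' \<Longrightarrow> r \<in> N' \<Longrightarrow> inv p \<otimes> (k \<otimes> q \<otimes> inv k) \<otimes> r \<in> N"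
proof -
  obtain A where A: "openin T A" "\<one> \<in> A" "\<And>p. p \<in> A \<Longrightarrow> inv p \<in> A"
    "\<And>p q r. p \<in> A \<Longrightarrow> q \<in> A \<Longrightarrow> r \<in> A \<Longrightarrow> p \<otimes> q \<otimes> r \<in> N"
    by (rule triple_product_neighbourhood[OF assms]) (rule that)
  obtain B where B: "openin T B" "\<one> \<in> B" "\<And>k x. k \<in> carrier K \<Longrightarrow> x \<in> B \<Longrightarrow> k \<otimes> x \<otimes> inv k \<in> A"
    using conjugation_equicontinuous[OF A(1,2)] by metis
  show ?thesis by (rule that[of "A \<inter> B"]) (use A B in auto)
qed

lemma Ulam_stableE:
  assumes "Ulam_stable \<H>" "openin T N" "\<one> \<in> N"
  obtains N' where "openin T N'" "\<one> \<in> N'"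
    "\<And>H f. H \<in> \<H> \<Longrightarrow> f \<in> carrier H \<rightarrow> carrier K \<Longrightarrow> \<forall>x\<in>carrier H. \<forall>z\<in>carrier H. defect H f x z \<in> N' \<Longrightarrow>
       \<exists>h\<in>hom H K. \<forall>x\<in>carrier H. h x \<otimes> inv (f x) \<in> N"
proof -
  obtain N' where "openin T N'" "\<one> \<in> N'"
    "\<forall>H\<in>\<H>. \<forall>f\<in>carrier H \<rightarrow> carrier K. (\<forall>x\<in>carrier H. \<forall>z\<in>carrier H. defect H f x z \<in> N') \<longrightarrow>
       (\<exists>h\<in>hom H K. \<forall>x\<in>carrier H. h x \<otimes> inv (f x) \<in> N)"
    using assms unfolding Ulam_stable_def by (elim allE impE exE conjE)
  then show ?thesis by (intro that[of N']) auto
qed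

end

text \<open>The map \<open>t\<close> sends a choice of representatives to \<open>\<tau>\<close> of its class; \<open>separation\<close> is all
  that is used of definability.\<close>

locale internal_homomorphism = compact_Hausdorff_group K T for K (structure) and T +
  fixes \<H> :: "('h, 'm) monoid_scheme set" and \<U> :: "'i filter" and H :: "'i \<Rightarrow> ('h, 'm) monoid_scheme"
    and t :: "('i \<Rightarrow> 'h) \<Rightarrow> 'a"
  assumes first_countable: "first_countable T" and stable: "Ulam_stable \<H>" and H_in: "H i \<in> \<H>"
    and ultra: "ultrafilter \<U>" and incomplete: "countably_incomplete \<U>"
    and group_H: "group (H i)"
    and t_carrier: "a \<in> sections (\<lambda>i. carrier (H i)) \<Longrightarrow> t a \<in> carrier K"
    and t_mult: "a \<in> sections (\<lambda>i. carrier (H i)) \<Longrightarrow> b \<in> sections (\<lambda>i. carrier (H i)) \<Longrightarrow>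
        t (\<lambda>i. a i \<otimes>\<^bsub>H i\<^esub> b i) = t a \<otimes> t b"
    and separation: "closedin T D \<Longrightarrow> openin T N \<Longrightarrow> D \<subseteq> N \<Longrightarrow>
        internally_separated \<U> (sections (\<lambda>i. carrier (H i))) (t -` D) (t -` N)"
begin

abbreviation "S \<equiv> sections (\<lambda>i. carrier (H i))"

lemma carrier_H_nonempty: "carrier (H i) \<noteq> {}"
  using group.is_monoid[OF group_H] monoid.one_closed by blast

lemma internal_neighbourhood:
  assumes N: "openin T N" "\<one> \<in> N" and k: "k \<in> carrier K"
  shows "\<exists>A X. openin T A \<and> k \<in> A \<and> (\<forall>a\<in>S. (t a \<in> A \<longrightarrow> (\<forall>\<^sub>F i in \<U>. a i \<in> X i)) \<and>
    ((\<forall>\<^sub>F i in \<U>. a i \<in> X i) \<longrightarrow> t a \<otimes> inv k \<in> N))"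
proof -
  let ?N = "{x \<in> carrier K. x \<otimes> inv k \<in> N}"
  have open_N: "openin T ?N" using N(1) k by (intro openin_right_translate) auto
  moreover have "k \<in> ?N" using k N(2) by simp
  ultimately obtain A D where AD: "openin T A" "closedin T D" "k \<in> A" "A \<subseteq> D" "D \<subseteq> ?N"
    by (rule closed_neighbourhood)
  from separation[OF AD(2) open_N AD(5)] obtain X where
    "\<forall>a\<in>S. (a \<in> t -` D \<longrightarrow> (\<forall>\<^sub>F i in \<U>. a i \<in> X i)) \<and> ((\<forall>\<^sub>F i in \<U>. a i \<in> X i) \<longrightarrow> a \<in> t -` ?N)"
    unfolding internally_separated_def by (rule exE)
  then show ?thesis using AD(1,3,4) by (intro exI[of _ A] exI[of _ X]) blast
qed

lemma internal_approximation:
  assumes N: "openin T N" "\<one> \<in> N"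
  obtains f where "\<And>i x. f i x \<in> carrier K" "\<And>a. a \<in> S \<Longrightarrow> \<forall>\<^sub>F i in \<U>. t a \<otimes> inv (f i (a i)) \<in> N"
proof -
  have "\<forall>k\<in>carrier K. \<exists>A X. openin T A \<and> k \<in> A \<and> (\<forall>a\<in>S. (t a \<in> A \<longrightarrow> (\<forall>\<^sub>F i in \<U>. a i \<in> X i)) \<and>
      ((\<forall>\<^sub>F i in \<U>. a i \<in> X i) \<longrightarrow> t a \<otimes> inv k \<in> N))"
    using internal_neighbourhood[OF N] by simp
  then obtain A X where AX: "\<forall>k\<in>carrier K. openin T (A k) \<and> k \<in> A k \<and>
      (\<forall>a\<in>S. (t a \<in> A k \<longrightarrow> (\<forall>\<^sub>F i in \<U>. a i \<in> X k i)) \<and> ((\<forall>\<^sub>F i in \<U>. a i \<in> X k i) \<longrightarrow> t a \<otimes> inv k \<in> N))"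
    unfolding bchoice_iff by (elim exE)
  have "\<exists>\<F>. finite \<F> \<and> \<F> \<subseteq> A ` carrier K \<and> topspace T \<subseteq> \<Union>\<F>"
    by (rule compact[unfolded compact_space_alt, rule_format]) (use AX topspace_eq in auto)
  then obtain P where P: "finite P" "P \<subseteq> carrier K" "carrier K \<subseteq> (\<Union>k\<in>P. A k)"
    using topspace_eq by (metis finite_subset_image)
  then have "P \<noteq> {}" using one_closed by blast
  then have "\<forall>i x. \<exists>k\<in>P. (\<exists>k\<in>P. x \<in> X k i) \<longrightarrow> x \<in> X k i" by blast
  then obtain f where f: "\<And>i x. f i x \<in> P" "\<And>i x k. k \<in> P \<Longrightarrow> x \<in> X k i \<Longrightarrow> x \<in> X (f i x) i" by metis
  show ?thesis
  proof (rule that[of f])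
    show "f i x \<in> carrier K" for i x using f(1) P(2) by blast
    fix a assume a: "a \<in> S"
    obtain k where k: "k \<in> P" "t a \<in> A k" using P(3) t_carrier[OF a] by blast
    then have "\<forall>\<^sub>F i in \<U>. a i \<in> X k i" using AX P(2) a by blast
    then have "\<forall>\<^sub>F i in \<U>. \<exists>k\<in>P. f i (a i) = k \<and> a i \<in> X k i"
      by eventually_elim (use f k(1) in blast)
    from ultrafilter_eventually_bex_finite[OF ultra P(1) this] obtain k' where
      k': "k' \<in> P" "\<forall>\<^sub>F i in \<U>. f i (a i) = k' \<and> a i \<in> X k' i" by blast
    from k'(2) have "\<forall>\<^sub>F i in \<U>. a i \<in> X k' i" by eventually_elim simp
    then have near: "t a \<otimes> inv k' \<in> N" using AX k'(1) P(2) a by blast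
    from k'(2) show "\<forall>\<^sub>F i in \<U>. t a \<otimes> inv (f i (a i)) \<in> N" by eventually_elim (simp add: near)
  qed
qed

lemma eventually_almost_hom:
  assumes N: "openin T N" "\<one> \<in> N"
  obtains N' where "openin T N'" "\<one> \<in> N'"
    "\<And>f. \<forall>i x. f i x \<in> carrier K \<Longrightarrow> \<forall>a\<in>S. \<forall>\<^sub>F i in \<U>. t a \<otimes> inv (f i (a i)) \<in> N' \<Longrightarrow>
       \<forall>\<^sub>F i in \<U>. \<forall>x\<in>carrier (H i). \<forall>z\<in>carrier (H i). defect (H i) (f i) x z \<in> N"
proof -
  obtain N' where N': "openin T N'" "\<one> \<in> N'" and word:
    "\<And>k p q r. k \<in> carrier K \<Longrightarrow> p \<in> N' \<Longrightarrow> q \<in> N' \<Longrightarrow> r \<in> N' \<Longrightarrow> inv p \<otimes> (k \<otimes> q \<otimes> inv k) \<otimes> r \<in> N"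
    by (rule twisted_product_neighbourhood[OF N]) (rule that)
  have "\<forall>\<^sub>F i in \<U>. \<forall>x\<in>carrier (H i). \<forall>z\<in>carrier (H i). defect (H i) (f i) x z \<in> N"
    if f: "\<forall>i x. f i x \<in> carrier K" and near: "\<forall>a\<in>S. \<forall>\<^sub>F i in \<U>. t a \<otimes> inv (f i (a i)) \<in> N'" for f
  proof -
    have "\<forall>\<^sub>F i in \<U>. \<forall>p\<in>carrier (H i) \<times> carrier (H i). defect (H i) (f i) (fst p) (snd p) \<in> N"
    proof (rule eventually_ball_if_sections)
      show "carrier (H i) \<times> carrier (H i) \<noteq> {}" for i using carrier_H_nonempty by simp
      fix p assume "\<And>i. p i \<in> carrier (H i) \<times> carrier (H i)"
      then obtain a b where ab: "a \<in> S" "b \<in> S" and p: "p = (\<lambda>i. (a i, b i))"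
        using that[of "\<lambda>i. fst (p i)" "\<lambda>i. snd (p i)"] by (simp add: sections_def mem_Times_iff)
      define c where "c i = a i \<otimes>\<^bsub>H i\<^esub> b i" for i
      have c: "c \<in> S" using ab group.is_monoid[OF group_H] by (simp add: c_def sections_def monoid.m_closed)
      have tc: "t c = t a \<otimes> t b" using t_mult[OF ab] by (simp add: c_def[abs_def])
      show "\<forall>\<^sub>F i in \<U>. defect (H i) (f i) (fst (p i)) (snd (p i)) \<in> N"
        using near[rule_format, OF ab(1)] near[rule_format, OF ab(2)] near[rule_format, OF c]
      proof eventually_elim
        case (elim i)
        have "inv (t c \<otimes> inv (f i (c i))) \<otimes> (t a \<otimes> (t b \<otimes> inv (f i (b i))) \<otimes> inv (t a))
            \<otimes> (t a \<otimes> inv (f i (a i))) \<in> N"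
          using elim t_carrier ab by (intro word) auto
        also have "inv (t c \<otimes> inv (f i (c i))) \<otimes> (t a \<otimes> (t b \<otimes> inv (f i (b i))) \<otimes> inv (t a))
            \<otimes> (t a \<otimes> inv (f i (a i))) = defect (H i) (f i) (a i) (b i)"
          using t_carrier ab f by (simp add: defect_def tc m_assoc inv_mult_group flip: c_def)
        finally show ?case by (simp add: p)
      qed
    qed
    then show ?thesis by eventually_elim auto
  qed
  then show ?thesis by (rule that[OF N'])
qed

lemma internal_hom_approximation:
  assumes N: "openin T N" "\<one> \<in> N"
  obtains h where "\<And>i. h i \<in> hom (H i) K" "\<And>a. a \<in> S \<Longrightarrow> \<forall>\<^sub>F i in \<U>. t a \<otimes> inv (h i (a i)) \<in> N"
proof -
  obtain A where A: "openin T A" "\<one> \<in> A" "\<And>p. p \<in> A \<Longrightarrow> inv p \<in> A" "\<And>p q. p \<in> A \<Longrightarrow> q \<in> A \<Longrightarrow> p \<otimes> q \<in> N"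
    by (rule symmetric_neighbourhood[OF N]) (rule that)
  obtain B where B: "openin T B" "\<one> \<in> B"
    and stable_B: "\<And>H' f. H' \<in> \<H> \<Longrightarrow> f \<in> carrier H' \<rightarrow> carrier K \<Longrightarrow>
      \<forall>x\<in>carrier H'. \<forall>z\<in>carrier H'. defect H' f x z \<in> B \<Longrightarrow> \<exists>h\<in>hom H' K. \<forall>x\<in>carrier H'. h x \<otimes> inv (f x) \<in> A"
    by (rule Ulam_stableE[OF stable A(1,2)]) (rule that)
  obtain N' where N': "openin T N'" "\<one> \<in> N'" and almost_hom:
    "\<And>f. \<forall>i x. f i x \<in> carrier K \<Longrightarrow> \<forall>a\<in>S. \<forall>\<^sub>F i in \<U>. t a \<otimes> inv (f i (a i)) \<in> N' \<Longrightarrow>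
       \<forall>\<^sub>F i in \<U>. \<forall>x\<in>carrier (H i). \<forall>z\<in>carrier (H i). defect (H i) (f i) x z \<in> B"
    by (rule eventually_almost_hom[OF B]) (rule that)
  have "openin T (A \<inter> N')" "\<one> \<in> A \<inter> N'" using A N' by auto
  then obtain f where f: "\<And>i x. f i x \<in> carrier K"
    and near: "\<And>a. a \<in> S \<Longrightarrow> \<forall>\<^sub>F i in \<U>. t a \<otimes> inv (f i (a i)) \<in> A \<inter> N'"
    by (rule internal_approximation) (rule that)
  have "\<forall>\<^sub>F i in \<U>. \<forall>x\<in>carrier (H i). \<forall>z\<in>carrier (H i). defect (H i) (f i) x z \<in> B"
    using f near by (intro almost_hom) (auto simp: eventually_conj_iff)
  then have "\<forall>\<^sub>F i in \<U>. \<exists>h\<in>hom (H i) K. \<forall>x\<in>carrier (H i). h x \<otimes> inv (f i x) \<in> A"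
    by eventually_elim (use f H_in in \<open>auto intro!: stable_B\<close>)
  moreover have "hom (H i) K \<noteq> {}" for i
    using homI[of "H i" "\<lambda>_. \<one>" K] by auto
  ultimately obtain h where h: "\<And>i. h i \<in> hom (H i) K"
    and h_near: "\<forall>\<^sub>F i in \<U>. \<forall>x\<in>carrier (H i). h i x \<otimes> inv (f i x) \<in> A"
    using eventually_bex_iff_section[of "\<lambda>i. hom (H i) K" "\<lambda>i h. \<forall>x\<in>carrier (H i). h x \<otimes> inv (f i x) \<in> A" \<U>]
    by auto
  show ?thesis
  proof (rule that[OF h])
    fix a assume a: "a \<in> S"
    show "\<forall>\<^sub>F i in \<U>. t a \<otimes> inv (h i (a i)) \<in> N"
      using near[OF a] h_near
    proof eventually_elim
      case (elim i)
      have "(t a \<otimes> inv (f i (a i))) \<otimes> inv (h i (a i) \<otimes> inv (f i (a i))) \<in> N"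
        using elim sectionsD[OF a] by (intro A(3,4)) auto
      also have "(t a \<otimes> inv (f i (a i))) \<otimes> inv (h i (a i) \<otimes> inv (f i (a i))) = t a \<otimes> inv (h i (a i))"
        using hom_in_carrier[OF h sectionsD[OF a]] f t_carrier[OF a] by (simp add: m_assoc inv_mult_group)
      finally show ?case .
    qed
  qed
qed

lemma eventually_uniformly_close:
  assumes h: "\<And>i. h i \<in> hom (H i) K" "\<And>a. a \<in> S \<Longrightarrow> \<forall>\<^sub>F i in \<U>. t a \<otimes> inv (h i (a i)) \<in> N"
    and h': "\<And>i. h' i \<in> hom (H i) K" "\<And>a. a \<in> S \<Longrightarrow> \<forall>\<^sub>F i in \<U>. t a \<otimes> inv (h' i (a i)) \<in> N"
  shows "\<forall>\<^sub>F i in \<U>. \<forall>x\<in>carrier (H i). \<exists>p\<in>N. \<exists>q\<in>N. h' i x \<otimes> inv (h i x) = inv p \<otimes> q"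
proof (rule eventually_ball_if_sections[OF carrier_H_nonempty])
  fix a assume "\<And>i. a i \<in> carrier (H i)"
  then have a: "a \<in> S" by (simp add: sections_def)
  show "\<forall>\<^sub>F i in \<U>. \<exists>p\<in>N. \<exists>q\<in>N. h' i (a i) \<otimes> inv (h i (a i)) = inv p \<otimes> q"
    using h(2)[OF a] h'(2)[OF a]
  proof eventually_elim
    case (elim i)
    have "h' i (a i) \<otimes> inv (h i (a i)) = inv (t a \<otimes> inv (h' i (a i))) \<otimes> (t a \<otimes> inv (h i (a i)))"
      using hom_in_carrier[OF h(1) sectionsD[OF a]] hom_in_carrier[OF h'(1) sectionsD[OF a]] t_carrier[OF a]
      by (simp add: m_assoc inv_mult_group)
    then show ?case using elim by blast
  qed
qed

lemma diagonal_hom: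
  assumes B: "\<And>m. openin T (B m)" "\<And>m. \<one> \<in> B m" "decseq B"
  obtains h \<sigma> where "\<And>m i. h m i \<in> hom (H i) K" "\<And>i. \<sigma> i \<in> hom (H i) K"
    "\<And>m a. a \<in> S \<Longrightarrow> \<forall>\<^sub>F i in \<U>. t a \<otimes> inv (h m i (a i)) \<in> B m"
    "\<And>m. \<forall>\<^sub>F i in \<U>. \<forall>x\<in>carrier (H i). \<exists>p\<in>B m. \<exists>q\<in>B m. \<sigma> i x \<otimes> inv (h m i x) = inv p \<otimes> q"
proof -
  have "\<exists>h. (\<forall>i. h i \<in> hom (H i) K) \<and> (\<forall>a\<in>S. \<forall>\<^sub>F i in \<U>. t a \<otimes> inv (h i (a i)) \<in> B m)" for m
    by (rule internal_hom_approximation[OF B(1,2)[of m]]) blast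
  then obtain h where h: "\<And>m i. h m i \<in> hom (H i) K"
    and near: "\<And>m a. a \<in> S \<Longrightarrow> \<forall>\<^sub>F i in \<U>. t a \<otimes> inv (h m i (a i)) \<in> B m" by metis
  define close where "close j m i \<longleftrightarrow>
    (\<forall>x\<in>carrier (H i). \<exists>p\<in>B j. \<exists>q\<in>B j. h m i x \<otimes> inv (h j i x) = inv p \<otimes> q)" for j m i
  have "\<forall>\<^sub>F i in \<U>. close j m i" if jm: "j \<le> m" for j m
    unfolding close_def
  proof (rule eventually_uniformly_close[OF h near h])
    fix a assume "a \<in> S"
    from near[OF this] show "\<forall>\<^sub>F i in \<U>. t a \<otimes> inv (h m i (a i)) \<in> B j"
      by (rule eventually_mono) (use decseqD[OF B(3) jm] in blast)
  qed
  then have close: "\<forall>\<^sub>F i in \<U>. \<forall>j\<in>{..m}. close j m i" for m by (intro eventually_ball_finite) auto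
  obtain k :: "'i \<Rightarrow> nat" where k: "\<forall>\<^sub>F i in \<U>. \<forall>j\<in>{..k i}. close j (k i) i" "\<And>m. \<forall>\<^sub>F i in \<U>. m \<le> k i"
    by (rule countably_incomplete_diagonal[OF incomplete close]) (rule that)
  have "\<forall>\<^sub>F i in \<U>. close m (k i) i" for m
    using k(1) k(2)[of m] by eventually_elim simp
  then show ?thesis using h near by (intro that[of h "\<lambda>i. h (k i) i"]) (auto simp: close_def)
qed

theorem internal_homomorphism_limit:
  obtains \<sigma> where "\<And>i. \<sigma> i \<in> hom (H i) K" "\<And>a. a \<in> S \<Longrightarrow> limitin T (\<lambda>i. \<sigma> i (a i)) (t a) \<U>"
proof -
  have "\<one> \<in> topspace T" by (simp add: topspace_eq)
  then obtain B :: "nat \<Rightarrow> 'a set" where B: "\<And>m. openin T (B m)" "\<And>m. \<one> \<in> B m" "decseq B"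
    and B_base: "\<And>N. openin T N \<Longrightarrow> \<one> \<in> N \<Longrightarrow> \<exists>m. B m \<subseteq> N"
    by (rule first_countable_decreasing_base[OF first_countable]) (rule that)
  obtain h \<sigma> where h: "\<And>m i. h m i \<in> hom (H i) K" and \<sigma>: "\<And>i. \<sigma> i \<in> hom (H i) K"
    and near: "\<And>m a. a \<in> S \<Longrightarrow> \<forall>\<^sub>F i in \<U>. t a \<otimes> inv (h m i (a i)) \<in> B m"
    and close: "\<And>m. \<forall>\<^sub>F i in \<U>. \<forall>x\<in>carrier (H i). \<exists>p\<in>B m. \<exists>q\<in>B m. \<sigma> i x \<otimes> inv (h m i x) = inv p \<otimes> q"
    by (rule diagonal_hom[OF B]) (rule that)
  have "limitin T (\<lambda>i. \<sigma> i (a i)) (t a) \<U>" if a: "a \<in> S" for a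
  proof (rule limitin_if_quotients[OF t_carrier[OF a]])
    have K: "\<sigma> i (a i) \<in> carrier K" "h m i (a i) \<in> carrier K" for i m
      using hom_in_carrier[OF _ sectionsD[OF a]] \<sigma> h by blast+
    then show "\<forall>\<^sub>F i in \<U>. \<sigma> i (a i) \<in> carrier K" by simp
    fix N assume N: "openin T N" "\<one> \<in> N"
    obtain N' where N': "openin T N'" "\<one> \<in> N'" "\<And>p. p \<in> N' \<Longrightarrow> inv p \<in> N'"
      "\<And>p q r. p \<in> N' \<Longrightarrow> q \<in> N' \<Longrightarrow> r \<in> N' \<Longrightarrow> p \<otimes> q \<otimes> r \<in> N"
      by (rule triple_product_neighbourhood[OF N]) (rule that)
    obtain m where m: "B m \<subseteq> N'" using B_base[OF N'(1,2)] by blast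
    show "\<forall>\<^sub>F i in \<U>. \<sigma> i (a i) \<otimes> inv (t a) \<in> N"
      using close[of m] near[OF a, of m]
    proof eventually_elim
      case (elim i)
      then obtain p q where pq: "p \<in> B m" "q \<in> B m" "\<sigma> i (a i) \<otimes> inv (h m i (a i)) = inv p \<otimes> q"
        using sectionsD[OF a] by blast
      have "inv p \<otimes> q \<otimes> inv (t a \<otimes> inv (h m i (a i))) \<in> N"
        using pq(1,2) elim(2) m by (intro N'(3,4)) auto
      then show ?case
        using K t_carrier[OF a] unfolding pq(3)[symmetric] by (simp add: m_assoc inv_mult_group)
    qed
  qed
  then show ?thesis using \<sigma> by (rule that[rotated])
qed

end

section \<open>Ultraproducts\<close>

text \<open>The part of the ultraproduct construction common to both logics; \<open>\<sim>\<close> identifies the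
  sections that represent the same element.\<close>

locale structure_ultraproduct =
  fixes \<U> :: "'i filter" and L :: "('f, 'r, 'x) lang_scheme" and G :: "'i \<Rightarrow> ('a, 'f, 'y) fun_structure_scheme"
    and M :: "(('i \<Rightarrow> 'a) set, 'f, 'w) fun_structure_scheme"
    and sim :: "('i \<Rightarrow> 'a) \<Rightarrow> ('i \<Rightarrow> 'a) \<Rightarrow> bool" (infix \<open>\<sim>\<close> 50)
  assumes ultra: "ultrafilter \<U>" and univ_nonempty: "univ (G i) \<noteq> {}"
    and sim_refl: "a \<in> sections (\<lambda>i. univ (G i)) \<Longrightarrow> a \<sim> a" and sim_sym: "a \<sim> b \<Longrightarrow> b \<sim> a"
    and sim_trans: "a \<sim> b \<Longrightarrow> b \<sim> c \<Longrightarrow> a \<in> sections (\<lambda>i. univ (G i)) \<Longrightarrow>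
      b \<in> sections (\<lambda>i. univ (G i)) \<Longrightarrow> c \<in> sections (\<lambda>i. univ (G i)) \<Longrightarrow> a \<sim> c"
    and univ: "univ M = (\<lambda>a. {b \<in> sections (\<lambda>i. univ (G i)). a \<sim> b}) ` sections (\<lambda>i. univ (G i))"
    and fn: "fn M f As = {b \<in> sections (\<lambda>i. univ (G i)).
      (\<lambda>i. fn (G i) f (map (\<lambda>A. (SOME a. a \<in> A) i) As)) \<sim> b}"
    and fn_closed: "f \<in> fun_syms L \<Longrightarrow> xs \<in> tuples (univ (G i)) (fun_arity L f) \<Longrightarrow> fn (G i) f xs \<in> univ (G i)"
    and fn_sim: "f \<in> fun_syms L \<Longrightarrow> length as = fun_arity L f \<Longrightarrow> set as \<subseteq> sections (\<lambda>i. univ (G i)) \<Longrightarrow>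
      set bs \<subseteq> sections (\<lambda>i. univ (G i)) \<Longrightarrow> list_all2 (\<sim>) as bs \<Longrightarrow>
      (\<lambda>i. fn (G i) f (map (\<lambda>a. a i) as)) \<sim> (\<lambda>i. fn (G i) f (map (\<lambda>a. a i) bs))"
begin

abbreviation "S \<equiv> sections (\<lambda>i. univ (G i))"

definition cls :: "('i \<Rightarrow> 'a) \<Rightarrow> ('i \<Rightarrow> 'a) set" where "cls a = {b \<in> S. a \<sim> b}"

definition rep :: "('i \<Rightarrow> 'a) set \<Rightarrow> 'i \<Rightarrow> 'a" where "rep A = (SOME a. a \<in> A)"

lemma univ_M: "univ M = cls ` S"
  by (simp add: univ cls_def)

lemma cls_in_univ: "a \<in> S \<Longrightarrow> cls a \<in> univ M"
  by (simp add: univ_M)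

lemma cls_eq_iff: "a \<in> S \<Longrightarrow> b \<in> S \<Longrightarrow> cls a = cls b \<longleftrightarrow> a \<sim> b"
  using sim_refl sim_sym sim_trans unfolding cls_def by blast

lemma in_univ_M:
  assumes "A \<in> univ M" "a \<in> A"
  shows "a \<in> S" "cls a = A"
proof -
  obtain b where b: "b \<in> S" "A = cls b" using assms(1) univ_M by auto
  then show a: "a \<in> S" using assms(2) by (simp add: cls_def)
  have "b \<sim> a" using assms(2) b by (simp add: cls_def)
  then show "cls a = A" using b(2) cls_eq_iff[OF b(1) a] by simp
qed

lemma rep:
  assumes "A \<in> univ M"
  shows "rep A \<in> S" "cls (rep A) = A"
proof -
  obtain b where "b \<in> S" "A = cls b" using assms univ_M by auto
  then have "b \<in> A" using sim_refl by (simp add: cls_def)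
  then have "rep A \<in> A" unfolding rep_def by (rule someI[of "\<lambda>a. a \<in> A"])
  with in_univ_M[OF assms] show "rep A \<in> S" "cls (rep A) = A" by auto
qed

lemma rep_cls:
  assumes "a \<in> S"
  shows "rep (cls a) \<in> S" "rep (cls a) \<sim> a"
  using rep[OF cls_in_univ[OF assms]] cls_eq_iff[OF _ assms] by auto

lemma reps_sections: "set as \<subseteq> S \<Longrightarrow> set (map (\<lambda>a. rep (cls a)) as) \<subseteq> S"
  using rep_cls(1) by auto

lemma reps_sim: "set as \<subseteq> S \<Longrightarrow> list_all2 (\<sim>) (map (\<lambda>a. rep (cls a)) as) as"
  using rep_cls(2) by (auto simp: list_all2_map1 list_all2_same)

lemma section_tuple: "set as \<subseteq> S \<Longrightarrow> map (\<lambda>a. a i) as \<in> tuples (univ (G i)) (length as)"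
  by (auto simp: tuples_def sections_def)

lemma fn_section:
  "f \<in> fun_syms L \<Longrightarrow> length as = fun_arity L f \<Longrightarrow> set as \<subseteq> S \<Longrightarrow>
   (\<lambda>i. fn (G i) f (map (\<lambda>a. a i) as)) \<in> S"
  using fn_closed[of f] section_tuple[of as] by (simp add: sections_def)

lemma fn_M_cls:
  assumes f: "f \<in> fun_syms L" "length as = fun_arity L f" and as: "set as \<subseteq> S"
  shows "fn M f (map cls as) = cls (\<lambda>i. fn (G i) f (map (\<lambda>a. a i) as))"
proof -
  let ?rs = "map (\<lambda>a. rep (cls a)) as"
  have "fn M f (map cls as) = cls (\<lambda>i. fn (G i) f (map (\<lambda>a. a i) ?rs))"
    by (simp add: fn cls_def rep_def o_def)
  also have "\<dots> = cls (\<lambda>i. fn (G i) f (map (\<lambda>a. a i) as))"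
    using fn_sim[OF f(1) _ reps_sections[OF as] as reps_sim[OF as]] f(2)
      fn_section[OF f(1) _ reps_sections[OF as]] fn_section[OF f as]
    by (subst cls_eq_iff) simp_all
  finally show ?thesis .
qed

definition trm_at :: "'i \<Rightarrow> (('i \<Rightarrow> 'a) set, 'f) trm \<Rightarrow> ('a, 'f) trm" where
  "trm_at i = map_trm (\<lambda>A. rep A i) (\<lambda>f. f)"

lemma trm_at_simps [simp]:
  "trm_at i (Var x) = Var x" "trm_at i (Param A) = Param (rep A i)" "trm_at i (App f ts) = App f (map (trm_at i) ts)"
  by (simp_all add: trm_at_def)

lemma trm_val_at_closed:
  assumes "\<And>n. w n \<in> univ (G i)" "wf_trm L (univ M) s"
  shows "trm_val (G i) w (trm_at i s) \<in> univ (G i)"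
  using assms(2)
proof (induction s)
  case (Param A)
  then show ?case using sectionsD[OF rep(1)] by simp
next
  case (App f ts)
  then have "map (trm_val (G i) w) (map (trm_at i) ts) \<in> tuples (univ (G i)) (fun_arity L f)"
    by (auto simp: tuples_def)
  then show ?case using fn_closed[of f _ i] App.prems by simp
qed (simp add: assms(1))

lemma trm_val_at_section:
  assumes "\<And>n. v n \<in> S" "wf_trm L (univ M) s"
  shows "(\<lambda>i. trm_val (G i) (\<lambda>n. v n i) (trm_at i s)) \<in> S"
  using assms(1) trm_val_at_closed[OF _ assms(2)] by (simp add: sections_def)

lemma trm_val_M:
  assumes v: "\<And>n. v n \<in> S" and "wf_trm L (univ M) s"
  shows "trm_val M (\<lambda>n. cls (v n)) s = cls (\<lambda>i. trm_val (G i) (\<lambda>n. v n i) (trm_at i s))"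
  using assms(2)
proof (induction s)
  case (Param A)
  then show ?case using rep(2)[of A] by simp
next
  case (App f ts)
  define as where "as = map (\<lambda>s i. trm_val (G i) (\<lambda>n. v n i) (trm_at i s)) ts"
  have f: "f \<in> fun_syms L" "length as = fun_arity L f" using App.prems by (auto simp: as_def)
  have as: "set as \<subseteq> S" using App.prems trm_val_at_section[OF v] by (auto simp: as_def)
  have "map (trm_val M (\<lambda>n. cls (v n))) ts = map cls as" using App by (auto simp: as_def)
  then have "trm_val M (\<lambda>n. cls (v n)) (App f ts) = cls (\<lambda>i. fn (G i) f (map (\<lambda>a. a i) as))"
    using fn_M_cls[OF f as] by simp
  then show ?case by (simp add: as_def o_def)
qed simp

lemma trm_vals_M:
  assumes v: "\<And>n. v n \<in> S" and ts: "\<forall>s\<in>set ts. wf_trm L (univ M) s"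
  obtains as where "set as \<subseteq> S" "length as = length ts" "map (trm_val M (\<lambda>n. cls (v n))) ts = map cls as"
    "\<And>i. map (trm_val (G i) (\<lambda>n. v n i)) (map (trm_at i) ts) = map (\<lambda>a. a i) as"
  by (rule that[of "map (\<lambda>s i. trm_val (G i) (\<lambda>n. v n i) (trm_at i s)) ts"])
    (use trm_val_at_section[OF v] trm_val_M[OF v] ts in auto)

lemma cls_fun_upd: "(\<lambda>n. cls (v n))(x := cls b) = (\<lambda>n. cls ((v(x := b)) n))"
  by (rule ext) simp

lemma component_fun_upd: "(\<lambda>n. v n i)(x := b i) = (\<lambda>n. (v(x := b)) n i)"
  by (rule ext) simp

lemma homomorphism_limit:
  fixes K :: "('k, 'z) monoid_scheme"
  assumes K: "compact_Hausdorff_group K T" "first_countable T"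
      "topological_group.Ulam_stable K T {H :: 'a monoid. amenable_group H}"
    and incomplete: "countably_incomplete \<U>"
    and L: "extends_group_language L" and amenable: "\<And>i. expands_amenable_group L (G i)"
    and hom: "\<tau> \<in> hom (group_reduct L M) K"
    and separation: "\<And>D N. closedin T D \<Longrightarrow> openin T N \<Longrightarrow> D \<subseteq> N \<Longrightarrow>
      internally_separated \<U> S ((\<lambda>a. \<tau> (cls a)) -` D) ((\<lambda>a. \<tau> (cls a)) -` N)"
  shows "\<exists>\<sigma> :: 'i \<Rightarrow> 'a \<Rightarrow> 'k. (\<forall>i. \<sigma> i \<in> hom (group_reduct L (G i)) K) \<and>
    (\<forall>A \<in> univ M. \<forall>a \<in> A. limitin T (\<lambda>i. \<sigma> i (a i)) (\<tau> A) \<U>)"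
proof -
  let ?H = "\<lambda>i. group_reduct L (G i)" and ?t = "\<lambda>a. \<tau> (cls a)"
  interpret compact_Hausdorff_group K T by (rule K(1))
  have carrier: "carrier (group_reduct L M') = univ M'" for M' :: "('c, 'f, 's) fun_structure_scheme"
    by (simp add: group_reduct_def)
  interpret internal: internal_homomorphism K T "{H. amenable_group H}" \<U> ?H ?t
  proof (intro internal_homomorphism.intro internal_homomorphism_axioms.intro)
    show H: "?H i \<in> {H. amenable_group H}" for i using amenable by (simp add: expands_amenable_group_def)
    then show "group (?H i)" for i by (simp add: amenable_group_def)
    show "?t a \<in> carrier K" if "a \<in> sections (\<lambda>i. carrier (?H i))" for a
      using that by (intro hom_in_carrier[OF hom]) (simp add: carrier cls_in_univ)
    show "?t (\<lambda>i. a i \<otimes>\<^bsub>?H i\<^esub> b i) = ?t a \<otimes>\<^bsub>K\<^esub> ?t b"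
      if "a \<in> sections (\<lambda>i. carrier (?H i))" "b \<in> sections (\<lambda>i. carrier (?H i))" for a b
    proof -
      have ab: "a \<in> S" "b \<in> S" using that by (simp_all add: carrier)
      have "cls (\<lambda>i. a i \<otimes>\<^bsub>?H i\<^esub> b i) = cls a \<otimes>\<^bsub>group_reduct L M\<^esub> cls b"
        using fn_M_cls[of "mult_sym L" "[a, b]"] L ab by (simp add: extends_group_language_def group_reduct_def)
      then show ?thesis using hom_mult[OF hom, of "cls a" "cls b"] ab by (simp add: carrier cls_in_univ)
    qed
  qed (use K ultra incomplete separation in \<open>simp_all add: carrier\<close>)
  obtain \<sigma> where \<sigma>: "\<And>i. \<sigma> i \<in> hom (?H i) K" "\<And>a. a \<in> S \<Longrightarrow> limitin T (\<lambda>i. \<sigma> i (a i)) (?t a) \<U>"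
    using internal.internal_homomorphism_limit unfolding carrier by blast
  have "limitin T (\<lambda>i. \<sigma> i (a i)) (\<tau> A) \<U>" if A: "A \<in> univ M" "a \<in> A" for A a
    using \<sigma>(2)[OF in_univ_M(1)[OF A]] by (simp add: in_univ_M(2)[OF A])
  then show ?thesis using \<sigma>(1) by blast
qed

end

section \<open>Classical logic\<close>

lemma eventually_map_eq:
  assumes "list_all2 (\<lambda>a b. \<forall>\<^sub>F i in F. a i = b i) as bs"
  shows "\<forall>\<^sub>F i in F. map (\<lambda>a. a i) as = map (\<lambda>a. a i) bs"
  using assms
proof (induction rule: list_all2_induct)
  case (Cons a as b bs)
  then show ?case by (auto elim: eventually_elim2)
qed simp

lemma fo_types_satisfiable:
  "p \<in> fo_types L M \<Longrightarrow> finite \<Phi> \<Longrightarrow> \<Phi> \<subseteq> p \<Longrightarrow> \<exists>a\<in>univ M. \<forall>\<phi>\<in>\<Phi>. fo_sat M (\<lambda>_. a) \<phi>"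
  by (simp add: fo_types_def)

lemma fo_types_complete: "p \<in> fo_types L M \<Longrightarrow> \<phi> \<in> fo_fms L M \<Longrightarrow> \<phi> \<in> p \<or> Neg \<phi> \<in> p"
  by (simp add: fo_types_def)

lemma Conj_in_type_iff:
  assumes p: "p \<in> fo_types L M" and fms: "\<phi> \<in> fo_fms L M" "\<psi> \<in> fo_fms L M"
  shows "Conj \<phi> \<psi> \<in> p \<longleftrightarrow> \<phi> \<in> p \<and> \<psi> \<in> p"
proof -
  have "Conj \<phi> \<psi> \<in> fo_fms L M" using fms by (auto simp: fo_fms_def)
  then show ?thesis
    using fo_types_satisfiable[OF p, of "{Conj \<phi> \<psi>, Neg \<phi>}"] fo_types_satisfiable[OF p, of "{Conj \<phi> \<psi>, Neg \<psi>}"]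
      fo_types_satisfiable[OF p, of "{Neg (Conj \<phi> \<psi>), \<phi>, \<psi>}"] fo_types_complete[OF p] fms by auto
qed

lemma fo_tp_in_types: "a \<in> univ M \<Longrightarrow> fo_tp L M a \<in> fo_types L M"
  by (auto simp: fo_types_def fo_tp_def fo_fms_def)

lemma topspace_fo_type_space: "topspace (fo_type_space L M) = fo_types L M"
proof -
  have "\<exists>\<phi>\<in>fo_fms L M. \<phi> \<in> p" if p: "p \<in> fo_types L M" for p
  proof -
    have "Equal (Var 0) (Var 0) \<in> fo_fms L M" by (simp add: fo_fms_def)
    moreover have "Neg (Equal (Var 0) (Var 0)) \<in> fo_fms L M" by (simp add: fo_fms_def)
    ultimately show ?thesis using fo_types_complete[OF p] by blast
  qed
  then show ?thesis unfolding fo_type_space_def topology_generated_by_topspace by blast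
qed

lemma openin_fo_type_space_imp_formula:
  assumes "openin (fo_type_space L M) Q" "p \<in> Q"
  obtains \<phi> where "\<phi> \<in> fo_fms L M" "\<phi> \<in> p" "{q \<in> fo_types L M. \<phi> \<in> q} \<subseteq> Q"
proof -
  have "generate_topology_on {{p \<in> fo_types L M. \<phi> \<in> p} | \<phi>. \<phi> \<in> fo_fms L M} Q"
    using assms(1) unfolding fo_type_space_def openin_topology_generated_by_iff .
  then have "p \<in> Q \<Longrightarrow> \<exists>\<phi>\<in>fo_fms L M. p \<in> fo_types L M \<and> \<phi> \<in> p \<and> {q \<in> fo_types L M. \<phi> \<in> q} \<subseteq> Q"
  proof (induction rule: generate_topology_on.induct)
    case (Int A B)
    then obtain \<phi> \<psi> where p: "p \<in> fo_types L M" and fms: "\<phi> \<in> fo_fms L M" "\<psi> \<in> fo_fms L M"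
      and "\<phi> \<in> p" "\<psi> \<in> p" "{q \<in> fo_types L M. \<phi> \<in> q} \<subseteq> A" "{q \<in> fo_types L M. \<psi> \<in> q} \<subseteq> B" by auto
    then have "Conj \<phi> \<psi> \<in> p" "{q \<in> fo_types L M. Conj \<phi> \<psi> \<in> q} \<subseteq> A \<inter> B"
      using Conj_in_type_iff[OF _ fms] by blast+
    moreover have "Conj \<phi> \<psi> \<in> fo_fms L M" using fms by (auto simp: fo_fms_def)
    ultimately show ?case using p by blast
  next
    case (UN \<K>)
    then show ?case by blast
  qed auto
  then show ?thesis using assms(2) that by blast
qed

locale fo_structure_family =
  fixes \<U> :: "'i filter" and L :: "('f, 'r) lang" and G :: "'i \<Rightarrow> ('a, 'f, 'r) fo_structure"
  assumes ultrafilter: "ultrafilter \<U>" and struct: "is_fo_structure L (G i)"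
begin

abbreviation "M \<equiv> fo_ultraproduct \<U> G"

sublocale structure_ultraproduct \<U> L G M "\<lambda>a b. \<forall>\<^sub>F i in \<U>. a i = b i"
proof
  show "\<forall>\<^sub>F i in \<U>. a i = c i" if "\<forall>\<^sub>F i in \<U>. a i = b i" "\<forall>\<^sub>F i in \<U>. b i = c i" for a b c :: "'i \<Rightarrow> 'a"
    using that by eventually_elim simp
  show "univ (G i) \<noteq> {}" for i using struct[of i] by (simp add: is_fo_structure_def)
  show "fn (G i) f xs \<in> univ (G i)"
    if "f \<in> fun_syms L" "xs \<in> tuples (univ (G i)) (fun_arity L f)" for f xs i
    using struct[of i] that by (auto simp: is_fo_structure_def)
  show "\<forall>\<^sub>F i in \<U>. fn (G i) f (map (\<lambda>a. a i) as) = fn (G i) f (map (\<lambda>a. a i) bs)"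
    if "list_all2 (\<lambda>a b. \<forall>\<^sub>F i in \<U>. a i = b i) as bs" for f as bs
    by (rule eventually_mono[OF eventually_map_eq[OF that]]) simp
qed (auto simp: ultrafilter fo_ultraproduct_def fo_class_def sections_def elim: eventually_mono)

lemma rel_M_cls:
  assumes "set as \<subseteq> S"
  shows "rel M r (map cls as) \<longleftrightarrow> (\<forall>\<^sub>F i in \<U>. rel (G i) r (map (\<lambda>a. a i) as))"
proof -
  have "rel M r (map cls as) \<longleftrightarrow> (\<forall>\<^sub>F i in \<U>. rel (G i) r (map (\<lambda>a. a i) (map (\<lambda>a. rep (cls a)) as)))"
    by (simp add: fo_ultraproduct_def rep_def o_def)
  also have "\<dots> \<longleftrightarrow> (\<forall>\<^sub>F i in \<U>. rel (G i) r (map (\<lambda>a. a i) as))"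
    by (rule eventually_cong[OF eventually_map_eq[OF reps_sim[OF assms]]]) (simp only:)
  finally show ?thesis .
qed

definition fm_at :: "'i \<Rightarrow> (('i \<Rightarrow> 'a) set, 'f, 'r) fo_fm \<Rightarrow> ('a, 'f, 'r) fo_fm" where
  "fm_at i = map_fo_fm (\<lambda>A. rep A i) (\<lambda>f. f) (\<lambda>r. r)"

lemma fm_at_simps:
  "fm_at i (Equal s t) = Equal (trm_at i s) (trm_at i t)"
  "fm_at i (Rel r ts) = Rel r (map (trm_at i) ts)"
  "fm_at i (Neg \<phi>) = Neg (fm_at i \<phi>)"
  "fm_at i (Conj \<phi> \<psi>) = Conj (fm_at i \<phi>) (fm_at i \<psi>)"
  "fm_at i (Exists x \<phi>) = Exists x (fm_at i \<phi>)"
  by (simp_all add: fm_at_def trm_at_def)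

theorem Los:
  assumes "\<And>n. v n \<in> S" "wf_fo L (univ M) \<phi>"
  shows "fo_sat M (\<lambda>n. cls (v n)) \<phi> \<longleftrightarrow> (\<forall>\<^sub>F i in \<U>. fo_sat (G i) (\<lambda>n. v n i) (fm_at i \<phi>))"
  using assms
proof (induction \<phi> arbitrary: v)
  case (Equal s t)
  then show ?case
    using trm_val_M[of v] trm_val_at_section[of v] cls_eq_iff by (simp add: fm_at_simps)
next
  case (Rel r ts)
  then have wf: "\<forall>s\<in>set ts. wf_trm L (univ M) s" by simp
  obtain as where as: "set as \<subseteq> S" "map (trm_val M (\<lambda>n. cls (v n))) ts = map cls as"
    "\<And>i. map (trm_val (G i) (\<lambda>n. v n i)) (map (trm_at i) ts) = map (\<lambda>a. a i) as"
    by (rule trm_vals_M[of v ts, OF Rel.prems(1) wf]) (rule that)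
  show ?case by (simp only: fm_at_simps fo_sat.simps as rel_M_cls[OF as(1)])
next
  case (Neg \<phi>)
  then show ?case using ultrafilter_eventually_not_iff[OF ultra] by (simp add: fm_at_simps)
next
  case (Conj \<phi> \<psi>)
  then show ?case by (simp add: fm_at_simps eventually_conj_iff)
next
  case (Exists x \<phi>)
  have IH: "fo_sat M ((\<lambda>n. cls (v n))(x := cls b)) \<phi> \<longleftrightarrow>
      (\<forall>\<^sub>F i in \<U>. fo_sat (G i) ((\<lambda>n. v n i)(x := b i)) (fm_at i \<phi>))" if "b \<in> S" for b
    unfolding cls_fun_upd component_fun_upd using Exists.prems that by (intro Exists.IH) auto
  have "fo_sat M (\<lambda>n. cls (v n)) (Exists x \<phi>) \<longleftrightarrow>
      (\<exists>b\<in>S. \<forall>\<^sub>F i in \<U>. fo_sat (G i) ((\<lambda>n. v n i)(x := b i)) (fm_at i \<phi>))"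
    using IH by (auto simp: univ_M)
  also have "\<dots> \<longleftrightarrow> (\<forall>\<^sub>F i in \<U>. \<exists>c\<in>univ (G i). fo_sat (G i) ((\<lambda>n. v n i)(x := c)) (fm_at i \<phi>))"
    using eventually_bex_iff_section[of "\<lambda>i. univ (G i)", OF univ_nonempty] by (simp add: sections_def Bex_def)
  finally show ?case by (simp add: fm_at_simps)
qed

lemma fo_sat_internally_separated:
  assumes "\<phi> \<in> fo_fms L M"
  shows "internally_separated \<U> S {a. fo_sat M (\<lambda>_. cls a) \<phi>} {a. fo_sat M (\<lambda>_. cls a) \<phi>}"
  unfolding internally_separated_def
  by (rule exI[of _ "\<lambda>i. {x. fo_sat (G i) (\<lambda>_. x) (fm_at i \<phi>)}"])
    (use Los[of "\<lambda>_. _" \<phi>] assms in \<open>auto simp: fo_fms_def\<close>)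

lemma ultrafilter_type:
  assumes F: "ultrafilter F" "\<forall>\<^sub>F a in F. a \<in> S"
  shows "{\<phi> \<in> fo_fms L M. \<forall>\<^sub>F a in F. fo_sat M (\<lambda>_. cls a) \<phi>} \<in> fo_types L M" (is "?p \<in> _")
proof -
  have "\<exists>A\<in>univ M. \<forall>\<phi>\<in>\<Phi>. fo_sat M (\<lambda>_. A) \<phi>" if "finite \<Phi>" "\<Phi> \<subseteq> ?p" for \<Phi>
  proof -
    have "\<forall>\<^sub>F a in F. \<forall>\<phi>\<in>\<Phi>. fo_sat M (\<lambda>_. cls a) \<phi>" using that by (intro eventually_ball_finite) auto
    then have "\<forall>\<^sub>F a in F. a \<in> S \<and> (\<forall>\<phi>\<in>\<Phi>. fo_sat M (\<lambda>_. cls a) \<phi>)"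
      using F(2) by (rule eventually_elim2) blast
    from eventually_happens'[OF ultrafilter_imp_not_bot[OF F(1)] this] show ?thesis by (auto simp: univ_M)
  qed
  moreover have "\<phi> \<in> ?p \<or> Neg \<phi> \<in> ?p" if "\<phi> \<in> fo_fms L M" for \<phi>
    using that ultrafilter_eventually_not_iff[OF F(1), of "\<lambda>a. fo_sat M (\<lambda>_. cls a) \<phi>"] by (auto simp: fo_fms_def)
  ultimately show ?thesis unfolding fo_types_def by (intro CollectI conjI) auto
qed

lemma fo_tp_internally_separated:
  assumes "closedin (fo_type_space L M) D" "openin (fo_type_space L M) N" "D \<subseteq> N"
  shows "internally_separated \<U> S ((\<lambda>a. fo_tp L M (cls a)) -` D) ((\<lambda>a. fo_tp L M (cls a)) -` N)"
proof (rule internally_separated_vimage[OF ultra _ assms])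
  fix F assume F: "ultrafilter F" "\<forall>\<^sub>F a in F. a \<in> S"
  let ?p = "{\<phi> \<in> fo_fms L M. \<forall>\<^sub>F a in F. fo_sat M (\<lambda>_. cls a) \<phi>}"
  show "\<exists>p\<in>topspace (fo_type_space L M). \<forall>Q. openin (fo_type_space L M) Q \<longrightarrow> p \<in> Q \<longrightarrow>
      (\<exists>P. (\<forall>\<^sub>F a in F. a \<in> P) \<and> internally_separated \<U> S P ((\<lambda>a. fo_tp L M (cls a)) -` Q))"
  proof (intro bexI[of _ ?p] allI impI)
    show "?p \<in> topspace (fo_type_space L M)" using ultrafilter_type[OF F] by (simp add: topspace_fo_type_space)
    fix Q assume Q: "openin (fo_type_space L M) Q" "?p \<in> Q"
    obtain \<phi> where \<phi>: "\<phi> \<in> fo_fms L M" "\<phi> \<in> ?p" "{q \<in> fo_types L M. \<phi> \<in> q} \<subseteq> Q"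
      by (rule openin_fo_type_space_imp_formula[OF Q]) (rule that)
    have "fo_tp L M (cls a) \<in> Q" if "a \<in> S" "fo_sat M (\<lambda>_. cls a) \<phi>" for a
      using \<phi>(1,3) that fo_tp_in_types[OF cls_in_univ[OF that(1)]] by (auto simp: fo_tp_def)
    then have "internally_separated \<U> S {a. fo_sat M (\<lambda>_. cls a) \<phi>} ((\<lambda>a. fo_tp L M (cls a)) -` Q)"
      by (intro internally_separated_mono[OF fo_sat_internally_separated[OF \<phi>(1)]]) auto
    then show "\<exists>P. (\<forall>\<^sub>F a in F. a \<in> P) \<and> internally_separated \<U> S P ((\<lambda>a. fo_tp L M (cls a)) -` Q)"
      using \<phi>(2) by (intro exI[of _ "{a. fo_sat M (\<lambda>_. cls a) \<phi>}"]) simp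
  qed
qed

lemma fo_definable_internally_separated:
  assumes "fo_definable_map L M T \<tau>" "closedin T D" "openin T N" "D \<subseteq> N"
  shows "internally_separated \<U> S ((\<lambda>a. \<tau> (cls a)) -` D) ((\<lambda>a. \<tau> (cls a)) -` N)"
proof -
  obtain g where g: "continuous_map (fo_type_space L M) T g" "\<And>A. A \<in> univ M \<Longrightarrow> g (fo_tp L M A) = \<tau> A"
    using assms(1) unfolding fo_definable_map_def by blast
  show ?thesis
    by (rule internally_separated_continuous_map[OF g(1) _ _ fo_tp_internally_separated assms(2-4)])
      (simp_all add: g(2) cls_in_univ fo_tp_in_types topspace_fo_type_space)
qed

end

section \<open>Continuous logic\<close>

lemma SUP_ultralimit:
  fixes f :: "'i \<Rightarrow> 'a \<Rightarrow> real"
  assumes U: "ultrafilter U" and A: "\<And>i. A i \<noteq> {}" and bound: "\<And>i x. x \<in> A i \<Longrightarrow> \<bar>f i x\<bar> \<le> B"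
    and lim: "\<And>a. a \<in> sections A \<Longrightarrow> ((\<lambda>i. f i (a i)) \<longlongrightarrow> l a) U"
  shows "((\<lambda>i. SUP x\<in>A i. f i x) \<longlongrightarrow> (SUP a\<in>sections A. l a)) U"
proof -
  define s where "s i = (SUP x\<in>A i. f i x)" for i
  have bdd: "bdd_above (f i ` A i)" for i
    by (rule bdd_aboveI2[of _ _ B]) (use bound in \<open>auto simp: abs_le_iff\<close>)
  have "\<bar>s i\<bar> \<le> B" for i unfolding s_def using A bound by (intro cSup_abs_le) auto
  then have s: "(s \<longlongrightarrow> Lim U s) U" by (intro ultrafilter_bounded_tendsto[OF U, of _ B] always_eventually allI)
  note nontrivial = ultrafilter_imp_not_bot[OF U]
  have "(SUP a\<in>sections A. l a) = Lim U s"
  proof (rule cSup_eq_non_empty)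
    have "\<exists>a. \<forall>i. a i \<in> A i" by (rule choice) (use A in blast)
    then show "l ` sections A \<noteq> {}" by (auto simp: sections_def)
    show "y \<le> Lim U s" if y: "y \<in> l ` sections A" for y
    proof -
      obtain a where a: "a \<in> sections A" "y = l a" using y by blast
      have "f i (a i) \<le> s i" for i unfolding s_def using sectionsD[OF a(1)] bdd by (rule cSUP_upper)
      then have "l a \<le> Lim U s"
        by (intro tendsto_le[OF nontrivial s lim[OF a(1)]] always_eventually allI)
      then show ?thesis by (simp only: a(2))
    qed
    fix y assume y: "\<And>z. z \<in> l ` sections A \<Longrightarrow> z \<le> y"
    show "Lim U s \<le> y"
    proof (rule field_le_epsilon)
      fix e :: real assume "0 < e"
      then have "\<forall>i. \<exists>x\<in>A i. s i - e < f i x" by (simp add: s_def flip: less_cSUP_iff[OF A bdd])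
      then obtain a where a: "\<And>i. a i \<in> A i" "\<And>i. s i - e < f i (a i)" by metis
      have "a \<in> sections A" using a(1) by (simp add: sections_def)
      then have "Lim U s - e \<le> l a"
        by (rule tendsto_le[OF nontrivial lim tendsto_diff[OF s tendsto_const] always_eventually])
          (simp add: a(2) less_imp_le)
      also have "l a \<le> y" using y \<open>a \<in> sections A\<close> by blast
      finally show "Lim U s \<le> y + e" by simp
    qed
  qed
  then show ?thesis using s by (simp add: s_def[abs_def])
qed

lemma INF_ultralimit:
  fixes f :: "'i \<Rightarrow> 'a \<Rightarrow> real"
  assumes U: "ultrafilter U" and A: "\<And>i. A i \<noteq> {}" and bound: "\<And>i x. x \<in> A i \<Longrightarrow> \<bar>f i x\<bar> \<le> B"
    and lim: "\<And>a. a \<in> sections A \<Longrightarrow> ((\<lambda>i. f i (a i)) \<longlongrightarrow> l a) U"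
  shows "((\<lambda>i. INF x\<in>A i. f i x) \<longlongrightarrow> (INF a\<in>sections A. l a)) U"
  using tendsto_minus[OF SUP_ultralimit[where f = "\<lambda>i x. - f i x" and B = B and l = "\<lambda>a. - l a", OF U A]] bound tendsto_minus[OF lim]
  by (simp add: Inf_real_def image_image)

lemma continuous_map_Euclidean_space_bounded:
  assumes "continuous_map (Euclidean_space m) euclideanreal u"
  obtains B where "\<And>x. x \<in> topspace (Euclidean_space m) \<Longrightarrow> \<forall>i<m. \<bar>x i\<bar> \<le> d \<Longrightarrow> \<bar>u x\<bar> \<le> B"
proof -
  have "compactin euclideanreal (u ` {x \<in> topspace (Euclidean_space m). \<forall>i<m. \<bar>x i\<bar> \<le> d})"
    using compactin_Euclidean_space_box assms by (rule image_compactin)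
  then have "bounded (u ` {x \<in> topspace (Euclidean_space m). \<forall>i<m. \<bar>x i\<bar> \<le> d})"
    by (simp add: compact_imp_bounded)
  then show ?thesis using that by (auto simp: bounded_iff)
qed

lemma metric_val_Conn:
  "metric_val M v (Conn u \<phi>s) = u (\<lambda>k. if k < length \<phi>s then metric_val M v (\<phi>s ! k) else 0)"
  unfolding metric_val.simps by (rule arg_cong[of _ _ u]) auto

lemma topspace_metric_type_space: "topspace (metric_type_space L M) = metric_types L M"
  by (auto simp: metric_type_space_def metric_types_def PiE_def)

lemma metric_tp_apply: "\<phi> \<in> metric_fms L M \<Longrightarrow> metric_tp L M a \<phi> = metric_val M (\<lambda>_. a) \<phi>"
  by (simp add: metric_tp_def)

lemma metric_tp_in_types:
  assumes "a \<in> univ M"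
  shows "metric_tp L M a \<in> metric_types L M"
proof -
  have "\<exists>b\<in>univ M. \<forall>\<phi>\<in>\<Phi>. \<bar>metric_val M (\<lambda>_. b) \<phi> - metric_tp L M a \<phi>\<bar> < \<epsilon>"
    if "\<Phi> \<subseteq> metric_fms L M" "0 < \<epsilon>" for \<Phi> \<epsilon>
    using that assms by (intro bexI[of _ a]) (auto simp: metric_tp_apply)
  then show ?thesis by (simp add: metric_types_def metric_tp_def)
qed

lemma openin_metric_type_space_contains_box:
  assumes "openin (metric_type_space L M) Q" "p \<in> Q"
  obtains \<Phi> \<epsilon> where "finite \<Phi>" "\<Phi> \<subseteq> metric_fms L M" "0 < \<epsilon>"
    "{q \<in> metric_types L M. \<forall>\<phi>\<in>\<Phi>. \<bar>q \<phi> - p \<phi>\<bar> < \<epsilon>} \<subseteq> Q"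
proof -
  obtain S where S: "openin (product_topology (\<lambda>_. euclideanreal) (metric_fms L M)) S" "Q = S \<inter> metric_types L M"
    using assms(1) unfolding metric_type_space_def openin_subtopology by blast
  then have "p \<in> S" using assms(2) by blast
  with S(1) obtain \<Phi> \<epsilon> where \<Phi>: "finite \<Phi>" "\<Phi> \<subseteq> metric_fms L M" "0 < \<epsilon>"
    and box: "{q \<in> extensional (metric_fms L M). \<forall>\<phi>\<in>\<Phi>. \<bar>q \<phi> - p \<phi>\<bar> < \<epsilon>} \<subseteq> S"
    by (rule product_topology_real_contains_box)
  have "metric_types L M \<subseteq> extensional (metric_fms L M)" unfolding metric_types_def by (rule Collect_restrict)
  with box have "{q \<in> metric_types L M. \<forall>\<phi>\<in>\<Phi>. \<bar>q \<phi> - p \<phi>\<bar> < \<epsilon>} \<subseteq> Q" unfolding S(2) by blast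
  with \<Phi> show ?thesis by (rule that)
qed

locale metric_structure_family =
  fixes \<U> :: "'i filter" and L :: "('f, 'r) metric_lang" and G :: "'i \<Rightarrow> ('a, 'f, 'r) metric_structure"
  assumes ultrafilter: "ultrafilter \<U>" and lang: "is_metric_lang L" and struct: "is_metric_structure L (G i)"
begin

abbreviation "M \<equiv> metric_ultraproduct \<U> G"

lemma metric: "Metric_space (univ (G i)) (metr (G i))"
  using struct[of i] by (simp add: is_metric_structure_def)

lemmas metr_nonneg = Metric_space.nonneg[OF metric]
  and metr_commute = Metric_space.commute[OF metric]
  and metr_triangle = Metric_space.triangle[OF metric]

lemma metr_bound: "x \<in> univ (G i) \<Longrightarrow> y \<in> univ (G i) \<Longrightarrow> \<bar>metr (G i) x y\<bar> \<le> diam_bound L"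
  using struct[of i] metr_nonneg[of i x y] by (simp add: is_metric_structure_def)

lemma pred_bound:
  assumes "r \<in> rel_syms L" "xs \<in> tuples (univ (G i)) (rel_arity L r)"
  shows "\<bar>pred (G i) r xs\<bar> \<le> max \<bar>pred_lo L r\<bar> \<bar>pred_hi L r\<bar>"
proof -
  have "pred (G i) r xs \<in> {pred_lo L r .. pred_hi L r}"
    using struct[of i] assms by (simp add: is_metric_structure_def)
  then show ?thesis by auto
qed

lemma fn_modulus:
  assumes "f \<in> fun_syms L" "0 < \<epsilon>" "xs \<in> tuples (univ (G i)) (fun_arity L f)"
    "ys \<in> tuples (univ (G i)) (fun_arity L f)"
    "\<forall>k<fun_arity L f. metr (G i) (xs ! k) (ys ! k) < fun_modulus L f \<epsilon>"
  shows "metr (G i) (fn (G i) f xs) (fn (G i) f ys) \<le> \<epsilon>"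
  using struct[of i] assms unfolding is_metric_structure_def by blast

lemma pred_modulus:
  assumes "r \<in> rel_syms L" "0 < \<epsilon>" "xs \<in> tuples (univ (G i)) (rel_arity L r)"
    "ys \<in> tuples (univ (G i)) (rel_arity L r)"
    "\<forall>k<rel_arity L r. metr (G i) (xs ! k) (ys ! k) < metric_lang.pred_modulus L r \<epsilon>"
  shows "\<bar>pred (G i) r xs - pred (G i) r ys\<bar> \<le> \<epsilon>"
  using struct[of i] assms unfolding is_metric_structure_def by blast

definition infclose :: "('i \<Rightarrow> 'a) \<Rightarrow> ('i \<Rightarrow> 'a) \<Rightarrow> bool" where
  "infclose a b \<longleftrightarrow> ((\<lambda>i. metr (G i) (a i) (b i)) \<longlongrightarrow> 0) \<U>"

lemma infclose_trans:
  assumes ab: "infclose a b" and bc: "infclose b c"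
    and abc: "a \<in> sections (\<lambda>i. univ (G i))" "b \<in> sections (\<lambda>i. univ (G i))" "c \<in> sections (\<lambda>i. univ (G i))"
  shows "infclose a c"
  unfolding infclose_def
proof (rule Lim_null_comparison[OF always_eventually], rule allI)
  show "norm (metr (G i) (a i) (c i)) \<le> metr (G i) (a i) (b i) + metr (G i) (b i) (c i)" for i
    using metr_triangle[OF abc[THEN sectionsD]] metr_nonneg by simp
  show "((\<lambda>i. metr (G i) (a i) (b i) + metr (G i) (b i) (c i)) \<longlongrightarrow> 0) \<U>"
    using tendsto_add[OF ab[unfolded infclose_def] bc[unfolded infclose_def]] by simp
qed

lemma tendsto_0_if_modulus:
  fixes d \<delta> :: "_ \<Rightarrow> real"
  assumes close: "list_all2 infclose as bs" and \<delta>: "\<And>\<epsilon>. 0 < \<epsilon> \<Longrightarrow> 0 < \<delta> \<epsilon>"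
    and modulus: "\<And>i \<epsilon>. 0 < \<epsilon> \<Longrightarrow> \<forall>k<length as. metr (G i) ((as ! k) i) ((bs ! k) i) < \<delta> \<epsilon> \<Longrightarrow> \<bar>d i\<bar> \<le> \<epsilon>"
  shows "(d \<longlongrightarrow> 0) \<U>"
proof (rule tendstoI)
  fix \<epsilon> :: real assume \<epsilon>: "0 < \<epsilon>"
  have "\<forall>\<^sub>F i in \<U>. metr (G i) ((as ! k) i) ((bs ! k) i) < \<delta> (\<epsilon> / 2)" if "k < length as" for k
  proof -
    have "infclose (as ! k) (bs ! k)" using close that by (rule list_all2_nthD)
    then show ?thesis using \<delta> \<epsilon> unfolding infclose_def by (intro order_tendstoD(2)[of _ 0]) auto
  qed
  then have "\<forall>\<^sub>F i in \<U>. \<forall>k\<in>{..<length as}. metr (G i) ((as ! k) i) ((bs ! k) i) < \<delta> (\<epsilon> / 2)"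
    by (intro eventually_ball_finite) auto
  then show "\<forall>\<^sub>F i in \<U>. dist (d i) 0 < \<epsilon>"
  proof eventually_elim
    case (elim i)
    then have "\<bar>d i\<bar> \<le> \<epsilon> / 2" using \<epsilon> by (intro modulus) auto
    then show ?case using \<epsilon> by simp
  qed
qed

sublocale structure_ultraproduct \<U> L G M infclose
proof
  show "infclose a a" if "a \<in> sections (\<lambda>i. univ (G i))" for a
  proof -
    have "metr (G i) (a i) (a i) = 0" for i using sectionsD[OF that] Metric_space.zero[OF metric] by blast
    then show ?thesis by (simp add: infclose_def)
  qed
  show "infclose b a" if "infclose a b" for a b using that by (simp add: infclose_def metr_commute)
  show "infclose a c" if "infclose a b" "infclose b c" "a \<in> sections (\<lambda>i. univ (G i))"
    "b \<in> sections (\<lambda>i. univ (G i))" "c \<in> sections (\<lambda>i. univ (G i))" for a b c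
    using that by (rule infclose_trans)
  show "univ (G i) \<noteq> {}" for i using struct[of i] by (simp add: is_metric_structure_def)
  show "fn (G i) f xs \<in> univ (G i)"
    if "f \<in> fun_syms L" "xs \<in> tuples (univ (G i)) (fun_arity L f)" for f xs i
    using struct[of i] that by (simp add: is_metric_structure_def)
  show "infclose (\<lambda>i. fn (G i) f (map (\<lambda>a. a i) as)) (\<lambda>i. fn (G i) f (map (\<lambda>a. a i) bs))"
    if f: "f \<in> fun_syms L" "length as = fun_arity L f" and ab: "set as \<subseteq> sections (\<lambda>i. univ (G i))"
      "set bs \<subseteq> sections (\<lambda>i. univ (G i))" and close: "list_all2 infclose as bs" for f as bs
    unfolding infclose_def
  proof (rule tendsto_0_if_modulus[OF close])
    note len = list_all2_lengthD[OF close]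
    show "0 < fun_modulus L f \<epsilon>" if "0 < \<epsilon>" for \<epsilon> using lang f that by (simp add: is_metric_lang_def)
    show "\<bar>metr (G i) (fn (G i) f (map (\<lambda>a. a i) as)) (fn (G i) f (map (\<lambda>a. a i) bs))\<bar> \<le> \<epsilon>"
      if "0 < \<epsilon>" "\<forall>k<length as. metr (G i) ((as ! k) i) ((bs ! k) i) < fun_modulus L f \<epsilon>" for i \<epsilon>
      using fn_modulus[OF f(1) that(1), of "map (\<lambda>a. a i) as" i "map (\<lambda>a. a i) bs"] that(2) f(2) ab len
        metr_nonneg by (auto simp: tuples_def sections_def subset_iff)
  qed
qed (auto simp: ultrafilter metric_ultraproduct_def metric_class_def infclose_def sections_def)

lemma pred_M_cls:
  assumes r: "r \<in> rel_syms L" "length as = rel_arity L r" and as: "set as \<subseteq> S"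
  shows "((\<lambda>i. pred (G i) r (map (\<lambda>a. a i) as)) \<longlongrightarrow> pred M r (map cls as)) \<U>"
proof -
  let ?rs = "map (\<lambda>a. rep (cls a)) as"
  have tuples: "map (\<lambda>a. a i) as \<in> tuples (univ (G i)) (rel_arity L r)"
    "map (\<lambda>a. a i) ?rs \<in> tuples (univ (G i)) (rel_arity L r)" for i
    using section_tuple[OF as] section_tuple[OF reps_sections[OF as]] r(2) by simp_all
  have "((\<lambda>i. pred (G i) r (map (\<lambda>a. a i) ?rs)) \<longlongrightarrow> Lim \<U> (\<lambda>i. pred (G i) r (map (\<lambda>a. a i) ?rs))) \<U>"
    by (rule ultrafilter_bounded_tendsto[OF ultra always_eventually]) (use pred_bound[OF r(1) tuples(2)] in blast)
  moreover have "((\<lambda>i. pred (G i) r (map (\<lambda>a. a i) ?rs) - pred (G i) r (map (\<lambda>a. a i) as)) \<longlongrightarrow> 0) \<U>"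
  proof (rule tendsto_0_if_modulus[OF reps_sim[OF as]])
    show "0 < metric_lang.pred_modulus L r \<epsilon>" if "0 < \<epsilon>" for \<epsilon>
      using lang r(1) that by (simp add: is_metric_lang_def)
    show "\<bar>pred (G i) r (map (\<lambda>a. a i) ?rs) - pred (G i) r (map (\<lambda>a. a i) as)\<bar> \<le> \<epsilon>"
      if "0 < \<epsilon>" "\<forall>k<length ?rs. metr (G i) ((?rs ! k) i) ((as ! k) i) < metric_lang.pred_modulus L r \<epsilon>" for i \<epsilon>
      using that r(2) by (intro pred_modulus[OF r(1) _ tuples(2,1)]) auto
  qed
  ultimately have "((\<lambda>i. pred (G i) r (map (\<lambda>a. a i) as)) \<longlongrightarrow> Lim \<U> (\<lambda>i. pred (G i) r (map (\<lambda>a. a i) ?rs))) \<U>"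
    by (rule Lim_transform2)
  then show ?thesis by (simp add: metric_ultraproduct_def rep_def o_def)
qed

lemma metr_diff_le:
  assumes "x \<in> univ (G i)" "y \<in> univ (G i)" "x' \<in> univ (G i)" "y' \<in> univ (G i)"
  shows "\<bar>metr (G i) x' y' - metr (G i) x y\<bar> \<le> metr (G i) x' x + metr (G i) y' y"
  using metr_triangle[of x i x' y'] metr_triangle[of x i y' y] metr_triangle[of x' i x y'] metr_triangle[of x i y y']
    metr_commute[of i x x'] metr_commute[of i y y'] assms by linarith

lemma metr_M_cls:
  assumes a: "a \<in> S" and b: "b \<in> S"
  shows "((\<lambda>i. metr (G i) (a i) (b i)) \<longlongrightarrow> metr M (cls a) (cls b)) \<U>"
proof -
  let ?a = "rep (cls a)" and ?b = "rep (cls b)"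
  note reps = sectionsD[OF rep_cls(1)[OF a]] sectionsD[OF rep_cls(1)[OF b]]
  have "((\<lambda>i. metr (G i) (?a i) (?b i)) \<longlongrightarrow> Lim \<U> (\<lambda>i. metr (G i) (?a i) (?b i))) \<U>"
    by (rule ultrafilter_bounded_tendsto[OF ultra always_eventually]) (use metr_bound[OF reps] in blast)
  moreover have "((\<lambda>i. metr (G i) (?a i) (?b i) - metr (G i) (a i) (b i)) \<longlongrightarrow> 0) \<U>"
  proof (rule Lim_null_comparison[OF always_eventually], rule allI)
    show "norm (metr (G i) (?a i) (?b i) - metr (G i) (a i) (b i))
        \<le> metr (G i) (?a i) (a i) + metr (G i) (?b i) (b i)" for i
      using metr_diff_le[OF sectionsD[OF a] sectionsD[OF b] reps] by simp
    show "((\<lambda>i. metr (G i) (?a i) (a i) + metr (G i) (?b i) (b i)) \<longlongrightarrow> 0) \<U>"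
      using rep_cls(2)[OF a] rep_cls(2)[OF b] unfolding infclose_def by (rule tendsto_add_zero)
  qed
  ultimately have "((\<lambda>i. metr (G i) (a i) (b i)) \<longlongrightarrow> Lim \<U> (\<lambda>i. metr (G i) (?a i) (?b i))) \<U>"
    by (rule Lim_transform2)
  then show ?thesis by (simp add: metric_ultraproduct_def rep_def)
qed

definition fm_at :: "'i \<Rightarrow> (('i \<Rightarrow> 'a) set, 'f, 'r) metric_fm \<Rightarrow> ('a, 'f, 'r) metric_fm" where
  "fm_at i = map_metric_fm (\<lambda>A. rep A i) (\<lambda>f. f) (\<lambda>r. r)"

lemma fm_at_simps:
  "fm_at i (Dist s t) = Dist (trm_at i s) (trm_at i t)"
  "fm_at i (Pred r ts) = Pred r (map (trm_at i) ts)"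
  "fm_at i (Conn u \<phi>s) = Conn u (map (fm_at i) \<phi>s)"
  "fm_at i (SupQ x \<phi>) = SupQ x (fm_at i \<phi>)"
  "fm_at i (InfQ x \<phi>) = InfQ x (fm_at i \<phi>)"
  by (simp_all add: fm_at_def trm_at_def)

definition uniformly_bounded :: "(('i \<Rightarrow> 'a) set, 'f, 'r) metric_fm \<Rightarrow> real \<Rightarrow> bool" where
  "uniformly_bounded \<phi> B \<longleftrightarrow>
     (\<forall>i w. (\<forall>n. w n \<in> univ (G i)) \<longrightarrow> \<bar>metric_val (G i) w (fm_at i \<phi>)\<bar> \<le> B)"

lemma uniformly_boundedD:
  "uniformly_bounded \<phi> B \<Longrightarrow> (\<And>n. w n \<in> univ (G i)) \<Longrightarrow> \<bar>metric_val (G i) w (fm_at i \<phi>)\<bar> \<le> B"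
  by (simp add: uniformly_bounded_def)

lemma Conn_uniformly_bounded:
  assumes u: "continuous_map (Euclidean_space (length \<phi>s)) euclideanreal u"
    and "\<And>\<phi>. \<phi> \<in> set \<phi>s \<Longrightarrow> \<exists>B. uniformly_bounded \<phi> B"
  shows "\<exists>B. uniformly_bounded (Conn u \<phi>s) B"
proof -
  obtain B where B: "\<And>\<phi>. \<phi> \<in> set \<phi>s \<Longrightarrow> uniformly_bounded \<phi> (B \<phi>)" using assms(2) by metis
  define d where "d = Max (B ` set \<phi>s)"
  obtain B' where B': "\<And>x. x \<in> topspace (Euclidean_space (length \<phi>s)) \<Longrightarrow> \<forall>k<length \<phi>s. \<bar>x k\<bar> \<le> d \<Longrightarrow> \<bar>u x\<bar> \<le> B'"
    by (rule continuous_map_Euclidean_space_bounded[OF u, of d]) blast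
  have "\<bar>metric_val (G i) w (fm_at i (Conn u \<phi>s))\<bar> \<le> B'" if w: "\<forall>n. w n \<in> univ (G i)" for i w
    unfolding fm_at_simps metric_val_Conn length_map
  proof (rule B')
    have "\<bar>metric_val (G i) w (fm_at i (\<phi>s ! k))\<bar> \<le> d" if k: "k < length \<phi>s" for k
    proof -
      have "\<bar>metric_val (G i) w (fm_at i (\<phi>s ! k))\<bar> \<le> B (\<phi>s ! k)"
        using w by (intro uniformly_boundedD[OF B[OF nth_mem[OF k]]]) simp
      also have "\<dots> \<le> d" unfolding d_def using k by (intro Max_ge) auto
      finally show ?thesis .
    qed
    then show "\<forall>k<length \<phi>s. \<bar>if k < length \<phi>s then metric_val (G i) w (map (fm_at i) \<phi>s ! k) else 0\<bar> \<le> d" by simp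
  qed (simp add: topspace_Euclidean_space)
  then show ?thesis by (auto simp: uniformly_bounded_def)
qed

lemma metric_fm_uniformly_bounded:
  assumes "wf_metric L (univ M) \<phi>"
  shows "\<exists>B. uniformly_bounded \<phi> B"
  using assms
proof (induction \<phi>)
  case (Dist s t)
  then have "uniformly_bounded (Dist s t) (diam_bound L)"
    unfolding uniformly_bounded_def fm_at_simps metric_val.simps
    by (intro allI impI metr_bound) (auto intro!: trm_val_at_closed)
  then show ?case ..
next
  case (Pred r ts)
  have "\<bar>metric_val (G i) w (fm_at i (Pred r ts))\<bar> \<le> max \<bar>pred_lo L r\<bar> \<bar>pred_hi L r\<bar>"
    if w: "\<forall>n. w n \<in> univ (G i)" for i w
  proof -
    have "map (trm_val (G i) w) (map (trm_at i) ts) \<in> tuples (univ (G i)) (rel_arity L r)"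
      using Pred trm_val_at_closed[of w i] w by (auto simp: tuples_def)
    from pred_bound[OF _ this] show ?thesis using Pred by (simp add: fm_at_simps)
  qed
  then show ?case by (auto simp: uniformly_bounded_def)
next
  case (Conn u \<phi>s)
  then show ?case by (intro Conn_uniformly_bounded) auto
next
  case (SupQ x \<phi>)
  then obtain B where B: "uniformly_bounded \<phi> B" by auto
  have "uniformly_bounded (SupQ x \<phi>) B"
    unfolding uniformly_bounded_def fm_at_simps metric_val.simps
    by (intro allI impI cSup_abs_le) (auto simp: univ_nonempty intro!: uniformly_boundedD[OF B])
  then show ?case ..
next
  case (InfQ x \<phi>)
  then obtain B where B: "uniformly_bounded \<phi> B" by auto
  have "uniformly_bounded (InfQ x \<phi>) B"
    unfolding uniformly_bounded_def fm_at_simps metric_val.simps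
    by (intro allI impI cInf_abs_ge) (auto simp: univ_nonempty intro!: uniformly_boundedD[OF B])
  then show ?case ..
qed

lemma Conn_ultralimit:
  assumes u: "continuous_map (Euclidean_space (length \<phi>s)) euclideanreal u"
    and lim: "\<And>\<phi>. \<phi> \<in> set \<phi>s \<Longrightarrow>
      ((\<lambda>i. metric_val (G i) (w i) (fm_at i \<phi>)) \<longlongrightarrow> metric_val M v \<phi>) \<U>"
  shows "((\<lambda>i. metric_val (G i) (w i) (fm_at i (Conn u \<phi>s))) \<longlongrightarrow> metric_val M v (Conn u \<phi>s)) \<U>"
proof -
  let ?x = "\<lambda>i k. if k < length \<phi>s then metric_val (G i) (w i) (map (fm_at i) \<phi>s ! k) else 0"
  let ?y = "\<lambda>k. if k < length \<phi>s then metric_val M v (\<phi>s ! k) else 0"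
  have "limitin (Euclidean_space (length \<phi>s)) ?x ?y \<U>"
    by (rule limitin_Euclidean_space) (simp_all add: lim topspace_Euclidean_space)
  from continuous_map_limit[OF u this] show ?thesis
    unfolding fm_at_simps metric_val_Conn length_map o_def limitin_canonical_iff .
qed

theorem Los:
  assumes "\<And>n. v n \<in> S" "wf_metric L (univ M) \<phi>"
  shows "((\<lambda>i. metric_val (G i) (\<lambda>n. v n i) (fm_at i \<phi>)) \<longlongrightarrow> metric_val M (\<lambda>n. cls (v n)) \<phi>) \<U>"
  using assms
proof (induction \<phi> arbitrary: v)
  case (Dist s t)
  then show ?case
    using trm_val_M[of v] trm_val_at_section[of v] metr_M_cls by (simp add: fm_at_simps)
next
  case (Pred r ts)
  then have wf: "\<forall>s\<in>set ts. wf_trm L (univ M) s" "r \<in> rel_syms L" "length ts = rel_arity L r"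
    by simp_all
  obtain as where as: "set as \<subseteq> S" "length as = length ts" "map (trm_val M (\<lambda>n. cls (v n))) ts = map cls as"
    "\<And>i. map (trm_val (G i) (\<lambda>n. v n i)) (map (trm_at i) ts) = map (\<lambda>a. a i) as"
    by (rule trm_vals_M[of v ts, OF Pred.prems(1) wf(1)]) (rule that)
  show ?case
    unfolding fm_at_simps metric_val.simps as(3,4) using as(1,2) wf(2,3) by (intro pred_M_cls) auto
next
  case (Conn u \<phi>s)
  then show ?case by (intro Conn_ultralimit) auto
next
  case (SupQ x \<phi>)
  then obtain B where B: "uniformly_bounded \<phi> B" using metric_fm_uniformly_bounded[of \<phi>] by auto
  have "((\<lambda>i. SUP c\<in>univ (G i). metric_val (G i) ((\<lambda>n. v n i)(x := c)) (fm_at i \<phi>)) \<longlongrightarrow>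
      (SUP b\<in>S. metric_val M ((\<lambda>n. cls (v n))(x := cls b)) \<phi>)) \<U>"
    by (rule SUP_ultralimit[OF ultra univ_nonempty uniformly_boundedD[OF B]])
      (unfold cls_fun_upd component_fun_upd, use SupQ sectionsD[OF SupQ.prems(1)] in auto)
  then show ?case by (simp add: fm_at_simps univ_M image_image)
next
  case (InfQ x \<phi>)
  then obtain B where B: "uniformly_bounded \<phi> B" using metric_fm_uniformly_bounded[of \<phi>] by auto
  have "((\<lambda>i. INF c\<in>univ (G i). metric_val (G i) ((\<lambda>n. v n i)(x := c)) (fm_at i \<phi>)) \<longlongrightarrow>
      (INF b\<in>S. metric_val M ((\<lambda>n. cls (v n))(x := cls b)) \<phi>)) \<U>"
    by (rule INF_ultralimit[OF ultra univ_nonempty uniformly_boundedD[OF B]])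
      (unfold cls_fun_upd component_fun_upd, use InfQ sectionsD[OF InfQ.prems(1)] in auto)
  then show ?case by (simp add: fm_at_simps univ_M image_image)
qed

lemma metric_val_M_bounded:
  assumes "wf_metric L (univ M) \<phi>"
  obtains B where "\<And>a. a \<in> S \<Longrightarrow> \<bar>metric_val M (\<lambda>_. cls a) \<phi>\<bar> \<le> B"
proof -
  obtain B where B: "uniformly_bounded \<phi> B" using metric_fm_uniformly_bounded[OF assms] ..
  have "\<bar>metric_val M (\<lambda>_. cls a) \<phi>\<bar> \<le> B" if a: "a \<in> S" for a
  proof (rule tendsto_upperbound[OF tendsto_rabs[OF Los] always_eventually ultrafilter_imp_not_bot[OF ultra]])
    show "\<forall>i. \<bar>metric_val (G i) (\<lambda>_. a i) (fm_at i \<phi>)\<bar> \<le> B" by (intro allI uniformly_boundedD[OF B] sectionsD[OF a])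
  qed (use a assms in auto)
  then show ?thesis by (rule that)
qed

definition near :: "(('i \<Rightarrow> 'a) set, 'f, 'r) metric_fm set \<Rightarrow> real \<Rightarrow> ((('i \<Rightarrow> 'a) set, 'f, 'r) metric_fm \<Rightarrow> real) \<Rightarrow>
    ('i \<Rightarrow> 'a) set" where
  "near \<Phi> \<epsilon> p = {a. \<forall>\<phi>\<in>\<Phi>. \<bar>metric_val M (\<lambda>_. cls a) \<phi> - p \<phi>\<bar> < \<epsilon>}"

lemma near_internally_separated:
  assumes \<Phi>: "finite \<Phi>" "\<Phi> \<subseteq> metric_fms L M" and "\<delta> < \<epsilon>"
  shows "internally_separated \<U> S (near \<Phi> \<delta> p) (near \<Phi> \<epsilon> p)"
  unfolding internally_separated_def
proof (intro exI ballI conjI impI)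
  let ?X = "\<lambda>i. {x. \<forall>\<phi>\<in>\<Phi>. \<bar>metric_val (G i) (\<lambda>_. x) (fm_at i \<phi>) - p \<phi>\<bar> < \<delta>}"
  fix a assume a: "a \<in> S"
  have lim: "((\<lambda>i. \<bar>metric_val (G i) (\<lambda>_. a i) (fm_at i \<phi>) - p \<phi>\<bar>) \<longlongrightarrow> \<bar>metric_val M (\<lambda>_. cls a) \<phi> - p \<phi>\<bar>) \<U>"
    if "\<phi> \<in> \<Phi>" for \<phi>
    using that \<Phi>(2) a by (intro tendsto_intros Los) (auto simp: metric_fms_def)
  show "\<forall>\<^sub>F i in \<U>. a i \<in> ?X i" if "a \<in> near \<Phi> \<delta> p"
  proof -
    have "\<forall>\<^sub>F i in \<U>. \<forall>\<phi>\<in>\<Phi>. \<bar>metric_val (G i) (\<lambda>_. a i) (fm_at i \<phi>) - p \<phi>\<bar> < \<delta>"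
      using that by (intro eventually_ball_finite[OF \<Phi>(1)] ballI order_tendstoD(2)[OF lim]) (auto simp: near_def)
    then show ?thesis by simp
  qed
  show "a \<in> near \<Phi> \<epsilon> p" if X: "\<forall>\<^sub>F i in \<U>. a i \<in> ?X i"
  proof -
    have "\<bar>metric_val M (\<lambda>_. cls a) \<phi> - p \<phi>\<bar> < \<epsilon>" if \<phi>: "\<phi> \<in> \<Phi>" for \<phi>
    proof -
      from X have "\<forall>\<^sub>F i in \<U>. \<bar>metric_val (G i) (\<lambda>_. a i) (fm_at i \<phi>) - p \<phi>\<bar> \<le> \<delta>"
        by eventually_elim (use \<phi> in \<open>auto intro: less_imp_le\<close>)
      then have "\<bar>metric_val M (\<lambda>_. cls a) \<phi> - p \<phi>\<bar> \<le> \<delta>"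
        by (rule tendsto_upperbound[OF lim[OF \<phi>] _ ultrafilter_imp_not_bot[OF ultra]])
      then show ?thesis using \<open>\<delta> < \<epsilon>\<close> by linarith
    qed
    then show ?thesis by (simp add: near_def)
  qed
qed

definition type_limit :: "('i \<Rightarrow> 'a) filter \<Rightarrow> (('i \<Rightarrow> 'a) set, 'f, 'r) metric_fm \<Rightarrow> real" where
  "type_limit F = (\<lambda>\<phi>\<in>metric_fms L M. Lim F (\<lambda>a. metric_val M (\<lambda>_. cls a) \<phi>))"

lemma eventually_near_type_limit:
  assumes F: "ultrafilter F" "\<forall>\<^sub>F a in F. a \<in> S"
    and \<Phi>: "finite \<Phi>" "\<Phi> \<subseteq> metric_fms L M" and "0 < \<epsilon>"
  shows "\<forall>\<^sub>F a in F. a \<in> near \<Phi> \<epsilon> (type_limit F)"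
proof -
  have "\<forall>\<^sub>F a in F. \<bar>metric_val M (\<lambda>_. cls a) \<phi> - type_limit F \<phi>\<bar> < \<epsilon>" if "\<phi> \<in> \<Phi>" for \<phi>
  proof -
    have \<phi>: "\<phi> \<in> metric_fms L M" using that \<Phi>(2) by blast
    then have "wf_metric L (univ M) \<phi>" by (simp add: metric_fms_def)
    then obtain B where B: "\<And>a. a \<in> S \<Longrightarrow> \<bar>metric_val M (\<lambda>_. cls a) \<phi>\<bar> \<le> B"
      by (rule metric_val_M_bounded) (rule that)
    from F(2) have "\<forall>\<^sub>F a in F. \<bar>metric_val M (\<lambda>_. cls a) \<phi>\<bar> \<le> B" by eventually_elim (rule B)
    from tendstoD[OF ultrafilter_bounded_tendsto[OF F(1) this] \<open>0 < \<epsilon>\<close>] show ?thesis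
      using \<phi> by (simp add: type_limit_def dist_real_def)
  qed
  then have "\<forall>\<^sub>F a in F. \<forall>\<phi>\<in>\<Phi>. \<bar>metric_val M (\<lambda>_. cls a) \<phi> - type_limit F \<phi>\<bar> < \<epsilon>"
    by (intro eventually_ball_finite[OF \<Phi>(1)]) blast
  then show ?thesis by (simp add: near_def)
qed

lemma type_limit_in_types:
  assumes F: "ultrafilter F" "\<forall>\<^sub>F a in F. a \<in> S"
  shows "type_limit F \<in> metric_types L M"
proof -
  have "\<exists>A\<in>univ M. \<forall>\<phi>\<in>\<Phi>. \<bar>metric_val M (\<lambda>_. A) \<phi> - type_limit F \<phi>\<bar> < \<epsilon>"
    if "finite \<Phi>" "\<Phi> \<subseteq> metric_fms L M" "0 < \<epsilon>" for \<Phi> \<epsilon>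
    using eventually_happens'[OF ultrafilter_imp_not_bot[OF F(1)]
        eventually_conj[OF F(2) eventually_near_type_limit[OF F that]]]
    by (auto simp: near_def univ_M)
  then show ?thesis by (simp add: metric_types_def type_limit_def)
qed

lemma metric_tp_internally_separated:
  assumes "closedin (metric_type_space L M) D" "openin (metric_type_space L M) N" "D \<subseteq> N"
  shows "internally_separated \<U> S ((\<lambda>a. metric_tp L M (cls a)) -` D) ((\<lambda>a. metric_tp L M (cls a)) -` N)"
proof (rule internally_separated_vimage[OF ultra _ assms])
  fix F assume F: "ultrafilter F" "\<forall>\<^sub>F a in F. a \<in> S"
  show "\<exists>p\<in>topspace (metric_type_space L M). \<forall>Q. openin (metric_type_space L M) Q \<longrightarrow> p \<in> Q \<longrightarrow>
      (\<exists>P. (\<forall>\<^sub>F a in F. a \<in> P) \<and> internally_separated \<U> S P ((\<lambda>a. metric_tp L M (cls a)) -` Q))"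
  proof (intro bexI[of _ "type_limit F"] allI impI)
    show "type_limit F \<in> topspace (metric_type_space L M)"
      using type_limit_in_types[OF F] by (simp add: topspace_metric_type_space)
    fix Q assume Q: "openin (metric_type_space L M) Q" "type_limit F \<in> Q"
    obtain \<Phi> \<epsilon> where \<Phi>: "finite \<Phi>" "\<Phi> \<subseteq> metric_fms L M" "0 < \<epsilon>"
      and box: "{q \<in> metric_types L M. \<forall>\<phi>\<in>\<Phi>. \<bar>q \<phi> - type_limit F \<phi>\<bar> < \<epsilon>} \<subseteq> Q"
      by (rule openin_metric_type_space_contains_box[OF Q]) (rule that)
    have "metric_tp L M (cls a) \<in> Q" if "a \<in> S" "a \<in> near \<Phi> \<epsilon> (type_limit F)" for a
      by (rule subsetD[OF box])
        (use \<Phi>(2) that in \<open>auto simp: near_def metric_tp_apply metric_tp_in_types cls_in_univ\<close>)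
    then have "internally_separated \<U> S (near \<Phi> (\<epsilon> / 2) (type_limit F)) ((\<lambda>a. metric_tp L M (cls a)) -` Q)"
      using \<Phi> by (intro internally_separated_mono[OF near_internally_separated[of \<Phi> "\<epsilon> / 2" \<epsilon>]]) auto
    then show "\<exists>P. (\<forall>\<^sub>F a in F. a \<in> P) \<and> internally_separated \<U> S P ((\<lambda>a. metric_tp L M (cls a)) -` Q)"
      using eventually_near_type_limit[OF F \<Phi>(1,2)] \<Phi>(3) half_gt_zero by blast
  qed
qed

lemma metric_definable_internally_separated:
  assumes "metric_definable_map L M T \<tau>" "closedin T D" "openin T N" "D \<subseteq> N"
  shows "internally_separated \<U> S ((\<lambda>a. \<tau> (cls a)) -` D) ((\<lambda>a. \<tau> (cls a)) -` N)"
proof -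
  obtain g where g: "continuous_map (metric_type_space L M) T g" "\<And>A. A \<in> univ M \<Longrightarrow> g (metric_tp L M A) = \<tau> A"
    using assms(1) unfolding metric_definable_map_def by blast
  show ?thesis
    by (rule internally_separated_continuous_map[OF g(1) _ _ metric_tp_internally_separated assms(2-4)])
      (simp_all add: g(2) cls_in_univ metric_tp_in_types topspace_metric_type_space)
qed

end

theorem theorem4p12:
  fixes \<U> :: "'i filter"
    and K :: "('k, 'z) monoid_scheme" and T :: "'k topology"
    and n :: nat and \<A> :: "'k chart set"
  assumes "ultrafilter \<U>" and "countably_incomplete \<U>"
    and "Lie_group n K T \<A>" and "compact_space T"
  shows
    "(\<forall>(L :: ('f, 'r) lang) (G :: 'i \<Rightarrow> ('a, 'f, 'r) fo_structure) \<tau>.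
        extends_group_language L \<and>
        (\<forall>i. is_fo_structure L (G i) \<and> expands_amenable_group L (G i)) \<and>
        \<tau> \<in> hom (group_reduct L (fo_ultraproduct \<U> G)) K \<and>
        fo_definable_map L (fo_ultraproduct \<U> G) T \<tau> \<longrightarrow>
        (\<exists>\<sigma> :: 'i \<Rightarrow> 'a \<Rightarrow> 'k.
           (\<forall>i. \<sigma> i \<in> hom (group_reduct L (G i)) K) \<and>
           (\<forall>A \<in> univ (fo_ultraproduct \<U> G). \<forall>a \<in> A.
              limitin T (\<lambda>i. \<sigma> i (a i)) (\<tau> A) \<U>)))
     \<and>
     (\<forall>(L :: ('f, 'r) metric_lang) (G :: 'i \<Rightarrow> ('a, 'f, 'r) metric_structure) \<tau>.
        is_metric_lang L \<and> extends_group_language L \<and>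
        (\<forall>i. is_metric_structure L (G i) \<and> expands_amenable_group L (G i)) \<and>
        \<tau> \<in> hom (group_reduct L (metric_ultraproduct \<U> G)) K \<and>
        metric_definable_map L (metric_ultraproduct \<U> G) T \<tau> \<longrightarrow>
        (\<exists>\<sigma> :: 'i \<Rightarrow> 'a \<Rightarrow> 'k.
           (\<forall>i. \<sigma> i \<in> hom (group_reduct L (G i)) K) \<and>
           (\<forall>A \<in> univ (metric_ultraproduct \<U> G). \<forall>a \<in> A.
              limitin T (\<lambda>i. \<sigma> i (a i)) (\<tau> A) \<U>)))"
proof -
  have K: "compact_Hausdorff_group K T" "first_countable T"
    "topological_group.Ulam_stable K T {H :: 'a monoid. amenable_group H}"
    using Lie_group_imp_compact_Hausdorff_group[OF assms(3,4)] compact_Lie_group_Ulam_stable[OF assms(3,4)]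
      assms(3) second_countable_imp_first_countable by (auto simp: Lie_group_def)
  show ?thesis
  proof (intro conjI allI impI, goal_cases)
    case (1 L G \<tau>)
    then interpret fo_structure_family \<U> L G using assms(1) by unfold_locales auto
    show ?case
      by (rule homomorphism_limit[OF K assms(2)]) (use 1 fo_definable_internally_separated in auto)
  next
    case (2 L G \<tau>)
    then interpret metric_structure_family \<U> L G using assms(1) by unfold_locales auto
    show ?case
      by (rule homomorphism_limit[OF K assms(2)]) (use 2 metric_definable_internally_separated in auto)
  qed
qed

end
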